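(* Let $\mathbb{K}$ be a field, let $G$ be a graph with vertex set $\{v_1,\dots,v_n\}$ (so $n$ is the number of vertices of $G$), and let $I=I(G)\subseteq S=\mathbb{K}[x_1,\dots,x_n]$ be its edge ideal. Then $S/I^k$ satisfies Stanley's inequality, i.e. $\mathrm{depth}(S/I^k)\leq \mathrm{sdepth}(S/I^k)$, for every integer $k\geq n-1$.
   Context: Graphs are finite and simple with $n\ge 1$ vertices. The edge ideal $I(G)$ is the ideal of $S=\mathbb{K}[x_1,\dots,x_n]$ generated by the squarefree monomials $x_ix_j$ with $\{v_i,v_j\}$ an edge of $G$; $I^0=S$. Depth is taken with respect to the maximal ideal $\mathfrak{m}=(x_1,\dots,x_n)$. Stanley depth: let $M$ be a finitely generated $\mathbb{Z}^n$-graded $S$-module, $u\in M$ a homogeneous element and $Z\subseteq\{x_1,\dots,x_n\}$. The $\mathbb{K}$-subspace $u\mathbb{K}[Z]$ generated by all $uv$ with $v\in\mathbb{K}[Z]$ is called a Stanley space of dimension $|Z|$ if it is a free $\mathbb{K}[Z]$-module. A Stanley decomposition $\mathcal{D}$ of $M$ is a decomposition of $M$ (as a $\mathbb{K}$-vector space) as a finite direct sum of Stanley spaces; $\mathrm{sdepth}(\mathcal{D})$ is the minimum dimension of a Stanley space in $\mathcal{D}$, and $\mathrm{sdepth}(M)$ is the maximum of $\mathrm{sdepth}(\mathcal{D})$ over all Stanley decompositions $\mathcal{D}$ of $M$. Convention: $\mathrm{depth}(0)=\mathrm{sdepth}(0)=+\infty$ (the zero module occurs here only in the degenerate case $n=1$,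 $k=0$). *)

theory Defs
  imports "HOL-Library.Poly_Mapping" "HOL-Library.Extended_Nat"
    "HOL-Algebra.Module" "HOL-Algebra.QuotRing" "HOL-Algebra.Ideal_Product"
begin

section \<open>Polynomial rings and edge ideals\<close>

type_synonym ('v, 'k) mpoly = "('v \<Rightarrow>\<^sub>0 nat) \<Rightarrow>\<^sub>0 'k"

text \<open>\<open>K[x\<^sub>v : v \<in> V]\<close>, inside the polynomials with variables indexed by the whole type.
  It is also used as \<open>K[Z]\<close> for \<open>Z \<subseteq> V\<close>.\<close>

definition mpoly_ring :: "'v set \<Rightarrow> ('v, 'k::field) mpoly ring" where
  "mpoly_ring V =
     \<lparr>carrier = {p. \<forall>a \<in> Poly_Mapping.keys p. Poly_Mapping.keys a \<subseteq> V},
      monoid.mult = (*), monoid.one = 1, ring.zero = 0, ring.add = (+)\<rparr>"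

definition mvar :: "'v \<Rightarrow> ('v, 'k::field) mpoly" where
  "mvar v = Poly_Mapping.single (Poly_Mapping.single v 1) 1"

definition max_ideal :: "'v set \<Rightarrow> ('v, 'k::field) mpoly set" where
  "max_ideal V = Idl\<^bsub>mpoly_ring V\<^esub> (mvar ` V)"

definition simple_graph :: "'v set \<Rightarrow> 'v set set \<Rightarrow> bool" where
  "simple_graph V E \<longleftrightarrow> finite V \<and> (\<forall>e \<in> E. e \<subseteq> V \<and> card e = 2)"

definition edge_ideal :: "'v set \<Rightarrow> 'v set set \<Rightarrow> ('v, 'k::field) mpoly set" where
  "edge_ideal V E = Idl\<^bsub>mpoly_ring V\<^esub> {mvar u * mvar v | u v. {u, v} \<in> E}"

text \<open>Ideals form a monoid under the product of ideals with unit the whole ring, so that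
  the zeroth power is the whole ring.\<close>

definition ideal_power :: "('a, 'b) ring_scheme \<Rightarrow> 'a set \<Rightarrow> nat \<Rightarrow> 'a set" where
  "ideal_power R I k = I [^]\<^bsub>ideals_set R\<^esub> k"

section \<open>The module \<open>R/J\<close>\<close>

text \<open>The quotient ring, with \<open>R\<close> acting through the projection \<open>R \<rightarrow> R/J\<close>.\<close>

definition quot_module :: "('a, 'b) ring_scheme \<Rightarrow> 'a set \<Rightarrow> ('a, 'a set) module" where
  "quot_module R J =
     ring.extend (R Quot J) \<lparr>smult = (\<lambda>r c. (J +>\<^bsub>R\<^esub> r) \<otimes>\<^bsub>R Quot J\<^esub> c)\<rparr>"

section \<open>Depth\<close>

text \<open>The submodule \<open>(f\<^sub>1, \<dots>, f\<^sub>r) M\<close>.\<close>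

definition seq_submodule :: "('a, 'm, 'c) module_scheme \<Rightarrow> 'a list \<Rightarrow> 'm set" where
  "seq_submodule M fs =
     {(\<Oplus>\<^bsub>M\<^esub>j \<in> {..<length fs}. (fs ! j) \<odot>\<^bsub>M\<^esub> m j) | m. m \<in> {..<length fs} \<rightarrow> carrier M}"

text \<open>The middle condition says that each \<open>f\<^sub>i\<close> is a nonzerodivisor on
  \<open>M / (f\<^sub>1, \<dots>, f\<^sub>i\<^sub>-\<^sub>1) M\<close>.\<close>

definition regular_sequence ::
    "('a, 'b) ring_scheme \<Rightarrow> ('a, 'm, 'c) module_scheme \<Rightarrow> 'a list \<Rightarrow> bool" where
  "regular_sequence R M fs \<longleftrightarrow>
     set fs \<subseteq> carrier R \<and>
     (\<forall>i < length fs. \<forall>x \<in> carrier M.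
        (fs ! i) \<odot>\<^bsub>M\<^esub> x \<in> seq_submodule M (take i fs) \<longrightarrow> x \<in> seq_submodule M (take i fs)) \<and>
     seq_submodule M fs \<noteq> carrier M"

text \<open>Depth of \<open>M\<close> with respect to the ideal \<open>\<aa>\<close>. The zero module has no regular sequence in the
  sense above (not even the empty one), hence the separate clause.\<close>

definition depth ::
    "('a, 'b) ring_scheme \<Rightarrow> 'a set \<Rightarrow> ('a, 'm, 'c) module_scheme \<Rightarrow> enat" where
  "depth R \<aa> M =
     (if carrier M = {\<zero>\<^bsub>M\<^esub>} then \<infinity>
      else (SUP fs \<in> {fs. set fs \<subseteq> \<aa> \<and> regular_sequence R M fs}. enat (length fs)))"

section \<open>Stanley depth\<close>

text \<open>A \<open>\<int>\<^sup>n\<close>-grading of a module \<open>M\<close> is represented by its family of graded components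
  \<open>gr d\<close>, for \<open>d\<close> an integer vector indexed by the variables.\<close>

definition homogeneous :: "(('v \<Rightarrow> int) \<Rightarrow> 'm set) \<Rightarrow> 'm \<Rightarrow> bool" where
  "homogeneous gr u \<longleftrightarrow> (\<exists>d. u \<in> gr d)"

definition mpoly_grading :: "'v set \<Rightarrow> ('v \<Rightarrow> int) \<Rightarrow> ('v, 'k::field) mpoly set" where
  "mpoly_grading V d =
     {p \<in> carrier (mpoly_ring V).
        \<forall>a \<in> Poly_Mapping.keys p. \<forall>v. int (Poly_Mapping.lookup a v) = d v}"

text \<open>The grading induced on \<open>S/J\<close>; it is a grading when \<open>J\<close> is a monomial ideal.\<close>

definition quot_grading ::
    "'v set \<Rightarrow> ('v, 'k::field) mpoly set \<Rightarrow> ('v \<Rightarrow> int) \<Rightarrow> ('v, 'k) mpoly set set" where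
  "quot_grading V J d = (\<lambda>p. J +>\<^bsub>mpoly_ring V\<^esub> p) ` mpoly_grading V d"

text \<open>The space \<open>u K[Z]\<close>.\<close>

definition cyclic_space ::
    "(('v, 'k::field) mpoly, 'm, 'c) module_scheme \<Rightarrow> 'm \<Rightarrow> 'v set \<Rightarrow> 'm set" where
  "cyclic_space M u Z = (\<lambda>p. p \<odot>\<^bsub>M\<^esub> u) ` carrier (mpoly_ring Z)"

text \<open>\<open>u K[Z]\<close> is a Stanley space if it is a free \<open>K[Z]\<close>-module with basis \<open>u\<close>.\<close>

definition stanley_space ::
    "'v set \<Rightarrow> (('v, 'k::field) mpoly, 'm, 'c) module_scheme \<Rightarrow> (('v \<Rightarrow> int) \<Rightarrow> 'm set)
     \<Rightarrow> 'm \<Rightarrow> 'v set \<Rightarrow> bool" where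
  "stanley_space V M gr u Z \<longleftrightarrow>
     u \<in> carrier M \<and> homogeneous gr u \<and> Z \<subseteq> V \<and>
     (\<forall>p \<in> carrier (mpoly_ring Z). p \<odot>\<^bsub>M\<^esub> u = \<zero>\<^bsub>M\<^esub> \<longrightarrow> p = 0)"

text \<open>A finite set of pairs \<open>(u, Z)\<close> such that \<open>M\<close> is the internal direct sum of the
  Stanley spaces \<open>u K[Z]\<close>.\<close>

definition stanley_decomposition ::
    "'v set \<Rightarrow> (('v, 'k::field) mpoly, 'm, 'c) module_scheme \<Rightarrow> (('v \<Rightarrow> int) \<Rightarrow> 'm set)
     \<Rightarrow> ('m \<times> 'v set) set \<Rightarrow> bool" where
  "stanley_decomposition V M gr D \<longleftrightarrow>
     finite D \<and>
     (\<forall>(u, Z) \<in> D. stanley_space V M gr u Z) \<and>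
     (\<forall>x \<in> carrier M. \<exists>!s. s \<in> (\<Pi>\<^sub>E (u, Z) \<in> D. cyclic_space M u Z) \<and>
                          x = (\<Oplus>\<^bsub>M\<^esub>i \<in> D. s i))"

text \<open>For the zero module the only Stanley decomposition is the empty one, whose infimum
  is \<open>\<infinity>\<close>.\<close>

definition sdepth ::
    "'v set \<Rightarrow> (('v, 'k::field) mpoly, 'm, 'c) module_scheme \<Rightarrow> (('v \<Rightarrow> int) \<Rightarrow> 'm set) \<Rightarrow> enat"
  where
  "sdepth V M gr =
     (SUP D \<in> {D. stanley_decomposition V M gr D}. INF (u, Z) \<in> D. enat (card Z))"

definition stanley_inequality ::
    "'v set \<Rightarrow> (('v, 'k::field) mpoly, 'm, 'c) module_scheme \<Rightarrow> (('v \<Rightarrow> int) \<Rightarrow> 'm set) \<Rightarrow> bool"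
  where
  "stanley_inequality V M gr \<longleftrightarrow> depth (mpoly_ring V) (max_ideal V) M \<le> sdepth V M gr"

end

theory Submission
  imports Defs
begin

text \<open>Both sides are compared with the number \<open>b\<close> of bipartite connected components of \<open>G\<close>, isolated
  vertices included.

  Every power satisfies \<open>sdepth (S/I\<^sup>k) \<ge> b\<close>. A monomial lies in \<open>I\<^sup>k\<close> iff the packing numbers of its
  exponent in the components add up to at least \<open>k\<close>. In a bipartite component, Koenig's theorem
  gives a minimum vertex cover which is not everything, and raising the exponent of a vertex outside
  it leaves the packing number unchanged. Always using the first such direction in each bipartite
  component cuts the complement of \<open>I\<^sup>k\<close> into finitely many cones of dimension at least \<open>b\<close>.

  For \<open>k \<ge> n - 1\<close>, \<open>depth (S/I\<^sup>k) \<le> b\<close>. There is a monomial \<open>u\<close> such that \<open>S/(I\<^sup>k : u)\<close> is the tensor product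
  over the bipartite components of the rings \<open>K[X, Y]/(X Y)\<close>, with \<open>X\<close> and \<open>Y\<close> the two sides. Each factor
  has a nonzero Koszul cohomology class of degree one, and \<open>u\<close> times the product of these classes is
  nonzero in degree \<open>b\<close> of the Koszul cohomology of \<open>S/I\<^sup>k\<close>; passing to the quotient by a regular
  element lowers the degree of such a class by one.\<close>

section \<open>Koszul cochains\<close>

text \<open>The bound \<open>n - 1\<close> comes from \<open>u\<close>, a product of monomials
  \<open>u_C\<close> over the components \<open>C\<close> that have an edge. \<open>u_C\<close>
  contains \<open>t_C\<close> edges; it is grown vertex by vertex at the price of one edge each,
  which works for every \<open>t_C >= |C| - 2\<close>. The \<open>t_C\<close> must add up to
  \<open>k - 1\<close>, and the numbers \<open>|C| - 2\<close> add up to at most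
  \<open>n - 2\<close>.

  That \<open>u\<close> stays outside the power is a matter of counting. In a bipartite component
  \<open>u_C\<close> has weight \<open>t_C\<close> on each side, so a factor touching only one side
  leaves the other a cover of weight \<open>t_C\<close>. In a nonbipartite one the degree
  \<open>2 t_C + 1\<close> leaves no room for another edge.

  The obstacle for Stanley depth is the disjointness of the cones: the direction chosen at an
  exponent must still be chosen after a move along it. Hence the direction is part of the invariant
  of a block, and it is the least one in a fixed numbering, because a move can only remove
  candidates.

  No cohomology group is computed. An explicit linear functional takes the value 1 on the class and
  vanishes both on coboundaries and on cochains with values in the ideal.\<close>

text \<open>Cochains are arbitrary functions on lists; no alternation is required, which makes the
  differential and the contraction below structurally recursive.\<close>

primrec koszul :: "('v \<Rightarrow> 'a::comm_ring_1) \<Rightarrow> 'v list \<Rightarrow> ('v list \<Rightarrow> 'a) \<Rightarrow> 'a" where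
  "koszul c [] z = 0"
| "koszul c (v # l) z = c v * z l - koszul c l (\<lambda>m. z (v # m))"

definition kdiff :: "('v \<Rightarrow> 'a::comm_ring_1) \<Rightarrow> ('v list \<Rightarrow> 'a) \<Rightarrow> 'v list \<Rightarrow> 'a" where
  "kdiff c z = (\<lambda>l. koszul c l z)"

lemma kdiff_Nil [simp]: "kdiff c z [] = 0"
  and kdiff_Cons [simp]: "kdiff c z (v # l) = c v * z l - kdiff c (\<lambda>m. z (v # m)) l"
  by (simp_all add: kdiff_def)

lemma kdiff_zero [simp]: "kdiff c (\<lambda>l. 0) l = 0"
  by (induction l) auto

lemma kdiff_add: "kdiff c (\<lambda>l. z l + w l) l = kdiff c z l + kdiff c w l"
  by (induction l arbitrary: z w) (auto simp: algebra_simps)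

lemma kdiff_diff: "kdiff c (\<lambda>l. z l - w l) l = kdiff c z l - kdiff c w l"
  by (induction l arbitrary: z w) (auto simp: algebra_simps)

lemma kdiff_mult: "kdiff c (\<lambda>l. r * z l) l = r * kdiff c z l"
  by (induction l arbitrary: z) (auto simp: algebra_simps)

lemma kdiff_sum: "kdiff c (\<lambda>l. \<Sum>i\<in>A. z i l) l = (\<Sum>i\<in>A. kdiff c (z i) l)"
  by (induction A rule: infinite_finite_induct) (auto simp: kdiff_add)

lemma kdiff_left_sum: "kdiff (\<lambda>v. \<Sum>i\<in>A. c i v) z l = (\<Sum>i\<in>A. kdiff (c i) z l)"
  by (induction l arbitrary: z) (auto simp: sum_subtractf sum_distrib_right)

lemma kdiff_left_add: "kdiff (\<lambda>v. c v + c' v) z l = kdiff c z l + kdiff c' z l"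
  by (induction l arbitrary: z) (auto simp: algebra_simps)

lemma kdiff_left_mult: "kdiff (\<lambda>v. r * c v) z l = r * kdiff c z l"
  by (induction l arbitrary: z) (auto simp: algebra_simps)

lemma kdiff_kdiff [simp]: "kdiff c (kdiff c z) l = 0"
proof (induction l arbitrary: z)
  case (Cons v l)
  then show ?case by (simp add: kdiff_diff kdiff_mult)
qed auto

text \<open>Multiplication by \<open>c\<close> and by \<open>c'\<close> is multiplication by two
  forms of degree one. The sign rule lets a differential pass the factors of
  \<open>koszul_class\<close>.\<close>

lemma kdiff_anticommute: "kdiff c (kdiff c' z) l = - kdiff c' (kdiff c z) l"
proof (induction l arbitrary: z)
  case (Cons v l)
  show ?case using Cons[of "\<lambda>m. z (v # m)"] by (simp add: kdiff_diff kdiff_mult)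
qed auto

lemma kdiff_length:
  assumes "\<And>l. length l \<noteq> q \<Longrightarrow> z l = 0" and "length l \<noteq> Suc q"
  shows "kdiff c z l = 0"
  using assms
proof (induction l arbitrary: z q)
  case (Cons v l)
  have *: "z l = 0" using Cons.prems by auto
  show ?case
  proof (cases q)
    case 0
    then have "(\<lambda>m. z (v # m)) = (\<lambda>m. 0)" using Cons.prems by auto
    then show ?thesis using * by simp
  next
    case (Suc q')
    have "kdiff c (\<lambda>m. z (v # m)) l = 0"
      by (rule Cons.IH[of q']) (use Cons.prems Suc in auto)
    then show ?thesis using * by simp
  qed
qed auto

text \<open>\<open>kdiff\<close> is an alternating sum of products \<open>c v * z m\<close>. Only
  closure under differences is asked of \<open>A\<close>, so that it can also be a colon set or the
  multiples of a monomial.\<close>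

lemma kdiff_mem:
  assumes "0 \<in> A" and "\<And>a b. a \<in> A \<Longrightarrow> b \<in> A \<Longrightarrow> a - b \<in> A" and "\<And>v m. c v * z m \<in> A"
  shows "kdiff c z l \<in> A"
  using assms(3)
proof (induction l arbitrary: z)
  case (Cons v l)
  show ?case using assms(2)[OF Cons.prems Cons.IH[of "\<lambda>m. z (v # m)"]] Cons.prems by simp
qed (simp add: assms)

text \<open>Contraction with the vector whose coordinates are \<open>g\<close>, the adjoint partner
  of \<open>kdiff\<close>. Inserting at the head matches the recursion of
  \<open>kdiff\<close>.\<close>

definition contract :: "'v set \<Rightarrow> ('v \<Rightarrow> 'a::comm_ring_1) \<Rightarrow> ('v list \<Rightarrow> 'a) \<Rightarrow> 'v list \<Rightarrow> 'a" where
  "contract V g z l = (\<Sum>v\<in>V. g v * z (v # l))"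

text \<open>Cartan's formula: the element \<open>\<Sum>v\<in>V. g v * c v\<close> acts on the Koszul
  complex by a map homotopic to zero. Expanding \<open>kdiff\<close> at the inserted head makes all
  other terms cancel.\<close>

lemma contract_homotopy:
  "kdiff c (contract V g z) l + contract V g (kdiff c z) l = (\<Sum>v\<in>V. g v * c v) * z l"
proof -
  have "kdiff c (contract V g z) l + contract V g (kdiff c z) l
      = (\<Sum>v\<in>V. g v * kdiff c (\<lambda>m. z (v # m)) l + g v * kdiff c z (v # l))"
    unfolding contract_def[abs_def] by (simp only: kdiff_sum kdiff_mult sum.distrib)
  also have "\<dots> = (\<Sum>v\<in>V. g v * c v * z l)"
    by (intro sum.cong refl) (simp add: algebra_simps)
  finally show ?thesis by (simp only: sum_distrib_right)
qed

text \<open>\<open>K[V]\<close> is only a subset of the type of polynomials, so ideals and Koszul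
  cohomology are developed relative to a subring \<open>S\<close>.\<close>

locale subring_set =
  fixes S :: "'a::comm_ring_1 set"
  assumes zero_mem: "0 \<in> S" and one_mem: "1 \<in> S"
    and diff_mem: "a \<in> S \<Longrightarrow> b \<in> S \<Longrightarrow> a - b \<in> S"
    and mult_mem: "a \<in> S \<Longrightarrow> b \<in> S \<Longrightarrow> a * b \<in> S"
begin

lemma uminus_mem: "a \<in> S \<Longrightarrow> - a \<in> S"
  using diff_mem[OF zero_mem, of a] by simp

lemma add_mem: "a \<in> S \<Longrightarrow> b \<in> S \<Longrightarrow> a + b \<in> S"
  using diff_mem[of a "- b"] uminus_mem by simp

lemma sum_mem: "(\<And>i. i \<in> B \<Longrightarrow> f i \<in> S) \<Longrightarrow> sum f B \<in> S"
  by (induction B rule: infinite_finite_induct) (auto intro: add_mem zero_mem)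

definition ideal_set :: "'a set \<Rightarrow> bool" where
  "ideal_set A \<longleftrightarrow> A \<subseteq> S \<and> 0 \<in> A \<and> (\<forall>a\<in>A. \<forall>b\<in>A. a - b \<in> A) \<and> (\<forall>s\<in>S. \<forall>a\<in>A. s * a \<in> A)"

lemma ideal_setD:
  assumes "ideal_set A"
  shows "a \<in> A \<Longrightarrow> a \<in> S" "0 \<in> A" "a \<in> A \<Longrightarrow> b \<in> A \<Longrightarrow> a - b \<in> A"
    "s \<in> S \<Longrightarrow> a \<in> A \<Longrightarrow> s * a \<in> A"
  using assms by (auto simp: ideal_set_def)

lemma ideal_set_uminus: "ideal_set A \<Longrightarrow> a \<in> A \<Longrightarrow> - a \<in> A"
  using ideal_setD(3)[of A 0 a] ideal_setD(2) by simp

lemma ideal_set_add: "ideal_set A \<Longrightarrow> a \<in> A \<Longrightarrow> b \<in> A \<Longrightarrow> a + b \<in> A"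
  using ideal_setD(3)[of A a "- b"] ideal_set_uminus by simp

lemma ideal_set_sum: "ideal_set A \<Longrightarrow> (\<And>i. i \<in> B \<Longrightarrow> f i \<in> A) \<Longrightarrow> sum f B \<in> A"
  by (induction B rule: infinite_finite_induct) (auto intro: ideal_set_add ideal_setD(2))

definition adjoin :: "'a set \<Rightarrow> 'a \<Rightarrow> 'a set" where
  "adjoin A f = {a + f * s | a s. a \<in> A \<and> s \<in> S}"

lemma ideal_set_adjoin:
  assumes A: "ideal_set A" and f: "f \<in> S"
  shows "ideal_set (adjoin A f)"
  unfolding ideal_set_def
proof (intro conjI ballI subsetI)
  show "x \<in> S" if "x \<in> adjoin A f" for x
    using that f by (auto simp: adjoin_def intro!: add_mem mult_mem dest: ideal_setD(1)[OF A])
  show "0 \<in> adjoin A f"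
    by (force simp: adjoin_def intro: ideal_setD(2)[OF A] zero_mem)
  show "x - y \<in> adjoin A f" if xy: "x \<in> adjoin A f" "y \<in> adjoin A f" for x y
  proof -
    from xy obtain a s b t where "x = a + f * s" "y = b + f * t" "a \<in> A" "b \<in> A" "s \<in> S" "t \<in> S"
      by (auto simp: adjoin_def)
    moreover from this have "x - y = (a - b) + f * (s - t)" by (simp add: algebra_simps)
    ultimately have "x - y = (a - b) + f * (s - t)" "a - b \<in> A" "s - t \<in> S"
      by (auto intro: ideal_setD(3)[OF A] diff_mem)
    then show ?thesis unfolding adjoin_def by blast
  qed
  show "r * x \<in> adjoin A f" if "r \<in> S" and x: "x \<in> adjoin A f" for r x
  proof -
    from x obtain a s where as: "x = a + f * s" "a \<in> A" "s \<in> S"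
      by (auto simp: adjoin_def)
    have "r * x = r * a + f * (r * s)" by (simp add: as algebra_simps)
    moreover have "r * a \<in> A" by (intro ideal_setD(4)[OF A] \<open>r \<in> S\<close> as)
    moreover have "r * s \<in> S" by (intro mult_mem \<open>r \<in> S\<close> as)
    ultimately show ?thesis unfolding adjoin_def by blast
  qed
qed

text \<open>The Koszul cohomology of \<open>S/A\<close> with respect to the family \<open>x\<close> does not vanish in
  degree \<open>q\<close>.\<close>

definition koszul_nonvanishing :: "('v \<Rightarrow> 'a) \<Rightarrow> nat \<Rightarrow> 'a set \<Rightarrow> bool" where
  "koszul_nonvanishing x q A \<longleftrightarrow>
     (\<exists>z. range z \<subseteq> S \<and> (\<forall>l. length l \<noteq> q \<longrightarrow> z l = 0) \<and> range (kdiff x z) \<subseteq> A \<and>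
          \<not> (\<exists>w. range w \<subseteq> S \<and> (\<forall>l. z l - kdiff x w l \<in> A)))"

lemma kdiff_range: "range x \<subseteq> S \<Longrightarrow> range z \<subseteq> S \<Longrightarrow> kdiff x z l \<in> S"
  by (rule kdiff_mem) (auto intro!: zero_mem diff_mem mult_mem)

lemma koszul_nonvanishingE:
  assumes "koszul_nonvanishing x q A"
  obtains z where "range z \<subseteq> S" "\<And>l. length l \<noteq> q \<Longrightarrow> z l = 0" "\<And>l. kdiff x z l \<in> A"
    "\<And>w. range w \<subseteq> S \<Longrightarrow> (\<And>l. z l - kdiff x w l \<in> A) \<Longrightarrow> False"
proof -
  obtain z where z: "range z \<subseteq> S \<and> (\<forall>l. length l \<noteq> q \<longrightarrow> z l = 0) \<and> range (kdiff x z) \<subseteq> A \<and>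
          \<not> (\<exists>w. range w \<subseteq> S \<and> (\<forall>l. z l - kdiff x w l \<in> A))"
    using assms unfolding koszul_nonvanishing_def by (elim exE)
  show thesis
  proof (rule that[of z])
    show "range z \<subseteq> S" using z by (elim conjE)
    show "z l = 0" if "length l \<noteq> q" for l using z that by simp
    show "kdiff x z l \<in> A" for l using z by auto
    have "\<not> (\<exists>w. range w \<subseteq> S \<and> (\<forall>l. z l - kdiff x w l \<in> A))"
      using z by (elim conjE)
    then show False if "range w \<subseteq> S" "\<And>l. z l - kdiff x w l \<in> A" for w
      by (rule notE) (intro exI[of _ w] conjI allI that)
  qed
qed

lemma koszul_nonvanishingI:
  assumes "range z \<subseteq> S" "\<And>l. length l \<noteq> q \<Longrightarrow> z l = 0" "\<And>l. kdiff x z l \<in> A"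
    and "\<And>w. range w \<subseteq> S \<Longrightarrow> (\<And>l. z l - kdiff x w l \<in> A) \<Longrightarrow> False"
  shows "koszul_nonvanishing x q A"
  unfolding koszul_nonvanishing_def
proof (intro exI[of _ z] conjI notI)
  show "range z \<subseteq> S" by fact
  show "\<forall>l. length l \<noteq> q \<longrightarrow> z l = 0" using assms(2) by simp
  show "range (kdiff x z) \<subseteq> A" using assms(3) by auto
next
  assume "\<exists>w. range w \<subseteq> S \<and> (\<forall>l. z l - kdiff x w l \<in> A)"
  then obtain w where "range w \<subseteq> S \<and> (\<forall>l. z l - kdiff x w l \<in> A)" by (elim exE)
  then show False by (intro assms(4)[of w]) simp_all
qed

text \<open>As \<open>f\<close> acts by zero on the cohomology of \<open>S/A\<close>, the connecting
  map from degree \<open>q\<close> over \<open>S/(A + fS)\<close> to degree \<open>Suc q\<close>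
  over \<open>S/A\<close> is onto. The contraction \<open>w\<close> of a cocycle \<open>z\<close> is
  a preimage: its differential is \<open>f z\<close> modulo \<open>A\<close>. If \<open>w\<close>
  were a coboundary, \<open>w = du + a + f y\<close>, applying the differential would give
  \<open>f (z - dy) \<in> A\<close>, and \<open>z - dy \<in> A\<close> as \<open>f\<close> is
  regular.\<close>

lemma koszul_nonvanishing_step:
  assumes A: "ideal_set A" and x: "range x \<subseteq> S" and g: "\<And>v. v \<in> V \<Longrightarrow> g v \<in> S"
    and f: "f = (\<Sum>v\<in>V. g v * x v)"
    and reg: "\<And>p. p \<in> S \<Longrightarrow> f * p \<in> A \<Longrightarrow> p \<in> A"
    and nv: "koszul_nonvanishing x (Suc q) A"
  shows "koszul_nonvanishing x q (adjoin A f)"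
proof -
  obtain z where z: "range z \<subseteq> S" "\<And>l. length l \<noteq> Suc q \<Longrightarrow> z l = 0" "\<And>l. kdiff x z l \<in> A"
    and nb: "\<And>w. range w \<subseteq> S \<Longrightarrow> (\<And>l. z l - kdiff x w l \<in> A) \<Longrightarrow> False"
    by (fact koszul_nonvanishingE[OF nv])
  define w where "w = contract V g z"
  have wS: "range w \<subseteq> S"
    using z(1) g by (auto simp: w_def contract_def intro!: sum_mem mult_mem)
  have hom: "kdiff x w l = f * z l - contract V g (kdiff x z) l" for l
    using contract_homotopy[of x V g z l] by (simp add: w_def f algebra_simps)
  have cA: "contract V g (kdiff x z) l \<in> A" for l
    unfolding contract_def by (intro ideal_set_sum[OF A] ideal_setD(4)[OF A] g z(3))
  have cocycle: "kdiff x w l \<in> adjoin A f" for l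
    unfolding adjoin_def hom using ideal_set_uminus[OF A cA] z(1)
    by (intro CollectI exI[of _ "- contract V g (kdiff x z) l"] exI[of _ "z l"]) auto
  have supp: "w l = 0" if "length l \<noteq> q" for l
    using z(2) that by (simp add: w_def contract_def)
  have notcob: False if u: "range u \<subseteq> S" and ub: "\<And>l. w l - kdiff x u l \<in> adjoin A f" for u
  proof -
    have "\<forall>l. \<exists>a y. w l - kdiff x u l = a + f * y \<and> a \<in> A \<and> y \<in> S"
      using ub unfolding adjoin_def mem_Collect_eq by (rule allI)
    from this[unfolded choice_iff] obtain a y
      where "\<forall>l. w l - kdiff x u l = a l + f * y l \<and> a l \<in> A \<and> y l \<in> S" by (elim exE)
    then have ay: "\<And>l. a l \<in> A" "\<And>l. y l \<in> S" "\<And>l. w l - kdiff x u l = a l + f * y l"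
      by simp_all
    have "f * (z l - kdiff x y l) \<in> A" for l
    proof -
      have "kdiff x w l = kdiff x (\<lambda>l. kdiff x u l + (a l + f * y l)) l"
        by (rule arg_cong[of _ _ "\<lambda>w. kdiff x w l"]) (simp add: fun_eq_iff flip: ay(3))
      also have "\<dots> = kdiff x a l + f * kdiff x y l"
        by (simp add: kdiff_add kdiff_mult)
      finally have "f * (z l - kdiff x y l) = kdiff x a l + contract V g (kdiff x z) l"
        using hom[of l] by (simp add: algebra_simps)
      moreover have "kdiff x a l \<in> A"
      proof (rule kdiff_mem)
        show "x v * a m \<in> A" for v m
          by (intro ideal_setD(4)[OF A] ay) (use x in blast)
      qed (auto intro: ideal_setD(2,3)[OF A])
      ultimately show ?thesis using cA ideal_set_add[OF A] by simp
    qed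
    moreover have "z l - kdiff x y l \<in> S" for l
      using z(1) kdiff_range[OF x, of y l] ay(2) by (auto intro!: diff_mem)
    ultimately have "z l - kdiff x y l \<in> A" for l using reg by blast
    moreover have "range y \<subseteq> S" using ay(2) by auto
    ultimately show False by (intro nb[of y])
  qed
  show ?thesis
    using wS supp cocycle notcob by (rule koszul_nonvanishingI)
qed

text \<open>A cocycle of degree 0 is a single element, and the cocycle condition at one-element
  lists says that every \<open>x v\<close> sends it into \<open>A\<close>.\<close>

lemma koszul_nonvanishing_0:
  assumes A: "ideal_set A" and nv: "koszul_nonvanishing x 0 A"
  obtains p where "p \<in> S" "p \<notin> A" "\<And>v. x v * p \<in> A"
proof -
  obtain z where z: "range z \<subseteq> S" "\<And>l. length l \<noteq> 0 \<Longrightarrow> z l = 0" "\<And>l. kdiff x z l \<in> A"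
    and nb: "\<And>w. range w \<subseteq> S \<Longrightarrow> (\<And>l. z l - kdiff x w l \<in> A) \<Longrightarrow> False"
    by (fact koszul_nonvanishingE[OF nv])
  obtain l where l: "z l \<notin> A" using nb[of "\<lambda>_. 0"] zero_mem by (auto simp: image_subset_iff)
  then have "l = []" using z(2)[of l] ideal_setD(2)[OF A] by (cases l) auto
  moreover have "x v * z [] \<in> A" for v
    using z(3) kdiff_Cons[of x z v "[]"] by (metis diff_zero kdiff_Nil)
  ultimately show thesis using that[of "z []"] l z(1) by auto
qed

end

section \<open>Exponent vectors\<close>

definition pm_ev :: "'v \<Rightarrow> 'v \<Rightarrow>\<^sub>0 nat" where
  "pm_ev v = Poly_Mapping.single v 1"

abbreviation lk :: "('v \<Rightarrow>\<^sub>0 'b::zero) \<Rightarrow> 'v \<Rightarrow> 'b" where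
  "lk \<equiv> Poly_Mapping.lookup"

lemma lookup_ev: "lk (pm_ev x) v = (if v = x then 1 else 0)"
  by (simp add: pm_ev_def lookup_single when_def)

definition pm_of :: "'a set \<Rightarrow> ('a \<Rightarrow> 'b) \<Rightarrow> 'a \<Rightarrow>\<^sub>0 'b::comm_monoid_add" where
  "pm_of A f = (\<Sum>v\<in>A. Poly_Mapping.single v (f v))"

lemma lookup_pm_of: "finite A \<Longrightarrow> lk (pm_of A f) v = (if v \<in> A then f v else 0)"
  by (simp add: pm_of_def lookup_sum lookup_single when_def if_distrib sum.delta cong: if_cong)

text \<open>Kept generic because it serves twice: for exponents restricted to a set of vertices, and
  for polynomials restricted to a set of exponents.\<close>

definition restr :: "('a \<Rightarrow>\<^sub>0 'b::comm_monoid_add) \<Rightarrow> 'a set \<Rightarrow> 'a \<Rightarrow>\<^sub>0 'b" where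
  "restr a P = pm_of (Poly_Mapping.keys a \<inter> P) (lk a)"

lemma lookup_restr: "lk (restr a P) v = (if v \<in> P then lk a v else 0)"
  by (auto simp: restr_def lookup_pm_of in_keys_iff)

section \<open>Monomials in powers of the edge ideal\<close>

text \<open>The monomial with exponent \<open>a\<close> lies in \<open>I\<^sup>t\<close>: it is a
  product of \<open>t\<close> edges and an arbitrary cofactor, which the base case absorbs.
  Equivalently, \<open>t\<close> edges can be packed when vertex \<open>v\<close> has capacity
  \<open>a v\<close>.\<close>

inductive epow :: "'v set set \<Rightarrow> nat \<Rightarrow> ('v \<Rightarrow>\<^sub>0 nat) \<Rightarrow> bool" for E where
  epow_0: "epow E 0 a"
| epow_Suc: "epow E t a \<Longrightarrow> {x, y} \<in> E \<Longrightarrow> epow E (Suc t) (a + pm_ev x + pm_ev y)"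

lemma epow_mono: "epow E t a \<Longrightarrow> epow E t (a + b)"
proof (induction rule: epow.induct)
  case (epow_Suc t a x y)
  then show ?case using epow.epow_Suc[of E t "a + b" x y] by (simp add: ac_simps)
qed (rule epow_0)

lemma epow_add: "epow E s a \<Longrightarrow> epow E t b \<Longrightarrow> epow E (s + t) (a + b)"
proof (induction rule: epow.induct)
  case (epow_0 a)
  then show ?case using epow_mono[of E t b a] by (simp add: ac_simps)
next
  case (epow_Suc s a x y)
  then show ?case using epow.epow_Suc[of E "s + t" "a + b" x y] by (simp add: ac_simps)
qed

lemma epow_edge: "{x, y} \<in> E \<Longrightarrow> epow E 1 (pm_ev x + pm_ev y)"
  using epow_Suc[OF epow_0[of E 0]] by simp

lemma epow_le: "epow E t a \<Longrightarrow> s \<le> t \<Longrightarrow> epow E s a"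
proof (induction arbitrary: s rule: epow.induct)
  case (epow_Suc t a x y)
  show ?case
  proof (cases "s = Suc t")
    case True
    then show ?thesis using epow.epow_Suc[OF epow_Suc.hyps] by simp
  next
    case False
    then have "epow E s (a + (pm_ev x + pm_ev y))"
      using epow_Suc by (intro epow_mono) auto
    then show ?thesis by (simp add: ac_simps)
  qed
qed (auto intro: epow_0)

lemma epow_mono_edges: "epow E t a \<Longrightarrow> E \<subseteq> F \<Longrightarrow> epow F t a"
  by (induction rule: epow.induct) (auto intro: epow.intros)

lemma diff_ev_add:
  assumes "x \<noteq> y" "lk b x \<ge> 1" "lk b y \<ge> 1"
  obtains b' where "b = b' + pm_ev x + pm_ev y"
proof -
  have "b = (b - pm_ev x - pm_ev y) + pm_ev x + pm_ev y"
    by (rule poly_mapping_eqI) (use assms in \<open>auto simp: lookup_add lookup_minus lookup_ev\<close>)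
  then show thesis by (rule that)
qed

text \<open>Without loops, \<open>t\<close> edges use a vertex at most \<open>t\<close> times, so
  capacity beyond \<open>t\<close> is irrelevant, and so are vertices on no edge. This is the source
  of all finiteness below.\<close>

lemma epow_trunc:
  assumes "epow E t a" and "\<forall>e\<in>E. card e = 2"
    and "\<And>v. v \<in> \<Union> E \<Longrightarrow> min (lk a v) t \<le> lk b v"
  shows "epow E t b"
  using assms(1,3)
proof (induction arbitrary: b rule: epow.induct)
  case (epow_Suc t a x y)
  have xy: "x \<noteq> y" "x \<in> \<Union> E" "y \<in> \<Union> E" using epow_Suc.hyps assms(2) by auto
  have "lk b x \<ge> 1" "lk b y \<ge> 1"
    using epow_Suc.prems[OF xy(2)] epow_Suc.prems[OF xy(3)] by (auto simp: lookup_add lookup_ev)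
  then obtain b' where b': "b = b' + pm_ev x + pm_ev y" using diff_ev_add[OF xy(1)] by blast
  have "epow E t b'"
  proof (rule epow_Suc.IH)
    fix v assume "v \<in> \<Union> E"
    from epow_Suc.prems[OF this] show "min (lk a v) t \<le> lk b' v"
      using xy(1) by (auto simp: b' lookup_add lookup_ev split: if_splits)
  qed
  then show ?case unfolding b' using epow_Suc.hyps by (intro epow.epow_Suc)
qed (rule epow_0)

section \<open>Weighted vertex covers in bipartite graphs\<close>

definition wt :: "('v \<Rightarrow>\<^sub>0 nat) \<Rightarrow> 'v set \<Rightarrow> nat" where
  "wt a C = (\<Sum>v\<in>C. lk a v)"

lemma wt_Un_disjoint: "finite C \<Longrightarrow> finite D \<Longrightarrow> C \<inter> D = {} \<Longrightarrow> wt a (C \<union> D) = wt a C + wt a D"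
  by (simp add: wt_def sum.union_disjoint)

lemma wt_add: "wt (a + b) C = wt a C + wt b C"
  by (simp add: wt_def lookup_add sum.distrib)

lemma wt_ev: "finite C \<Longrightarrow> wt (pm_ev x) C = (if x \<in> C then 1 else 0)"
  by (simp add: wt_def lookup_ev)

lemma wt_restr: "finite C \<Longrightarrow> wt (restr a P) C = wt a (C \<inter> P)"
  by (simp add: wt_def lookup_restr sum.inter_restrict)

definition vertex_cover :: "'v set set \<Rightarrow> 'v set \<Rightarrow> bool" where
  "vertex_cover F C \<longleftrightarrow> (\<forall>e\<in>F. e \<inter> C \<noteq> {})"

text \<open>If deleting an edge \<open>xy\<close> from a minimum cover problem lowers the optimum by two, a minimum
  cover contains both ends, and it cuts the problem into two smaller ones.\<close>

theorem koenig_weighted: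
  assumes fin: "finite X" "finite Y" and disj: "X \<inter> Y = {}"
    and F: "\<And>e. e \<in> F \<Longrightarrow> \<exists>x\<in>X. \<exists>y\<in>Y. e = {x, y}"
  shows "\<exists>C\<subseteq>X \<union> Y. vertex_cover F C \<and> epow F (wt a C) a"
proof (induction "wt a (X \<union> Y)" arbitrary: a rule: less_induct)
  case less
  define W where "W = X \<union> Y"
  define Cov where "Cov = {C. C \<subseteq> W \<and> vertex_cover F C}"
  have finW: "finite W" using fin by (simp add: W_def)
  have finCov: "finite Cov" using finW by (simp add: Cov_def)
  have WCov: "W \<in> Cov" using F by (force simp: Cov_def vertex_cover_def W_def)
  then obtain C where C: "C \<in> Cov" "\<And>D. D \<in> Cov \<Longrightarrow> wt a C \<le> wt a D"
    using arg_min_if_finite[of Cov "wt a"] finCov by (metis empty_iff not_less)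
  have card2: "\<forall>e\<in>F. card e = 2"
  proof
    fix e assume "e \<in> F"
    with F obtain x y where "x \<in> X" "y \<in> Y" "e = {x, y}" by blast
    moreover from this have "x \<noteq> y" using disj by auto
    ultimately show "card e = 2" by simp
  qed
  have UF: "\<Union> F \<subseteq> W" using F by (fastforce simp: W_def)
  have "epow F (wt a C) a"
  proof (cases "\<exists>x\<in>X. \<exists>y\<in>Y. {x, y} \<in> F \<and> lk a x > 0 \<and> lk a y > 0")
    case False
    \<comment> \<open>No edge has two ends of positive capacity, so the vertices of capacity zero
      form a cover and the optimum is zero.\<close>
    have "{v \<in> W. lk a v = 0} \<in> Cov"
      unfolding Cov_def vertex_cover_def
    proof safe
      fix e assume "e \<in> F" and *: "e \<inter> {v \<in> W. lk a v = 0} = {}"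
      with F obtain x y where "x \<in> X" "y \<in> Y" "e = {x, y}" by blast
      then show False using False \<open>e \<in> F\<close> * by (auto simp: W_def)
    qed
    from C(2)[OF this] have "wt a C = 0" by (simp add: wt_def)
    then show ?thesis by (simp add: epow_0)
  next
    case True
    then obtain x y where xy: "x \<in> X" "y \<in> Y" "{x, y} \<in> F" "lk a x > 0" "lk a y > 0" by blast
    then have "x \<noteq> y" using disj by auto
    then obtain a' where a': "a = a' + pm_ev x + pm_ev y"
      using diff_ev_add[of x y a] xy by (metis One_nat_def Suc_leI)
    have "wt a' (X \<union> Y) < wt a (X \<union> Y)" using xy fin by (simp add: a' wt_add wt_ev)
    from less[OF this] obtain C' where C': "C' \<in> Cov" "epow F (wt a' C') a'"
      by (auto simp: Cov_def W_def)
    then have finC': "finite C'" using finW finite_subset by (auto simp: Cov_def)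
    show ?thesis
    proof (cases "wt a C \<le> Suc (wt a' C')")
      case True
      then show ?thesis
        using epow_le[OF epow_Suc[OF C'(2) xy(3)]] by (simp add: a')
    next
      case False
      \<comment> \<open>Under \<open>a\<close>, the cover \<open>C'\<close> weighs at most two more
        than under \<open>a'\<close>. As the optimum exceeds the old value by more than one, both
        ends lie in \<open>C'\<close>, and \<open>C'\<close> is itself a minimum cover for
        \<open>a\<close>.\<close>
      then have xyC': "x \<in> C'" "y \<in> C'" and wC': "wt a C = wt a C'"
        using C(2)[OF C'(1)] finC' by (auto simp: a' wt_add wt_ev split: if_splits)
      have cov: "e \<inter> C' \<noteq> {}" if "e \<in> F" for e
        using C'(1) that by (auto simp: Cov_def vertex_cover_def)
      \<comment> \<open>One half of the packing, stated symmetrically in the two sides. In the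
        subproblem on \<open>C' \<inter> A\<close> and the uncovered part of \<open>B\<close>, no
        cover beats \<open>C' \<inter> A\<close>. The subproblem is strictly smaller because it
        loses the capacity of \<open>z\<close>.\<close>
      have main: "epow F (wt a (C' \<inter> A)) (restr a ((C' \<inter> A) \<union> (B - C')))"
        if AB: "A \<union> B = W" "A \<inter> B = {}" and z: "z \<in> B" "z \<in> C'" "lk a z > 0"
          and FAB: "\<And>e. e \<in> F \<Longrightarrow> \<exists>p\<in>A. \<exists>q\<in>B. e = {p, q}" for A B z
      proof -
        define P where "P = (C' \<inter> A) \<union> (B - C')"
        have finAB: "finite A" "finite B" using AB finW by (metis finite_Un)+
        have zP: "z \<notin> P" and zW: "z \<in> W" using z AB by (auto simp: P_def)
        have "wt (restr a P) W < wt a W"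
          unfolding wt_def by (rule sum_strict_mono_ex1)
            (use finW z zP zW in \<open>auto simp: lookup_restr intro!: bexI[of _ z]\<close>)
        then obtain D where D: "D \<subseteq> W" "vertex_cover F D" "epow F (wt (restr a P) D) (restr a P)"
          using less[of "restr a P"] by (auto simp: W_def)
        have finD: "finite D" using D(1) finW finite_subset by blast
        \<comment> \<open>Exchange: an edge missing \<open>C' \<inter> B\<close> has its end in
          \<open>A\<close> in \<open>C'\<close>, hence lies inside \<open>P\<close>, where
          \<open>D\<close> covers it. Minimality of \<open>C'\<close> then bounds the weight of
          \<open>D\<close> from below.\<close>
        have "(D \<inter> P) \<union> (C' \<inter> B) \<in> Cov"
          unfolding Cov_def vertex_cover_def
        proof safe
          fix e assume e: "e \<in> F" and none: "e \<inter> (D \<inter> P \<union> C' \<inter> B) = {}"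
          obtain p q where pq: "p \<in> A" "q \<in> B" "e = {p, q}" using FAB[OF e] by blast
          then have "q \<notin> C'" using none by auto
          then have "p \<in> C'" using cov[OF e] pq by auto
          then have "e \<subseteq> P" using pq \<open>q \<notin> C'\<close> by (auto simp: P_def)
          moreover have "e \<inter> D \<noteq> {}" using D(2) e by (simp add: vertex_cover_def)
          ultimately show False using none by blast
        qed (use D C' AB in \<open>auto simp: Cov_def\<close>)
        from C(2)[OF this] have "wt a C' \<le> wt a ((D \<inter> P) \<union> (C' \<inter> B))" by (simp add: wC')
        also have "\<dots> = wt a (D \<inter> P) + wt a (C' \<inter> B)"
        proof (rule wt_Un_disjoint)
          show "D \<inter> P \<inter> (C' \<inter> B) = {}" using AB(2) unfolding P_def by blast
        qed (use finD finC' in simp_all)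
        finally have "wt a C' \<le> wt a (D \<inter> P) + wt a (C' \<inter> B)" .
        moreover have "wt a C' = wt a (C' \<inter> A) + wt a (C' \<inter> B)"
        proof -
          have "C' = (C' \<inter> A) \<union> (C' \<inter> B)" using C'(1) AB by (auto simp: Cov_def)
          moreover have "(C' \<inter> A) \<inter> (C' \<inter> B) = {}" using AB by auto
          ultimately show ?thesis using wt_Un_disjoint[of "C' \<inter> A" "C' \<inter> B" a] finC' by auto
        qed
        ultimately have "wt a (C' \<inter> A) \<le> wt (restr a P) D" using finD by (simp add: wt_restr)
        then show ?thesis using epow_le[OF D(3)] by (simp add: P_def)
      qed
      have 1: "epow F (wt a (C' \<inter> X)) (restr a ((C' \<inter> X) \<union> (Y - C')))"
        by (rule main[of X Y y]) (use xyC' xy disj F in \<open>auto simp: W_def\<close>)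
      have 2: "epow F (wt a (C' \<inter> Y)) (restr a ((C' \<inter> Y) \<union> (X - C')))"
      proof (rule main[of Y X x])
        show "\<exists>p\<in>Y. \<exists>q\<in>X. e = {p, q}" if "e \<in> F" for e using F[OF that] by (metis insert_commute)
      qed (use xyC' xy disj in \<open>auto simp: W_def\<close>)
      have "C' = (C' \<inter> X) \<union> (C' \<inter> Y)" using C'(1) by (auto simp: Cov_def W_def)
      moreover have "(C' \<inter> X) \<inter> (C' \<inter> Y) = {}" using disj by auto
      ultimately have "wt a C' = wt a (C' \<inter> X) + wt a (C' \<inter> Y)"
        using wt_Un_disjoint[of "C' \<inter> X" "C' \<inter> Y" a] finC' by auto
      \<comment> \<open>The two subproblems live on disjoint vertex sets, so their packings add up
        within the capacities \<open>a\<close>.\<close>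
      then have "epow F (wt a C) (restr a ((C' \<inter> X) \<union> (Y - C')) + restr a ((C' \<inter> Y) \<union> (X - C')))"
        using epow_add[OF 1 2] wC' by simp
      then show ?thesis
        by (rule epow_trunc[OF _ card2]) (use disj in \<open>auto simp: lookup_add lookup_restr\<close>)
    qed
  qed
  then show ?case using C(1) by (auto simp: Cov_def W_def)
qed

text \<open>Weak duality: every packed edge uses a unit of capacity inside the cover.\<close>

lemma epow_wt_le:
  assumes "vertex_cover F C" "finite C" "epow F t a"
  shows "t \<le> wt a C"
  using assms(3)
proof (induction rule: epow.induct)
  case (epow_Suc t a x y)
  then have "x \<in> C \<or> y \<in> C" using assms(1) by (auto simp: vertex_cover_def)
  then show ?case using epow_Suc assms(2) by (auto simp: wt_add wt_ev)
qed simp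

text \<open>Any vertex outside a proper minimum cover will do.\<close>

lemma exists_free_direction:
  assumes fin: "finite X" "finite Y" and disj: "X \<inter> Y = {}" and ne: "X \<union> Y \<noteq> {}"
    and F: "\<And>e. e \<in> F \<Longrightarrow> \<exists>x\<in>X. \<exists>y\<in>Y. e = {x, y}"
  obtains v where "v \<in> X \<union> Y"
    "\<And>t s. epow F t (a + Poly_Mapping.single v s) \<Longrightarrow> epow F t a"
proof -
  obtain C where C: "C \<subseteq> X \<union> Y" "vertex_cover F C" "epow F (wt a C) a"
    using koenig_weighted[OF fin disj F] by blast
  have "\<exists>D\<subset>X \<union> Y. vertex_cover F D \<and> wt a D \<le> wt a C"
  \<comment> \<open>If the minimum cover is everything, the side \<open>X\<close> alone is a cover
    of no larger weight. It is proper unless \<open>Y\<close> is empty; in that case there are no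
    edges and the empty cover serves.\<close>
  proof (cases "C = X \<union> Y")
    case True
    show ?thesis
    proof (cases "Y = {}")
      case True
      then have "F = {}" using F by auto
      then show ?thesis using ne by (intro exI[of _ "{}"]) (auto simp: vertex_cover_def wt_def)
    next
      case False
      have "vertex_cover F X" using F by (force simp: vertex_cover_def)
      moreover have "wt a X \<le> wt a C" using wt_Un_disjoint[OF fin disj] True by simp
      ultimately show ?thesis using False disj by blast
    qed
  qed (use C in blast)
  then obtain D where D: "D \<subset> X \<union> Y" "vertex_cover F D" "wt a D \<le> wt a C" by blast
  then obtain v where v: "v \<in> X \<union> Y" "v \<notin> D" by blast
  have finD: "finite D" using D fin by (meson finite_Un finite_subset psubset_imp_subset)
  show thesis
  proof (rule that[OF v(1)])
    fix t s assume "epow F t (a + Poly_Mapping.single v s)"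
    from epow_wt_le[OF D(2) finD this] have "t \<le> wt (a + Poly_Mapping.single v s) D" .
    also have "\<dots> = wt a D"
      unfolding wt_def using v(2)
      by (intro sum.cong refl) (auto simp: lookup_add lookup_single when_def)
    finally have "t \<le> wt a D" .
    then show "epow F t a" using epow_le[OF C(3), of t] D(3) by simp
  qed
qed

section \<open>Partition into cones\<close>

text \<open>The exponents of the monomials in the Stanley space
  \<open>x\<^sup>c K[Z]\<close>.\<close>

definition cone :: "('v \<Rightarrow>\<^sub>0 nat) \<Rightarrow> 'v set \<Rightarrow> ('v \<Rightarrow>\<^sub>0 nat) set" where
  "cone c Z = {b. \<forall>v. if v \<in> Z then lk c v \<le> lk b v else lk b v = lk c v}"

lemma keys_cone_subset: "b \<in> cone c Z \<Longrightarrow> Poly_Mapping.keys b \<subseteq> Poly_Mapping.keys c \<union> Z"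
  by (auto simp: cone_def in_keys_iff split: if_splits)

text \<open>A set of exponents is described by the values of invariants \<open>\<kappa> C\<close>, one for each block of
  variables; each value provides a direction in the block along which it remains constant.\<close>

locale free_blocks =
  fixes V :: "'v set" and \<B> :: "'v set set" and k :: nat
    and \<kappa> :: "'v set \<Rightarrow> ('v \<Rightarrow>\<^sub>0 nat) \<Rightarrow> 'c" and \<delta> :: "'c \<Rightarrow> 'v"
  assumes finite_V: "finite V"
    and block_subset: "C \<in> \<B> \<Longrightarrow> C \<subseteq> V"
    and block_disjoint: "C \<in> \<B> \<Longrightarrow> D \<in> \<B> \<Longrightarrow> v \<in> C \<Longrightarrow> v \<in> D \<Longrightarrow> C = D"
    and dir_mem: "C \<in> \<B> \<Longrightarrow> \<delta> (\<kappa> C a) \<in> C"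
    and inv_trunc: "C \<in> \<B> \<Longrightarrow> (\<And>v. v \<in> C \<Longrightarrow> min (lk a v) k = min (lk b v) k) \<Longrightarrow> \<kappa> C a = \<kappa> C b"
    and inv_dir: "C \<in> \<B> \<Longrightarrow> \<kappa> C (a + pm_ev (\<delta> (\<kappa> C a))) = \<kappa> C a"
begin

definition dirs :: "('v \<Rightarrow>\<^sub>0 nat) \<Rightarrow> 'v set" where
  "dirs a = (\<lambda>C. \<delta> (\<kappa> C a)) ` \<B>"

definition same_inv :: "('v \<Rightarrow>\<^sub>0 nat) \<Rightarrow> 'v \<Rightarrow> nat \<Rightarrow> bool" where
  "same_inv a v s \<longleftrightarrow> (\<forall>C\<in>\<B>. \<kappa> C (Poly_Mapping.update v s a) = \<kappa> C a)"

definition start :: "('v \<Rightarrow>\<^sub>0 nat) \<Rightarrow> 'v \<Rightarrow> nat" where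
  "start a v = (LEAST s. same_inv a v s)"

text \<open>The canonical apex of the cone through \<open>a\<close>: chosen directions are lowered
  as far as the invariants permit, all other coordinates are truncated at \<open>k\<close>.\<close>

definition base :: "('v \<Rightarrow>\<^sub>0 nat) \<Rightarrow> 'v \<Rightarrow>\<^sub>0 nat" where
  "base a = pm_of V (\<lambda>v. if v \<in> dirs a then start a v else min (lk a v) k)"

text \<open>Coordinates that have reached \<open>k\<close> may also grow freely, since the
  invariants see only truncated exponents.\<close>

definition free :: "('v \<Rightarrow>\<^sub>0 nat) \<Rightarrow> 'v set" where
  "free a = dirs a \<union> {v \<in> V. k \<le> lk a v}"

lemma dirs_subset: "dirs a \<subseteq> V"
  using dir_mem block_subset by (auto simp: dirs_def)

lemma dirs_block: "v \<in> dirs a \<Longrightarrow> C \<in> \<B> \<Longrightarrow> v \<in> C \<Longrightarrow> v = \<delta> (\<kappa> C a)"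
  using dir_mem block_disjoint by (fastforce simp: dirs_def)

lemma free_subset: "free a \<subseteq> V"
  using dirs_subset by (auto simp: free_def)

lemma card_free: "card \<B> \<le> card (free a)"
proof -
  have "inj_on (\<lambda>C. \<delta> (\<kappa> C a)) \<B>"
    by (rule inj_onI) (metis dir_mem block_disjoint)
  then have "card (dirs a) = card \<B>" by (simp add: dirs_def card_image)
  moreover have "finite (free a)" using free_subset finite_V finite_subset by blast
  ultimately show ?thesis by (metis free_def card_mono le_sup_iff order_refl)
qed

lemma same_inv_trunc: "same_inv a v (min (lk a v) k)"
  unfolding same_inv_def by (intro ballI inv_trunc) (auto simp: lookup_update)

lemma same_inv_self: "same_inv a v (lk a v)"
  unfolding same_inv_def by (intro ballI inv_trunc) (auto simp: lookup_update)

lemma same_inv_start: "same_inv a v (start a v)"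
  unfolding start_def by (rule LeastI, rule same_inv_self)

lemma start_le: "same_inv a v s \<Longrightarrow> start a v \<le> s"
  unfolding start_def by (rule Least_le)

text \<open>The direction is a function of the invariant. As the invariant at value \<open>s\<close>
  is that of \<open>a\<close>, \<open>v\<close> is still the direction there, and
  \<open>inv_dir\<close> permits one more step. So the admissible values of \<open>v\<close> form a
  ray starting at \<open>start a v\<close>.\<close>

lemma same_inv_Suc:
  assumes v: "v \<in> dirs a" and s: "same_inv a v s"
  shows "same_inv a v (Suc s)"
  unfolding same_inv_def
proof
  fix C assume C: "C \<in> \<B>"
  have eq: "\<kappa> C (Poly_Mapping.update v s a) = \<kappa> C a" using s C by (simp add: same_inv_def)
  show "\<kappa> C (Poly_Mapping.update v (Suc s) a) = \<kappa> C a"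
  proof (cases "v \<in> C")
    case True
    then have "v = \<delta> (\<kappa> C (Poly_Mapping.update v s a))" using dirs_block[OF v C] eq by simp
    then have "\<kappa> C (Poly_Mapping.update v s a + pm_ev v) = \<kappa> C a"
      using inv_dir[OF C, of "Poly_Mapping.update v s a"] eq by simp
    moreover have "Poly_Mapping.update v s a + pm_ev v = Poly_Mapping.update v (Suc s) a"
      by (rule poly_mapping_eqI) (auto simp: lookup_add lookup_update lookup_ev)
    ultimately show ?thesis by simp
  next
    case False
    then show ?thesis by (intro inv_trunc[OF C]) (auto simp: lookup_update)
  qed
qed

lemma same_inv_iff:
  assumes "v \<in> dirs a"
  shows "same_inv a v s \<longleftrightarrow> start a v \<le> s"
proof
  assume "start a v \<le> s"
  then show "same_inv a v s"
    by (induction rule: dec_induct) (auto intro: same_inv_start same_inv_Suc[OF assms])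
qed (rule start_le)

lemma lookup_base:
  "Poly_Mapping.keys a \<subseteq> V \<Longrightarrow>
    lk (base a) v = (if v \<in> dirs a then start a v else min (lk a v) k)"
proof -
  assume "Poly_Mapping.keys a \<subseteq> V"
  then have "lk a v = 0" if "v \<notin> V" using that by (auto simp: in_keys_iff)
  then show ?thesis using dirs_subset finite_V by (auto simp: base_def lookup_pm_of)
qed

lemma keys_base: "Poly_Mapping.keys (base a) \<subseteq> V"
  using finite_V by (auto simp: base_def lookup_pm_of in_keys_iff split: if_splits)

lemma mem_cone_base:
  assumes "Poly_Mapping.keys a \<subseteq> V"
  shows "a \<in> cone (base a) (free a)"
  using assms start_le[OF same_inv_self, of a]
  by (auto simp: cone_def free_def lookup_base min_def in_keys_iff)

text \<open>Every coordinate of an apex is at most \<open>k\<close>; for \<open>start\<close> this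
  holds because truncating at \<open>k\<close> preserves the invariants.\<close>

lemma finite_bases: "finite ((\<lambda>a. (base a, free a)) ` {a. Poly_Mapping.keys a \<subseteq> V})"
proof (rule finite_subset)
  show "(\<lambda>a. (base a, free a)) ` {a. Poly_Mapping.keys a \<subseteq> V}
      \<subseteq> (pm_of V ` (\<Pi>\<^sub>E v\<in>V. {..k})) \<times> Pow V"
  proof (rule image_subsetI)
    fix a :: "'v \<Rightarrow>\<^sub>0 nat" assume "a \<in> {a. Poly_Mapping.keys a \<subseteq> V}"
    then have a: "Poly_Mapping.keys a \<subseteq> V" by simp
    have "lk (base a) v \<le> k" for v
      using start_le[OF same_inv_trunc, of a v] by (auto simp: lookup_base[OF a])
    moreover have "base a = pm_of V (restrict (lk (base a)) V)"
      using keys_base[of a] finite_V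
      by (intro poly_mapping_eqI) (auto simp: lookup_pm_of in_keys_iff)
    ultimately show "(base a, free a) \<in> (pm_of V ` (\<Pi>\<^sub>E v\<in>V. {..k})) \<times> Pow V"
      using free_subset by auto
  qed
  show "finite ((pm_of V ` (\<Pi>\<^sub>E v\<in>V. {..k})) \<times> Pow V)"
    using finite_V by (auto intro!: finite_PiE)
qed

context
  fixes a b assumes a: "Poly_Mapping.keys a \<subseteq> V" and b: "b \<in> cone (base a) (free a)"
begin

lemma cone_trunc_eq:
  assumes "v \<notin> dirs a"
  shows "min (lk b v) k = min (lk a v) k"
proof (cases "v \<in> V")
  case True
  have "if k \<le> lk a v then lk (base a) v \<le> lk b v else lk b v = lk (base a) v"
    using b assms True by (simp add: cone_def free_def split: if_splits)
  then show ?thesis using assms by (simp add: lookup_base[OF a] split: if_splits)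
next
  case False
  then have "v \<notin> free a" using free_subset by auto
  then have "lk b v = lk (base a) v" using b by (simp add: cone_def split: if_splits)
  then show ?thesis using assms a by (simp add: lookup_base)
qed

text \<open>A block contains only one chosen direction \<open>v\<close>. Off \<open>v\<close>, the
  exponents \<open>a\<close> and \<open>b\<close> agree in the block up to truncation, and moving
  \<open>a\<close> along \<open>v\<close> to the value of \<open>b\<close> is harmless, as that
  value is at least \<open>start a v\<close>.\<close>

lemma cone_inv_eq:
  assumes C: "C \<in> \<B>"
  shows "\<kappa> C b = \<kappa> C a"
proof -
  define v where "v = \<delta> (\<kappa> C a)"
  have v: "v \<in> dirs a" using C by (auto simp: v_def dirs_def)
  then have "start a v \<le> lk b v"
    using b a by (simp add: cone_def free_def lookup_base split: if_splits)
  then have "same_inv a v (lk b v)" using same_inv_iff[OF v] by simp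
  then have "\<kappa> C (Poly_Mapping.update v (lk b v) a) = \<kappa> C a" using C by (simp add: same_inv_def)
  moreover have "\<kappa> C b = \<kappa> C (Poly_Mapping.update v (lk b v) a)"
  proof (rule inv_trunc[OF C])
    fix w assume "w \<in> C"
    then have "w \<notin> dirs a" if "w \<noteq> v" using dirs_block[OF _ C] that by (auto simp: v_def)
    then show "min (lk b w) k = min (lk (Poly_Mapping.update v (lk b v) a) w) k"
      using cone_trunc_eq by (auto simp: lookup_update)
  qed
  ultimately show ?thesis by simp
qed

lemma cone_dirs_eq: "dirs b = dirs a"
  by (auto simp: dirs_def cone_inv_eq)

lemma cone_free_eq: "free b = free a"
proof -
  have "k \<le> lk b v \<longleftrightarrow> k \<le> lk a v" if "v \<notin> dirs a" for v
    using cone_trunc_eq[OF that] by linarith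
  then show ?thesis by (auto simp: free_def cone_dirs_eq)
qed

text \<open>Once the coordinate \<open>v\<close> is set to a common value, \<open>a\<close> and
  \<open>b\<close> agree up to truncation in the block of \<open>v\<close>; the other blocks do not
  see \<open>v\<close>.\<close>

lemma cone_start_eq:
  assumes v: "v \<in> dirs a"
  shows "start b v = start a v"
proof -
  have "\<kappa> C (Poly_Mapping.update v s b) = \<kappa> C (Poly_Mapping.update v s a)" if C: "C \<in> \<B>" for C s
  proof (cases "v \<in> C")
    case True
    show ?thesis
    proof (rule inv_trunc[OF C])
      fix w assume "w \<in> C"
      then have "w \<notin> dirs a" if "w \<noteq> v" using dirs_block[OF _ C] that True v by metis
      then show "min (lk (Poly_Mapping.update v s b) w) k = min (lk (Poly_Mapping.update v s a) w) k"
        using cone_trunc_eq by (auto simp: lookup_update)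
    qed
  next
    case False
    have "\<kappa> C (Poly_Mapping.update v s c) = \<kappa> C c" for c
      using False by (intro inv_trunc[OF C]) (auto simp: lookup_update)
    then show ?thesis using cone_inv_eq[OF C] by simp
  qed
  then show ?thesis by (simp add: start_def same_inv_def cone_inv_eq cong: ball_cong)
qed

lemma keys_cone_base: "Poly_Mapping.keys b \<subseteq> V"
  using keys_cone_subset[OF b] keys_base free_subset by blast

text \<open>With \<open>cone_free_eq\<close>: every exponent in the cone of \<open>a\<close> has the
  same cone. Hence two of these cones are equal or disjoint, and they form a partition.\<close>

lemma cone_base_eq: "base b = base a"
  by (rule poly_mapping_eqI)
    (simp add: lookup_base[OF a] lookup_base[OF keys_cone_base] cone_dirs_eq cone_start_eq cone_trunc_eq)

end

end

section \<open>Packing numbers\<close>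

text \<open>The packing number is truncated at \<open>k\<close>, so that it only depends on truncated
  exponents.\<close>

definition nu :: "'v set set \<Rightarrow> nat \<Rightarrow> ('v \<Rightarrow>\<^sub>0 nat) \<Rightarrow> nat" where
  "nu F k a = Max {t. t \<le> k \<and> epow F t a}"

lemma nu_le: "nu F k a \<le> k" and epow_nu: "epow F (nu F k a) a"
proof -
  have "nu F k a \<in> {t. t \<le> k \<and> epow F t a}"
    unfolding nu_def by (rule Max_in) (auto intro: exI[of _ 0] epow_0)
  then show "nu F k a \<le> k" "epow F (nu F k a) a" by auto
qed

lemma le_nu_iff: "t \<le> k \<Longrightarrow> t \<le> nu F k a \<longleftrightarrow> epow F t a"
proof -
  assume t: "t \<le> k"
  show ?thesis
  proof
    assume "epow F t a"
    then show "t \<le> nu F k a" unfolding nu_def using t by (intro Max_ge) auto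
  qed (rule epow_le[OF epow_nu])
qed

lemma nu_eqI: "(\<And>t. t \<le> k \<Longrightarrow> epow F t a \<longleftrightarrow> epow F t b) \<Longrightarrow> nu F k a = nu F k b"
  by (rule order_antisym)
    (use nu_le[of F k a] nu_le[of F k b] epow_nu[of F k a] epow_nu[of F k b] in
      \<open>simp_all add: le_nu_iff\<close>)

lemma nu_cong:
  assumes "\<forall>e\<in>F. card e = 2" and "\<And>v. v \<in> \<Union> F \<Longrightarrow> min (lk a v) k = min (lk b v) k"
  shows "nu F k a = nu F k b"
proof (rule nu_eqI)
  fix t assume t: "t \<le> k"
  have "min (lk a v) t \<le> lk b v \<and> min (lk b v) t \<le> lk a v" if "v \<in> \<Union> F" for v
    using assms(2)[OF that] t by linarith
  then show "epow F t a \<longleftrightarrow> epow F t b"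
    using epow_trunc[OF _ assms(1)] by metis
qed

lemma nu_mono: "nu F k a \<le> nu F k (a + b)"
  using epow_mono[OF epow_nu] by (simp add: le_nu_iff nu_le)

lemma epow_sum: "finite S \<Longrightarrow> (\<And>i. i \<in> S \<Longrightarrow> epow E (t i) (a i)) \<Longrightarrow> epow E (sum t S) (sum a S)"
  by (induction S rule: finite_induct) (auto intro: epow_0 epow_add)

definition inner_edges :: "'v set set \<Rightarrow> 'v set \<Rightarrow> 'v set set" where
  "inner_edges E C = {e \<in> E. e \<subseteq> C}"

lemma epow_split:
  assumes "epow E t a" and fin: "finite \<C>" and "\<And>e. e \<in> E \<Longrightarrow> \<exists>C\<in>\<C>. e \<subseteq> C"
  shows "\<exists>f. sum f \<C> = t \<and> (\<forall>C\<in>\<C>. epow (inner_edges E C) (f C) a)"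
  using assms(1)
proof (induction rule: epow.induct)
  case (epow_0 a)
  show ?case by (rule exI[of _ "\<lambda>_. 0"]) (auto intro: epow.epow_0)
next
  case (epow_Suc t a x y)
  then obtain f where f: "sum f \<C> = t" "\<And>C. C \<in> \<C> \<Longrightarrow> epow (inner_edges E C) (f C) a" by blast
  obtain D where D: "D \<in> \<C>" "{x, y} \<subseteq> D" using assms(3) epow_Suc by blast
  have "sum (f(D := Suc (f D))) \<C> = Suc t"
    using D fin f(1) by (simp add: sum.remove[of \<C> D])
  moreover have "epow (inner_edges E C) ((f(D := Suc (f D))) C) (a + pm_ev x + pm_ev y)"
    if "C \<in> \<C>" for C
  proof (cases "C = D")
    case True
    then show ?thesis
      using epow.epow_Suc[OF f(2)[OF that]] D epow_Suc.hyps by (auto simp: inner_edges_def)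
  next
    case False
    then show ?thesis
      using epow_mono[OF f(2)[OF that], of "pm_ev x + pm_ev y"] by (simp add: ac_simps)
  qed
  ultimately show ?case by blast
qed

text \<open>Packings in disjoint vertex sets do not compete for capacity. Truncating the summands at
  \<open>k\<close> loses nothing, because no component holds more than \<open>k\<close> of
  \<open>k\<close> edges.\<close>

lemma epow_iff_sum_nu:
  assumes fin: "finite \<C>" and E: "\<forall>e\<in>E. card e = 2"
    and cov: "\<And>e. e \<in> E \<Longrightarrow> \<exists>C\<in>\<C>. e \<subseteq> C"
    and disj: "\<And>C D v. C \<in> \<C> \<Longrightarrow> D \<in> \<C> \<Longrightarrow> v \<in> C \<Longrightarrow> v \<in> D \<Longrightarrow> C = D"
  shows "epow E k a \<longleftrightarrow> k \<le> (\<Sum>C\<in>\<C>. nu (inner_edges E C) k a)"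
proof
  assume "epow E k a"
  then obtain f where f: "sum f \<C> = k" "\<And>C. C \<in> \<C> \<Longrightarrow> epow (inner_edges E C) (f C) a"
    using epow_split[OF _ fin cov] by blast
  have "f C \<le> nu (inner_edges E C) k a" if C: "C \<in> \<C>" for C
  proof -
    have "f C \<le> k" using member_le_sum[OF C, of f] fin f(1) by simp
    then show ?thesis using f(2)[OF C] by (simp add: le_nu_iff)
  qed
  then show "k \<le> (\<Sum>C\<in>\<C>. nu (inner_edges E C) k a)" using sum_mono f(1) by metis
next
  assume k: "k \<le> (\<Sum>C\<in>\<C>. nu (inner_edges E C) k a)"
  have "epow E (nu (inner_edges E C) k a) (restr a C)" for C
  proof (rule epow_mono_edges)
    show "epow (inner_edges E C) (nu (inner_edges E C) k a) (restr a C)"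
      by (rule epow_trunc[OF epow_nu]) (use E in \<open>auto simp: inner_edges_def lookup_restr\<close>)
  qed (auto simp: inner_edges_def)
  then have "epow E k (\<Sum>C\<in>\<C>. restr a C)"
    using epow_le[OF epow_sum[OF fin] k] by blast
  then show "epow E k a"
  proof (rule epow_trunc[OF _ E])
    fix v
    have "(\<Sum>C\<in>\<C>. if v \<in> C then lk a v else 0) \<le> lk a v"
    proof (cases "\<exists>C\<in>\<C>. v \<in> C")
      case True
      then obtain D where "D \<in> \<C>" "v \<in> D" by blast
      then have "(\<Sum>C\<in>\<C>. if v \<in> C then lk a v else 0) = (\<Sum>C\<in>\<C>. if C = D then lk a v else 0)"
        using disj by (intro sum.cong) auto
      then show ?thesis using fin by simp
    qed (simp add: sum.neutral)
    then show "min (lk (\<Sum>C\<in>\<C>. restr a C) v) k \<le> lk a v"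
      by (simp add: lookup_sum lookup_restr)
  qed
qed

section \<open>Free directions in bipartite components\<close>

text \<open>Raising \<open>v\<close> by \<open>k\<close> already exhausts the truncation, so this
  tests invariance under raising \<open>v\<close> by any amount.\<close>

definition free_dirs :: "'v set set \<Rightarrow> 'v set \<Rightarrow> nat \<Rightarrow> ('v \<Rightarrow>\<^sub>0 nat) \<Rightarrow> 'v set" where
  "free_dirs F C k a = {v \<in> C. nu F k (a + Poly_Mapping.single v k) = nu F k a}"

text \<open>The numbering \<open>h\<close> makes the choice depend on the set of candidates in a
  monotone way: it is unchanged when other candidates disappear.\<close>

definition free_dir :: "('v \<Rightarrow> nat) \<Rightarrow> 'v set set \<Rightarrow> 'v set \<Rightarrow> nat \<Rightarrow> ('v \<Rightarrow>\<^sub>0 nat) \<Rightarrow> 'v" where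
  "free_dir h F C k a = arg_min_on h (free_dirs F C k a)"

definition bipartition :: "'v set set \<Rightarrow> 'v set \<Rightarrow> 'v set \<Rightarrow> 'v set \<Rightarrow> bool" where
  "bipartition F C X Y \<longleftrightarrow> C = X \<union> Y \<and> X \<inter> Y = {} \<and> (\<forall>e\<in>F. \<exists>x\<in>X. \<exists>y\<in>Y. e = {x, y})"

context
  fixes F :: "'v set set" and C X Y :: "'v set" and k :: nat and h :: "'v \<Rightarrow> nat"
  assumes bip: "bipartition F C X Y" and finC: "finite C" and neC: "C \<noteq> {}"
    and h: "inj_on h C" and k: "k \<ge> 1"
begin

lemma card_bip_edge: "\<forall>e\<in>F. card e = 2"
proof
  fix e assume "e \<in> F"
  with bip obtain x y where "x \<in> X" "y \<in> Y" "e = {x, y}" by (auto simp: bipartition_def)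
  moreover from this have "x \<noteq> y" using bip by (auto simp: bipartition_def)
  ultimately show "card e = 2" by simp
qed

lemma free_dirs_nonempty: "free_dirs F C k a \<noteq> {}"
proof -
  obtain v where "v \<in> C" and v: "\<And>t s. epow F t (a + Poly_Mapping.single v s) \<Longrightarrow> epow F t a"
    using exists_free_direction[of X Y F a thesis for thesis] bip finC neC
    by (auto simp: bipartition_def)
  moreover have "nu F k (a + Poly_Mapping.single v k) = nu F k a"
    using v epow_mono by (intro nu_eqI) blast
  ultimately show ?thesis by (auto simp: free_dirs_def)
qed

lemma finite_free_dirs: "finite (free_dirs F C k a)"
  using finC by (simp add: free_dirs_def)

lemma free_dir_mem: "free_dir h F C k a \<in> free_dirs F C k a"
  unfolding free_dir_def using arg_min_if_finite(1)[OF finite_free_dirs free_dirs_nonempty] .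

lemma free_dir_eqI:
  assumes "v \<in> free_dirs F C k a" "\<And>w. w \<in> free_dirs F C k a \<Longrightarrow> h v \<le> h w"
  shows "free_dir h F C k a = v"
proof -
  have "h (free_dir h F C k a) = h v"
    using arg_min_least[OF finite_free_dirs free_dirs_nonempty assms(1), of h]
      assms(2)[OF free_dir_mem] by (simp add: free_dir_def)
  moreover have "free_dir h F C k a \<in> C" "v \<in> C"
    using free_dir_mem assms(1) by (auto simp: free_dirs_def)
  ultimately show ?thesis using h by (auto dest: inj_onD)
qed

lemma free_dir_least: "w \<in> free_dirs F C k a \<Longrightarrow> h (free_dir h F C k a) \<le> h w"
  using arg_min_least[OF finite_free_dirs free_dirs_nonempty] by (simp add: free_dir_def)

lemma invariant_trunc:
  assumes "\<And>v. v \<in> C \<Longrightarrow> min (lk a v) k = min (lk b v) k"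
  shows "nu F k a = nu F k b" "free_dir h F C k a = free_dir h F C k b"
proof -
  have UF: "\<Union> F \<subseteq> C" using bip by (fastforce simp: bipartition_def)
  show nu: "nu F k a = nu F k b"
    by (rule nu_cong[OF card_bip_edge]) (use assms UF in auto)
  have "nu F k (a + Poly_Mapping.single v k) = nu F k (b + Poly_Mapping.single v k)" for v
  proof (rule nu_cong[OF card_bip_edge])
    fix w assume "w \<in> \<Union> F"
    then have "min (lk a w) k = min (lk b w) k" using assms UF by auto
    then show "min (lk (a + Poly_Mapping.single v k) w) k = min (lk (b + Poly_Mapping.single v k) w) k"
      by (auto simp: lookup_add lookup_single when_def)
  qed
  then show "free_dir h F C k a = free_dir h F C k b"
    by (simp add: free_dir_def free_dirs_def nu)
qed

text \<open>A direction that is free after the move was free before it: raising it from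
  \<open>a\<close> yields at most what raising it from \<open>a + pm_ev v\<close> yields, and the
  latter is \<open>nu F k a\<close>. So candidates only disappear, while \<open>v\<close> survives
  and remains least.\<close>

lemma invariant_free_dir:
  fixes a
  defines "v \<equiv> free_dir h F C k a"
  shows "nu F k (a + pm_ev v) = nu F k a" "free_dir h F C k (a + pm_ev v) = v"
proof -
  have v: "nu F k (a + Poly_Mapping.single v k) = nu F k a" "v \<in> C"
    using free_dir_mem[of a] by (auto simp: v_def free_dirs_def)
  have vk: "Poly_Mapping.single v k = pm_ev v + Poly_Mapping.single v (k - 1)"
    using k by (simp add: pm_ev_def flip: single_add)
  show nu: "nu F k (a + pm_ev v) = nu F k a"
    using nu_mono[of F k a "pm_ev v"] nu_mono[of F k "a + pm_ev v" "Poly_Mapping.single v (k - 1)"] v(1)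
    by (simp add: vk ac_simps)
  show "free_dir h F C k (a + pm_ev v) = v"
  proof (rule free_dir_eqI)
    have "nu F k (a + pm_ev v + Poly_Mapping.single v k) = nu F k (a + Poly_Mapping.single v k)"
      by (rule nu_cong[OF card_bip_edge]) (auto simp: lookup_add lookup_single lookup_ev when_def)
    then show "v \<in> free_dirs F C k (a + pm_ev v)" using v nu by (simp add: free_dirs_def)
  next
    fix w assume w: "w \<in> free_dirs F C k (a + pm_ev v)"
    have "nu F k (a + Poly_Mapping.single w k) \<le> nu F k (a + Poly_Mapping.single w k + pm_ev v)"
      by (rule nu_mono)
    also have "\<dots> = nu F k a"
      using w nu by (simp add: free_dirs_def ac_simps)
    finally have "w \<in> free_dirs F C k a"
      using w nu_mono[of F k a "Poly_Mapping.single w k"] by (simp add: free_dirs_def)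
    then show "h v \<le> h w" unfolding v_def by (rule free_dir_least)
  qed
qed

end

text \<open>Instance of \<open>free_blocks\<close> with the pair of packing number and chosen
  direction as the invariant of a bipartite block. Membership in the power is constant on each cone
  because every packing number is.\<close>

theorem cone_partition_complement:
  fixes V :: "'v set" and E \<C> \<B> :: "'v set set"
  assumes finV: "finite V" and k: "k \<ge> 1"
    and E: "\<forall>e\<in>E. card e = 2" and cov: "\<And>e. e \<in> E \<Longrightarrow> \<exists>C\<in>\<C>. e \<subseteq> C"
    and disj: "\<And>C D v. C \<in> \<C> \<Longrightarrow> D \<in> \<C> \<Longrightarrow> v \<in> C \<Longrightarrow> v \<in> D \<Longrightarrow> C = D"
    and sub: "\<And>C. C \<in> \<C> \<Longrightarrow> C \<subseteq> V" and ne: "{} \<notin> \<C>"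
    and B: "\<B> \<subseteq> \<C>" and bip: "\<And>C. C \<in> \<B> \<Longrightarrow> \<exists>X Y. bipartition (inner_edges E C) C X Y"
  shows "\<exists>(base :: ('v \<Rightarrow>\<^sub>0 nat) \<Rightarrow> 'v \<Rightarrow>\<^sub>0 nat) free.
    finite ((\<lambda>a. (base a, free a)) ` {a. Poly_Mapping.keys a \<subseteq> V}) \<and>
    (\<forall>a. Poly_Mapping.keys (base a) \<subseteq> V \<and> free a \<subseteq> V \<and> card \<B> \<le> card (free a)) \<and>
    (\<forall>a. Poly_Mapping.keys a \<subseteq> V \<longrightarrow> a \<in> cone (base a) (free a) \<and>
       (\<forall>b\<in>cone (base a) (free a).
          base b = base a \<and> free b = free a \<and> (epow E k b \<longleftrightarrow> epow E k a)))"
proof -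
  obtain h :: "'v \<Rightarrow> nat" where h: "inj_on h V"
    using finV finite_imp_inj_to_nat_seg by metis
  define \<kappa> where "\<kappa> C a = (nu (inner_edges E C) k a, free_dir h (inner_edges E C) C k a)" for C a
  have BC: "finite C" "C \<noteq> {}" "inj_on h C" if "C \<in> \<B>" for C
    using that B sub ne finV h by (auto intro: finite_subset inj_on_subset)
  interpret free_blocks V \<B> k \<kappa> snd
  proof
    fix C a assume C: "C \<in> \<B>"
    then obtain X Y where XY: "bipartition (inner_edges E C) C X Y" using bip by blast
    show "C \<subseteq> V" using C B sub by auto
    show "snd (\<kappa> C a) \<in> C"
      using free_dir_mem[OF XY BC[OF C] k] by (auto simp: \<kappa>_def free_dirs_def)
    show "\<kappa> C (a + pm_ev (snd (\<kappa> C a))) = \<kappa> C a"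
      using invariant_free_dir[OF XY BC[OF C] k] by (simp add: \<kappa>_def)
    show "\<kappa> C a = \<kappa> C b" if "\<And>v. v \<in> C \<Longrightarrow> min (lk a v) k = min (lk b v) k" for b
      using invariant_trunc[OF XY BC[OF C] k that] by (simp add: \<kappa>_def)
    show "C = D" if "D \<in> \<B>" "v \<in> C" "v \<in> D" for D v
      using disj C that B by blast
  qed (rule finV)
  have finC: "finite \<C>" using sub finV by (meson PowI finite_Pow_iff finite_subset subsetI)
  have "epow E k b \<longleftrightarrow> epow E k a"
    if a: "Poly_Mapping.keys a \<subseteq> V" and b: "b \<in> cone (base a) (free a)" for a b
  proof -
    have "nu (inner_edges E C) k b = nu (inner_edges E C) k a" if C: "C \<in> \<C>" for C
    proof (cases "C \<in> \<B>")
      case True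
      then show ?thesis using cone_inv_eq[OF a b True] by (simp add: \<kappa>_def)
    next
      \<comment> \<open>This block contains no chosen direction, so all its coordinates are constant
        on the cone up to truncation.\<close>
      case False
      show ?thesis
      proof (rule nu_cong)
        fix v assume "v \<in> \<Union> (inner_edges E C)"
        then have "v \<in> C" by (auto simp: inner_edges_def)
        have "v \<notin> dirs a"
        proof
          assume "v \<in> dirs a"
          then obtain D where "D \<in> \<B>" "v \<in> D" using dir_mem by (auto simp: dirs_def)
          then show False using disj[OF C, of D v] \<open>v \<in> C\<close> B False by blast
        qed
        then show "min (lk b v) k = min (lk a v) k" by (rule cone_trunc_eq[OF a b])
      qed (use E in \<open>auto simp: inner_edges_def\<close>)
    qed
    then have "(\<Sum>C\<in>\<C>. nu (inner_edges E C) k b) = (\<Sum>C\<in>\<C>. nu (inner_edges E C) k a)"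
      by (rule sum.cong[OF refl])
    then show ?thesis
      using epow_iff_sum_nu[OF finC E cov disj, where k = k and a = a]
        epow_iff_sum_nu[OF finC E cov disj, where k = k and a = b] by simp
  qed
  note epow_eq = this
  have "\<forall>a. Poly_Mapping.keys a \<subseteq> V \<longrightarrow> a \<in> cone (base a) (free a) \<and>
       (\<forall>b\<in>cone (base a) (free a).
          base b = base a \<and> free b = free a \<and> (epow E k b \<longleftrightarrow> epow E k a))"
  proof (intro allI impI conjI ballI)
    fix a :: "'v \<Rightarrow>\<^sub>0 nat" assume a: "Poly_Mapping.keys a \<subseteq> V"
    show "a \<in> cone (base a) (free a)" by (rule mem_cone_base[OF a])
    fix b assume b: "b \<in> cone (base a) (free a)"
    show "base b = base a" by (rule cone_base_eq[OF a b])
    show "free b = free a" by (rule cone_free_eq[OF a b])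
    show "epow E k b \<longleftrightarrow> epow E k a" by (rule epow_eq[OF a b])
  qed
  moreover have "\<forall>a. Poly_Mapping.keys (base a) \<subseteq> V \<and> free a \<subseteq> V \<and> card \<B> \<le> card (free a)"
    by (simp add: keys_base free_subset card_free)
  ultimately show ?thesis
    using finite_bases by (intro exI[of _ base] exI[of _ free] conjI)
qed

section \<open>The polynomial ring\<close>

lemma pm_sum_monomials:
  "p = (\<Sum>a\<in>Poly_Mapping.keys p. Poly_Mapping.single a (lk p a))"
  by (rule poly_mapping_eqI) (auto simp: lookup_sum lookup_single when_def in_keys_iff)

lemma lookup_mult_single:
  fixes p :: "('v \<Rightarrow>\<^sub>0 nat) \<Rightarrow>\<^sub>0 'k::field"
  shows "lk (p * Poly_Mapping.single c r) (b + c) = lk p b * r"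
proof -
  have "p * Poly_Mapping.single c r
      = (\<Sum>a\<in>Poly_Mapping.keys p. Poly_Mapping.single (a + c) (lk p a * r))"
    by (subst pm_sum_monomials) (simp add: sum_distrib_right mult_single)
  then show ?thesis
    by (auto simp: lookup_sum lookup_single when_def in_keys_iff)
qed

lemma keys_mult_single:
  fixes p :: "('v \<Rightarrow>\<^sub>0 nat) \<Rightarrow>\<^sub>0 'k::field"
  shows "Poly_Mapping.keys (p * Poly_Mapping.single c 1) = (\<lambda>b. b + c) ` Poly_Mapping.keys p"
proof
  show "Poly_Mapping.keys (p * Poly_Mapping.single c 1) \<subseteq> (\<lambda>b. b + c) ` Poly_Mapping.keys p"
    using keys_mult[of p "Poly_Mapping.single c 1"] by auto
  show "(\<lambda>b. b + c) ` Poly_Mapping.keys p \<subseteq> Poly_Mapping.keys (p * Poly_Mapping.single c 1)"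
    by (auto simp: in_keys_iff lookup_mult_single)
qed

lemma mem_mpoly_ring: "p \<in> carrier (mpoly_ring V) \<longleftrightarrow> (\<forall>a\<in>Poly_Mapping.keys p. Poly_Mapping.keys a \<subseteq> V)"
  by (simp add: mpoly_ring_def)

lemma mpoly_ring_simps [simp]:
  "mult (mpoly_ring V) = (*)" "one (mpoly_ring V) = 1" "zero (mpoly_ring V) = 0"
  "add (mpoly_ring V) = (+)"
  by (simp_all add: mpoly_ring_def)

lemma single_mem_mpoly_ring: "Poly_Mapping.keys a \<subseteq> V \<Longrightarrow> Poly_Mapping.single a c \<in> carrier (mpoly_ring V)"
  by (auto simp: mem_mpoly_ring split: if_splits)

lemma keys_pm_ev [simp]: "Poly_Mapping.keys (pm_ev v) = {v}"
  by (simp add: pm_ev_def)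

lemma mvar_eq: "mvar v = Poly_Mapping.single (pm_ev v) 1"
  by (simp add: mvar_def pm_ev_def)

lemma mvar_mem: "v \<in> V \<Longrightarrow> mvar v \<in> carrier (mpoly_ring V)"
  by (simp add: mvar_eq single_mem_mpoly_ring)

interpretation mp: subring_set "carrier (mpoly_ring V) :: ('v, 'k::field) mpoly set" for V
proof
  fix p q :: "('v, 'k) mpoly" assume pq: "p \<in> carrier (mpoly_ring V)" "q \<in> carrier (mpoly_ring V)"
  show "p - q \<in> carrier (mpoly_ring V)"
    unfolding mem_mpoly_ring
  proof
    fix a assume "a \<in> Poly_Mapping.keys (p - q)"
    then have "a \<in> Poly_Mapping.keys p \<or> a \<in> Poly_Mapping.keys q" by (auto simp: in_keys_iff lookup_minus)
    then show "Poly_Mapping.keys a \<subseteq> V" using pq by (auto simp: mem_mpoly_ring)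
  qed
  show "p * q \<in> carrier (mpoly_ring V)"
    unfolding mem_mpoly_ring
  proof
    fix a assume "a \<in> Poly_Mapping.keys (p * q)"
    then obtain b c where "a = b + c" "b \<in> Poly_Mapping.keys p" "c \<in> Poly_Mapping.keys q"
      using keys_mult by blast
    then show "Poly_Mapping.keys a \<subseteq> V" using pq keys_add[of b c] by (fastforce simp: mem_mpoly_ring)
  qed
qed (auto simp: mem_mpoly_ring)

lemma cring_mpoly_ring: "cring (mpoly_ring V :: ('v, 'k::field) mpoly ring)"
proof (rule cringI)
  show "abelian_group (mpoly_ring V :: ('v, 'k) mpoly ring)"
  proof (rule abelian_groupI)
    fix p :: "('v, 'k) mpoly" assume "p \<in> carrier (mpoly_ring V)"
    then show "\<exists>q\<in>carrier (mpoly_ring V). q \<oplus>\<^bsub>mpoly_ring V\<^esub> p = \<zero>\<^bsub>mpoly_ring V\<^esub>"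
      by (intro bexI[of _ "- p"]) (auto intro: mp.uminus_mem)
  qed (auto intro: mp.zero_mem mp.add_mem simp: ac_simps)
  show "Group.comm_monoid (mpoly_ring V :: ('v, 'k) mpoly ring)"
    by (rule comm_monoidI) (auto intro: mp.one_mem mp.mult_mem simp: ac_simps)
qed (auto simp: algebra_simps)

text \<open>Connects the ideals of the algebra library with the relative notion in which the Koszul
  argument is carried out.\<close>

lemma ideal_iff_ideal_set:
  fixes A :: "('v, 'k::field) mpoly set"
  shows "ideal A (mpoly_ring V) \<longleftrightarrow> mp.ideal_set V A"
proof
  assume "ideal A (mpoly_ring V)"
  then interpret ideal A "mpoly_ring V" .
  have "- b \<in> A" if "b \<in> A" for b
  proof -
    have "(- 1) * b \<in> A"
      using I_l_closed[OF that, of "- 1"] mp.uminus_mem[OF mp.one_mem, of V] by simp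
    then show ?thesis by simp
  qed
  then have "a - b \<in> A" if "a \<in> A" "b \<in> A" for a b
    using additive_subgroup.a_closed[OF additive_subgroup_axioms, of a "- b"] that by simp
  then show "mp.ideal_set V A"
    unfolding mp.ideal_set_def using a_subset I_l_closed additive_subgroup.zero_closed[OF additive_subgroup_axioms] by auto
next
  assume A: "mp.ideal_set V A"
  interpret cring "mpoly_ring V :: ('v, 'k) mpoly ring" by (rule cring_mpoly_ring)
  show "ideal A (mpoly_ring V)"
  proof (rule idealI)
    show "subgroup A (add_monoid (mpoly_ring V))"
    proof (rule group.subgroupI)
      show "group (add_monoid (mpoly_ring V :: ('v, 'k) mpoly ring))" by (rule a_group)
      fix a assume a: "a \<in> A"
      have "inv\<^bsub>add_monoid (mpoly_ring V)\<^esub> a = - a"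
        using minus_equality[of "- a" a] mp.ideal_setD(1)[OF A a] mp.uminus_mem[of a V]
        by (simp add: a_inv_def)
      then show "inv\<^bsub>add_monoid (mpoly_ring V)\<^esub> a \<in> A"
        using mp.ideal_set_uminus[OF A a] by simp
    next
      show "A \<noteq> {}" using mp.ideal_setD(2)[OF A] by auto
    qed (use mp.ideal_setD[OF A] mp.ideal_set_add[OF A] in auto)
    fix a x :: "('v, 'k) mpoly" assume "a \<in> A" "x \<in> carrier (mpoly_ring V)"
    then have "x * a \<in> A" by (intro mp.ideal_setD(4)[OF A])
    then show "x \<otimes>\<^bsub>mpoly_ring V\<^esub> a \<in> A" "a \<otimes>\<^bsub>mpoly_ring V\<^esub> x \<in> A"
      by (simp_all add: mult.commute)
  qed (rule ring_axioms)
qed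

section \<open>Powers of the edge ideal\<close>

definition monomial_ideal :: "'v set \<Rightarrow> (('v \<Rightarrow>\<^sub>0 nat) \<Rightarrow> bool) \<Rightarrow> ('v, 'k::field) mpoly set" where
  "monomial_ideal V P = {p \<in> carrier (mpoly_ring V). \<forall>a\<in>Poly_Mapping.keys p. P a}"

lemma ideal_set_monomial_ideal:
  assumes "\<And>a b. P a \<Longrightarrow> P (a + b)"
  shows "mp.ideal_set V (monomial_ideal V P :: ('v, 'k::field) mpoly set)"
  unfolding mp.ideal_set_def
proof (intro conjI ballI)
  fix p q :: "('v, 'k) mpoly" assume pq: "p \<in> monomial_ideal V P" "q \<in> monomial_ideal V P"
  have "a \<in> Poly_Mapping.keys p \<or> a \<in> Poly_Mapping.keys q" if "a \<in> Poly_Mapping.keys (p - q)" for a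
    using that by (auto simp: in_keys_iff lookup_minus)
  then show "p - q \<in> monomial_ideal V P"
    using pq by (auto simp: monomial_ideal_def intro: mp.diff_mem)
next
  fix s p :: "('v, 'k) mpoly" assume s: "s \<in> carrier (mpoly_ring V)" and p: "p \<in> monomial_ideal V P"
  have "P a" if a: "a \<in> Poly_Mapping.keys (s * p)" for a
  proof -
    obtain b c where "a = b + c" "c \<in> Poly_Mapping.keys p" using a keys_mult[of s p] by blast
    then show ?thesis using assms[of c b] p by (simp add: monomial_ideal_def ac_simps)
  qed
  then show "s * p \<in> monomial_ideal V P"
    using s p by (auto simp: monomial_ideal_def intro: mp.mult_mem)
qed (auto simp: monomial_ideal_def mp.zero_mem)

lemma monomial_ideal_subset:
  fixes A :: "('v, 'k::field) mpoly set"
  assumes A: "mp.ideal_set V A"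
    and mon: "\<And>a c. Poly_Mapping.keys a \<subseteq> V \<Longrightarrow> P a \<Longrightarrow> Poly_Mapping.single a c \<in> A"
  shows "monomial_ideal V P \<subseteq> A"
proof
  fix p :: "('v, 'k) mpoly" assume p: "p \<in> monomial_ideal V P"
  have "(\<Sum>a\<in>Poly_Mapping.keys p. Poly_Mapping.single a (lk p a)) \<in> A"
    using p by (intro mp.ideal_set_sum[OF A] mon) (auto simp: monomial_ideal_def mem_mpoly_ring)
  then show "p \<in> A" by (simp flip: pm_sum_monomials)
qed

lemma ideal_set_epow: "mp.ideal_set V (monomial_ideal V (epow E k))"
  by (rule ideal_set_monomial_ideal) (rule epow_mono)

lemma keys_add_nat: "Poly_Mapping.keys (a + b) = Poly_Mapping.keys a \<union> Poly_Mapping.keys b"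
  for a b :: "'v \<Rightarrow>\<^sub>0 nat"
  by (auto simp: in_keys_iff lookup_add)

lemma edge_ideal_eq:
  assumes "\<And>e. e \<in> E \<Longrightarrow> e \<subseteq> V"
  shows "edge_ideal V E = (monomial_ideal V (epow E 1) :: ('v, 'k::field) mpoly set)"
proof
  interpret cring "mpoly_ring V :: ('v, 'k) mpoly ring" by (rule cring_mpoly_ring)
  let ?G = "{mvar u * mvar v | u v. {u, v} \<in> E} :: ('v, 'k) mpoly set"
  have mm: "mvar u * mvar v = (Poly_Mapping.single (pm_ev u + pm_ev v) 1 :: ('v, 'k) mpoly)" for u v
    by (simp add: mvar_eq mult_single)
  show "edge_ideal V E \<subseteq> (monomial_ideal V (epow E 1) :: ('v, 'k) mpoly set)"
    unfolding edge_ideal_def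
  proof (rule genideal_minimal)
    show "?G \<subseteq> monomial_ideal V (epow E 1)"
    proof clarify
      fix u v assume "{u, v} \<in> E"
      then show "mvar u * mvar v \<in> (monomial_ideal V (epow E 1) :: ('v, 'k) mpoly set)"
        using assms[of "{u, v}"] epow_edge
        by (auto simp: monomial_ideal_def mm keys_add_nat intro!: single_mem_mpoly_ring)
    qed
  qed (simp add: ideal_iff_ideal_set ideal_set_epow)
  have G: "?G \<subseteq> carrier (mpoly_ring V)"
    using assms by (fastforce simp: mm keys_add_nat intro!: single_mem_mpoly_ring)
  show "monomial_ideal V (epow E 1) \<subseteq> (edge_ideal V E :: ('v, 'k) mpoly set)"
  proof (rule monomial_ideal_subset)
    show I: "mp.ideal_set V (edge_ideal V E :: ('v, 'k) mpoly set)"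
      unfolding edge_ideal_def using genideal_ideal[OF G] by (simp add: ideal_iff_ideal_set)
    fix a :: "'v \<Rightarrow>\<^sub>0 nat" and c :: 'k assume a: "Poly_Mapping.keys a \<subseteq> V" "epow E 1 a"
    from a(2) obtain b x y where b: "a = b + pm_ev x + pm_ev y" "{x, y} \<in> E"
      by (cases rule: epow.cases) auto
    have "Poly_Mapping.single b c * (mvar x * mvar y) \<in> edge_ideal V E"
    proof (rule mp.ideal_setD(4)[OF I])
      show "Poly_Mapping.single b c \<in> carrier (mpoly_ring V)"
        using a(1) b by (intro single_mem_mpoly_ring) (auto simp: keys_add_nat)
      show "mvar x * mvar y \<in> (edge_ideal V E :: ('v, 'k) mpoly set)"
        unfolding edge_ideal_def using genideal_self[OF G] b(2) by blast
    qed
    then show "Poly_Mapping.single a c \<in> edge_ideal V E"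
      by (simp add: mm mult_single b(1) ac_simps)
  qed
qed

text \<open>The rule \<open>epow_Suc\<close> splits one edge off a monomial, which is the product
  with the first power. The zeroth power, the unit of the monoid of ideals, is the whole ring and
  matches \<open>epow_0\<close>.\<close>

lemma ideal_power_edge_ideal:
  assumes "\<And>e. e \<in> E \<Longrightarrow> e \<subseteq> V"
  shows "ideal_power (mpoly_ring V) (edge_ideal V E) k
    = (monomial_ideal V (epow E k) :: ('v, 'k::field) mpoly set)"
proof -
  interpret cring "mpoly_ring V :: ('v, 'k) mpoly ring" by (rule cring_mpoly_ring)
  interpret ids: Group.comm_monoid "ideals_set (mpoly_ring V :: ('v, 'k) mpoly ring)"
    by (rule ideals_set_is_comm_monoid)
  let ?J = "\<lambda>k. monomial_ideal V (epow E k) :: ('v, 'k) mpoly set"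
  have id: "ideal (?J k) (mpoly_ring V)" for k
    by (simp add: ideal_iff_ideal_set ideal_set_epow)
  have prod: "ideal_prod (mpoly_ring V) (?J k) (?J 1) = ?J (Suc k)" for k
  proof
    show "ideal_prod (mpoly_ring V) (?J k) (?J 1) \<subseteq> ?J (Suc k)"
    proof
      fix p assume "p \<in> ideal_prod (mpoly_ring V) (?J k) (?J 1)"
      then show "p \<in> ?J (Suc k)"
      proof (induction rule: ideal_prod.induct)
        case (prod p q)
        have "epow E (Suc k) a" if a: "a \<in> Poly_Mapping.keys (p * q)" for a
        proof -
          obtain b c where "a = b + c" "b \<in> Poly_Mapping.keys p" "c \<in> Poly_Mapping.keys q"
            using a keys_mult[of p q] by blast
          then show ?thesis using epow_add[of E k b 1 c] prod by (simp add: monomial_ideal_def)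
        qed
        then show ?case using prod by (auto simp: monomial_ideal_def intro: mp.mult_mem)
      next
        case (sum p q)
        then show ?case using mp.ideal_set_add[OF ideal_set_epow] by simp
      qed
    qed
    show "?J (Suc k) \<subseteq> ideal_prod (mpoly_ring V) (?J k) (?J 1)"
    proof (rule monomial_ideal_subset)
      show "mp.ideal_set V (ideal_prod (mpoly_ring V) (?J k) (?J 1))"
        using ideal_prod_is_ideal[OF id id] by (simp add: ideal_iff_ideal_set)
      fix a :: "'v \<Rightarrow>\<^sub>0 nat" and c :: 'k assume a: "Poly_Mapping.keys a \<subseteq> V" "epow E (Suc k) a"
      from a(2) obtain b x y where b: "a = b + pm_ev x + pm_ev y" "{x, y} \<in> E" "epow E k b"
        by (cases rule: epow.cases) auto
      have "Poly_Mapping.single b c \<in> ?J k"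
        using a(1) b
        by (auto simp: monomial_ideal_def keys_add_nat mp.zero_mem intro!: single_mem_mpoly_ring)
      moreover have "Poly_Mapping.single (pm_ev x + pm_ev y) 1 \<in> ?J 1"
        using epow_edge[OF b(2)] assms[OF b(2)]
        by (auto simp: monomial_ideal_def keys_add_nat intro!: single_mem_mpoly_ring)
      ultimately show "Poly_Mapping.single a c \<in> ideal_prod (mpoly_ring V) (?J k) (?J 1)"
        using ideal_prod.prod[of _ "?J k" _ "?J 1" "mpoly_ring V"] by (fastforce simp: mult_single b(1) ac_simps)
    qed
  qed
  have E1: "edge_ideal V E = ?J 1" by (rule edge_ideal_eq[OF assms])
  show ?thesis
    unfolding ideal_power_def
  proof (induction k)
    case 0
    show ?case by (auto simp: ideals_set_def monomial_ideal_def epow_0)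
  next
    case (Suc k)
    then show ?case by (simp add: E1 prod) (simp add: ideals_set_def prod[simplified])
  qed
qed

section \<open>The quotient module\<close>

abbreviation coset :: "'v set \<Rightarrow> ('v, 'k::field) mpoly set \<Rightarrow> ('v, 'k) mpoly \<Rightarrow> ('v, 'k) mpoly set" where
  "coset V J p \<equiv> a_r_coset (mpoly_ring V) J p"

locale mpoly_quotient =
  fixes V :: "'v set" and J :: "('v, 'k::field) mpoly set"
  assumes J: "mp.ideal_set V J"
begin

abbreviation "R \<equiv> mpoly_ring V :: ('v, 'k) mpoly ring"
abbreviation "M \<equiv> quot_module R J"

lemma J_ideal: "ideal J R"
  using J by (simp add: ideal_iff_ideal_set)

sublocale ideal J R
  rewrites "mult R = (*)" and "one R = 1" and "zero R = 0" and "add R = (+)"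
  by (rule J_ideal) simp_all

lemma coset_eq_iff:
  assumes "p \<in> carrier R" "q \<in> carrier R"
  shows "coset V J p = coset V J q \<longleftrightarrow> p - q \<in> J"
proof -
  have c: "coset V J p = {j + p | j. j \<in> J}" for p
    by (auto simp: a_r_coset_def r_coset_def)
  show ?thesis
  proof
    assume "coset V J p = coset V J q"
    moreover have "p \<in> coset V J p" using mp.ideal_setD(2)[OF J] by (force simp: c)
    ultimately show "p - q \<in> J" by (auto simp: c)
  next
    assume *: "p - q \<in> J"
    have "\<exists>j'. j + p = j' + q \<and> j' \<in> J" if "j \<in> J" for j
      using mp.ideal_set_add[OF J that *] by (intro exI[of _ "j + (p - q)"]) simp
    moreover have "\<exists>j'. j + q = j' + p \<and> j' \<in> J" if "j \<in> J" for j
      using mp.ideal_setD(3)[OF J that *] by (intro exI[of _ "j - (p - q)"]) simp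
    ultimately show "coset V J p = coset V J q" by (auto simp: c)
  qed
qed

lemma carrier_M: "carrier M = coset V J ` carrier R"
  by (auto simp: quot_module_def ring.defs FactRing_def A_RCOSETS_def RCOSETS_def a_r_coset_def)

lemma zero_M: "\<zero>\<^bsub>M\<^esub> = J"
  by (simp add: quot_module_def ring.defs FactRing_def)

lemma coset_zero: "coset V J 0 = J"
  by (auto simp: a_r_coset_def r_coset_def)

lemma coset_eq_zero_iff: "p \<in> carrier R \<Longrightarrow> coset V J p = J \<longleftrightarrow> p \<in> J"
  using coset_eq_iff[of p 0] by (simp add: coset_zero mp.zero_mem)

lemma smult_M:
  assumes "r \<in> carrier R" "p \<in> carrier R"
  shows "r \<odot>\<^bsub>M\<^esub> coset V J p = coset V J (r * p)"
proof -
  have "rcoset_mult R J (coset V J r) (coset V J p) = coset V J (r \<otimes>\<^bsub>R\<^esub> p)"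
    by (rule ideal.rcoset_mult_add[OF J_ideal assms])
  then show ?thesis by (simp add: quot_module_def ring.defs FactRing_def)
qed

lemma add_M:
  assumes "p \<in> carrier R" "q \<in> carrier R"
  shows "coset V J p \<oplus>\<^bsub>M\<^esub> coset V J q = coset V J (p + q)"
proof -
  have "set_add R (coset V J p) (coset V J q) = coset V J (p \<oplus>\<^bsub>R\<^esub> q)"
    by (rule ideal.a_rcos_sum[OF J_ideal assms])
  then show ?thesis by (simp add: quot_module_def ring.defs FactRing_def)
qed

lemma abelian_monoid_M: "abelian_monoid M"
proof (rule abelian_monoidI)
  show "\<zero>\<^bsub>M\<^esub> \<in> carrier M"
    unfolding zero_M carrier_M using imageI[OF mp.zero_mem, of "coset V J" V] coset_zero by simp
next
  fix x y assume "x \<in> carrier M" "y \<in> carrier M"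
  then obtain p q where "p \<in> carrier R" "x = coset V J p" "q \<in> carrier R" "y = coset V J q"
    by (auto simp: carrier_M)
  then show "x \<oplus>\<^bsub>M\<^esub> y \<in> carrier M" "x \<oplus>\<^bsub>M\<^esub> y = y \<oplus>\<^bsub>M\<^esub> x"
    by (simp_all add: carrier_M add_M mp.add_mem add.commute)
next
  fix x y z assume "x \<in> carrier M" "y \<in> carrier M" "z \<in> carrier M"
  then obtain p q r where "p \<in> carrier R" "x = coset V J p" "q \<in> carrier R" "y = coset V J q"
    "r \<in> carrier R" "z = coset V J r"
    by (auto simp: carrier_M)
  then show "x \<oplus>\<^bsub>M\<^esub> y \<oplus>\<^bsub>M\<^esub> z = x \<oplus>\<^bsub>M\<^esub> (y \<oplus>\<^bsub>M\<^esub> z)"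
    by (simp add: add_M mp.add_mem add.assoc)
next
  fix x assume "x \<in> carrier M"
  then obtain p where "p \<in> carrier R" "x = coset V J p" by (auto simp: carrier_M)
  then show "\<zero>\<^bsub>M\<^esub> \<oplus>\<^bsub>M\<^esub> x = x"
    using add_M[OF mp.zero_mem, of p] by (simp add: zero_M coset_zero)
qed

lemma finsum_M:
  assumes "finite B" "\<And>i. i \<in> B \<Longrightarrow> f i \<in> carrier R" "\<And>i. i \<in> B \<Longrightarrow> s i = coset V J (f i)"
  shows "finsum M s B = coset V J (sum f B)"
proof -
  interpret M: abelian_monoid M by (rule abelian_monoid_M)
  show ?thesis
    using assms
  proof (induction B rule: finite_induct)
    case empty
    then show ?case by (simp add: zero_M coset_zero)
  next
    case (insert i B)
    have "finsum M s (insert i B) = s i \<oplus>\<^bsub>M\<^esub> finsum M s B"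
      using insert by (intro M.finsum_insert) (auto simp: carrier_M)
    also have "\<dots> = coset V J (f i) \<oplus>\<^bsub>M\<^esub> coset V J (sum f B)"
      using insert by simp
    also have "\<dots> = coset V J (f i + sum f B)"
      using insert by (intro add_M mp.sum_mem) auto
    finally show ?case using insert by simp
  qed
qed

end

section \<open>Stanley decompositions from partitions into cones\<close>

lemma mult_single_keys_cone:
  fixes p :: "('v, 'k::field) mpoly"
  assumes "p \<in> carrier (mpoly_ring Z)" and "b \<in> Poly_Mapping.keys (p * Poly_Mapping.single c 1)"
  shows "b \<in> cone c Z"
proof -
  obtain a where "a \<in> Poly_Mapping.keys p" "b = a + c" using assms(2) by (auto simp: keys_mult_single)
  then show ?thesis using assms(1)
    by (auto simp: cone_def lookup_add mem_mpoly_ring in_keys_iff subset_iff)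
qed

text \<open>The subtraction \<open>b - c\<close> of exponents is truncated in general but exact on
  the cone, so the terms of \<open>p\<close> there can be divided by the apex monomial.\<close>

lemma restr_cone_eq_mult:
  fixes p :: "('v, 'k::field) mpoly"
  obtains q where "q \<in> carrier (mpoly_ring Z)"
    "restr p (cone c Z) = q * Poly_Mapping.single c 1"
proof
  define q where "q = (\<Sum>b\<in>Poly_Mapping.keys p \<inter> cone c Z. Poly_Mapping.single (b - c) (lk p b))"
  have bc: "Poly_Mapping.keys (b - c) \<subseteq> Z" "b - c + c = b" if "b \<in> cone c Z" for b
  proof -
    have *: "v \<in> Z \<and> lk c v \<le> lk b v \<or> v \<notin> Z \<and> lk b v = lk c v" for v
      using that unfolding cone_def by (cases "v \<in> Z") auto
    show "Poly_Mapping.keys (b - c) \<subseteq> Z"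
    proof
      fix v assume "v \<in> Poly_Mapping.keys (b - c)"
      then show "v \<in> Z" using *[of v] by (auto simp: in_keys_iff lookup_minus)
    qed
    show "b - c + c = b"
    proof (rule poly_mapping_eqI)
      show "lk (b - c + c) v = lk b v" for v
        using *[of v] by (auto simp: lookup_minus lookup_add)
    qed
  qed
  show "q \<in> carrier (mpoly_ring Z)"
    unfolding q_def using bc by (intro mp.sum_mem single_mem_mpoly_ring) auto
  have "q * Poly_Mapping.single c 1
      = (\<Sum>b\<in>Poly_Mapping.keys p \<inter> cone c Z. Poly_Mapping.single (b - c + c) (lk p b))"
    by (simp add: q_def sum_distrib_right mult_single)
  also have "\<dots> = restr p (cone c Z)"
    unfolding restr_def pm_of_def by (intro sum.cong) (auto simp: bc)
  finally show "restr p (cone c Z) = q * Poly_Mapping.single c 1" ..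
qed

text \<open>The monomials outside \<open>J\<close> represent a basis of \<open>S/J\<close>. The
  hypotheses partition their exponents into finitely many cones, and each cone spans a Stanley space
  on its apex monomial.\<close>

theorem sdepth_ge_of_cones:
  fixes V :: "'v set" and P :: "('v \<Rightarrow>\<^sub>0 nat) \<Rightarrow> bool"
    and base :: "('v \<Rightarrow>\<^sub>0 nat) \<Rightarrow> 'v \<Rightarrow>\<^sub>0 nat" and free :: "('v \<Rightarrow>\<^sub>0 nat) \<Rightarrow> 'v set"
  defines "J \<equiv> monomial_ideal V P :: ('v, 'k::field) mpoly set"
  assumes P: "\<And>a b. P a \<Longrightarrow> P (a + b)"
    and fin: "finite ((\<lambda>a. (base a, free a)) ` {a. Poly_Mapping.keys a \<subseteq> V \<and> \<not> P a})"
    and base: "\<And>a. Poly_Mapping.keys a \<subseteq> V \<Longrightarrow> \<not> P a \<Longrightarrow> Poly_Mapping.keys (base a) \<subseteq> V"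
    and free: "\<And>a. Poly_Mapping.keys a \<subseteq> V \<Longrightarrow> \<not> P a \<Longrightarrow> free a \<subseteq> V \<and> d \<le> card (free a)"
    and mem: "\<And>a. Poly_Mapping.keys a \<subseteq> V \<Longrightarrow> \<not> P a \<Longrightarrow> a \<in> cone (base a) (free a)"
    and const: "\<And>a b. Poly_Mapping.keys a \<subseteq> V \<Longrightarrow> \<not> P a \<Longrightarrow> b \<in> cone (base a) (free a) \<Longrightarrow>
       \<not> P b \<and> base b = base a \<and> free b = free a"
  shows "enat d \<le> sdepth V (quot_module (mpoly_ring V) J) (quot_grading V J)"
proof -
  have J: "mp.ideal_set V J" unfolding J_def by (rule ideal_set_monomial_ideal) (rule P)
  interpret mpoly_quotient V J by unfold_locales (rule J)
  define N where "N = {a. Poly_Mapping.keys a \<subseteq> V \<and> \<not> P a}"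
  define B where "B = (\<lambda>a. (base a, free a)) ` N"
  define X :: "('v \<Rightarrow>\<^sub>0 nat) \<Rightarrow> ('v, 'k) mpoly" where "X c = Poly_Mapping.single c 1" for c
  \<comment> \<open>Passes from an apex to its class in \<open>S/J\<close>. Since a decomposition is
    a set of pairs, injectivity is required; it holds because distinct monomials outside
    \<open>J\<close> have distinct classes.\<close>
  define enc where "enc \<beta> = (coset V J (X (fst \<beta>)), snd \<beta>)" for \<beta> :: "('v \<Rightarrow>\<^sub>0 nat) \<times> 'v set"
  define D where "D = enc ` B"
  have J_keys: "P a" if "p \<in> J" "a \<in> Poly_Mapping.keys p" for p a
    using that unfolding J_def monomial_ideal_def by blast
  have finB: "finite B" using fin by (simp add: B_def N_def)
  have B_keys: "Poly_Mapping.keys (fst \<beta>) \<subseteq> V" "snd \<beta> \<subseteq> V" "d \<le> card (snd \<beta>)" if \<beta>: "\<beta> \<in> B" for \<beta>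
  proof -
    obtain a where "a \<in> N" "\<beta> = (base a, free a)" using \<beta> by (auto simp: B_def)
    then show "Poly_Mapping.keys (fst \<beta>) \<subseteq> V" "snd \<beta> \<subseteq> V" "d \<le> card (snd \<beta>)"
      using base[of a] free[of a] by (simp_all add: N_def)
  qed
  have B_cone: "b \<in> N \<and> \<beta> = (base b, free b)" if \<beta>: "\<beta> \<in> B" "b \<in> cone (fst \<beta>) (snd \<beta>)" for \<beta> b
  proof -
    obtain a where a: "a \<in> N" "\<beta> = (base a, free a)" using \<beta>(1) by (auto simp: B_def)
    have "Poly_Mapping.keys b \<subseteq> V"
      using keys_cone_subset[OF \<beta>(2)] B_keys[OF \<beta>(1)] by blast
    then show ?thesis using const[of a b] a \<beta>(2) by (simp add: N_def)
  qed
  have N_cone: "a \<in> cone (fst \<beta>) (snd \<beta>) \<longleftrightarrow> \<beta> = (base a, free a)" if "a \<in> N" "\<beta> \<in> B" for a \<beta>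
    using B_cone[OF that(2), of a] mem[of a] that(1) by (auto simp: N_def)
  have XR: "X (fst \<beta>) \<in> carrier R" if "\<beta> \<in> B" for \<beta>
    using B_keys[OF that] by (simp add: X_def single_mem_mpoly_ring)
  have apex: "fst \<beta> \<in> N" if "\<beta> \<in> B" for \<beta>
    by (rule conjunct1[OF B_cone[OF that]]) (simp add: cone_def)
  have inj: "inj_on enc B"
  proof (rule inj_onI)
    fix \<beta> \<gamma> assume bg: "\<beta> \<in> B" "\<gamma> \<in> B" "enc \<beta> = enc \<gamma>"
    then have diff: "X (fst \<beta>) - X (fst \<gamma>) \<in> J" using coset_eq_iff XR by (simp add: enc_def)
    have "fst \<beta> = fst \<gamma>"
    proof (rule ccontr)
      assume "fst \<beta> \<noteq> fst \<gamma>"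
      then have "fst \<beta> \<in> Poly_Mapping.keys (X (fst \<beta>) - X (fst \<gamma>))"
        by (simp add: X_def in_keys_iff lookup_minus lookup_single)
      then have "P (fst \<beta>)" by (rule J_keys[OF diff])
      then show False using apex[OF bg(1)] by (simp add: N_def)
    qed
    then show "\<beta> = \<gamma>" using bg(3) by (simp add: enc_def prod_eq_iff)
  qed
  have ZR: "p \<in> carrier R" if "p \<in> carrier (mpoly_ring (snd \<beta>))" "\<beta> \<in> B" for p :: "('v, 'k) mpoly" and \<beta>
    using that B_keys(2)[OF that(2)] by (fastforce simp: mem_mpoly_ring)
  have cyc: "cyclic_space M (coset V J (X (fst \<beta>))) (snd \<beta>)
      = (\<lambda>p. coset V J (p * X (fst \<beta>))) ` carrier (mpoly_ring (snd \<beta>))" if "\<beta> \<in> B" for \<beta>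
    unfolding cyclic_space_def by (intro image_cong refl smult_M ZR[OF _ that] XR[OF that])
  have stanley: "stanley_space V M (quot_grading V J) (coset V J (X (fst \<beta>))) (snd \<beta>)"
    if \<beta>: "\<beta> \<in> B" for \<beta>
    unfolding stanley_space_def
  proof (intro conjI ballI impI)
    show "coset V J (X (fst \<beta>)) \<in> carrier M" using XR[OF \<beta>] by (simp add: carrier_M)
    have "X (fst \<beta>) \<in> mpoly_grading V (\<lambda>v. int (lk (fst \<beta>) v))"
      using XR[OF \<beta>] by (auto simp: mpoly_grading_def X_def)
    then show "homogeneous (quot_grading V J) (coset V J (X (fst \<beta>)))"
      by (auto simp: homogeneous_def quot_grading_def)
    show "snd \<beta> \<subseteq> V" using B_keys[OF \<beta>] by simp
    fix p assume p: "p \<in> carrier (mpoly_ring (snd \<beta>))"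
      and "p \<odot>\<^bsub>M\<^esub> coset V J (X (fst \<beta>)) = \<zero>\<^bsub>M\<^esub>"
    then have "p * X (fst \<beta>) \<in> J"
      using smult_M[OF ZR[OF p \<beta>] XR[OF \<beta>]] coset_eq_zero_iff mp.mult_mem[OF ZR[OF p \<beta>] XR[OF \<beta>]]
      by (simp add: zero_M)
    then have *: "P a" if "a \<in> Poly_Mapping.keys (p * X (fst \<beta>))" for a
      using J_keys that by blast
    have "a \<notin> Poly_Mapping.keys (p * X (fst \<beta>))" for a
    proof
      assume a: "a \<in> Poly_Mapping.keys (p * X (fst \<beta>))"
      then have "a \<in> N" using mult_single_keys_cone[OF p] B_cone[OF \<beta>] unfolding X_def by blast
      then show False using *[OF a] by (simp add: N_def)
    qed
    then have "Poly_Mapping.keys p = {}"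
      unfolding X_def keys_mult_single by blast
    then show "p = 0" by (intro poly_mapping_eqI) (auto simp: in_keys_iff)
  qed
  have decomp: "\<exists>!s. s \<in> (\<Pi>\<^sub>E (u, Z) \<in> D. cyclic_space M u Z) \<and> x = (\<Oplus>\<^bsub>M\<^esub>i \<in> D. s i)"
    if x: "x \<in> carrier M" for x
  proof -
    obtain p where p: "p \<in> carrier R" "x = coset V J p" using x by (auto simp: carrier_M)
    \<comment> \<open>The component of \<open>p\<close> in a Stanley space collects the terms of
      \<open>p\<close> whose exponents lie in the cone.\<close>
    define part where "part \<beta> = restr p (cone (fst \<beta>) (snd \<beta>))" for \<beta>
    have partR: "part \<beta> \<in> carrier R" for \<beta>
      using p(1) by (auto simp: part_def mem_mpoly_ring in_keys_iff lookup_restr split: if_splits)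
    define s where "s = restrict (\<lambda>i. coset V J (part (inv_into B enc i))) D"
    have s_enc: "s (enc \<beta>) = coset V J (part \<beta>)" if "\<beta> \<in> B" for \<beta>
      using that inj by (simp add: s_def D_def)
    have fs: "finsum M t D = coset V J (\<Sum>\<beta>\<in>B. f \<beta>)"
      if "\<And>\<beta>. \<beta> \<in> B \<Longrightarrow> f \<beta> \<in> carrier R" "\<And>\<beta>. \<beta> \<in> B \<Longrightarrow> t (enc \<beta>) = coset V J (f \<beta>)" for t f
    proof -
      have "finsum M t D = coset V J (\<Sum>i\<in>D. f (inv_into B enc i))"
        by (rule finsum_M) (use that inj finB in \<open>auto simp: D_def\<close>)
      also have "(\<Sum>i\<in>D. f (inv_into B enc i)) = (\<Sum>\<beta>\<in>B. f \<beta>)"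
        unfolding D_def by (simp add: sum.reindex[OF inj] inj)
      finally show ?thesis .
    qed
    \<comment> \<open>At an exponent outside \<open>J\<close> only the summand of its own cone
      contributes; this gives existence and uniqueness of the decomposition.\<close>
    have sum_coeff: "lk (\<Sum>\<beta>\<in>B. f \<beta>) b = lk (f (base b, free b)) b"
      if "b \<in> N" "\<And>\<beta>. \<beta> \<in> B \<Longrightarrow> Poly_Mapping.keys (f \<beta>) \<subseteq> cone (fst \<beta>) (snd \<beta>)"
      for b and f :: "_ \<Rightarrow> ('v, 'k) mpoly"
    proof -
      have "lk (\<Sum>\<beta>\<in>B. f \<beta>) b = (\<Sum>\<beta>\<in>B. lk (f \<beta>) b)" by (simp add: lookup_sum)
      also have "\<dots> = (\<Sum>\<beta>\<in>{(base b, free b)}. lk (f \<beta>) b)"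
      proof (rule sum.mono_neutral_right[OF finB])
        show "{(base b, free b)} \<subseteq> B" using that(1) by (auto simp: B_def)
        show "\<forall>\<beta>\<in>B - {(base b, free b)}. lk (f \<beta>) b = 0"
        proof
          fix \<beta> assume "\<beta> \<in> B - {(base b, free b)}"
          then have "\<beta> \<in> B" "b \<notin> cone (fst \<beta>) (snd \<beta>)" using N_cone[OF that(1)] by auto
          then show "lk (f \<beta>) b = 0" using that(2)[of \<beta>] by (auto simp: in_keys_iff)
        qed
      qed
      finally show ?thesis by simp
    qed
    have part_keys: "Poly_Mapping.keys (part \<beta>) \<subseteq> cone (fst \<beta>) (snd \<beta>)" for \<beta>
      by (auto simp: part_def in_keys_iff lookup_restr split: if_splits)
    show ?thesis
    proof (rule ex1I[of _ s])
      have "p - (\<Sum>\<beta>\<in>B. part \<beta>) \<in> J"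
        unfolding J_def monomial_ideal_def
      proof (intro CollectI conjI ballI)
        show R: "p - (\<Sum>\<beta>\<in>B. part \<beta>) \<in> carrier R"
          using p(1) partR by (intro mp.diff_mem mp.sum_mem)
        fix b assume b: "b \<in> Poly_Mapping.keys (p - (\<Sum>\<beta>\<in>B. part \<beta>))"
        show "P b"
        proof (rule ccontr)
          assume "\<not> P b"
          then have bN: "b \<in> N" using R b by (auto simp: N_def mem_mpoly_ring)
          have "lk (\<Sum>\<beta>\<in>B. part \<beta>) b = lk p b"
            using sum_coeff[OF bN part_keys] mem[of b] bN by (simp add: part_def lookup_restr N_def)
          then show False using b by (simp add: in_keys_iff lookup_minus)
        qed
      qed
      then have "x = coset V J (\<Sum>\<beta>\<in>B. part \<beta>)"
        using coset_eq_iff[OF p(1)] partR p(2) by (simp add: mp.sum_mem)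
      also have "\<dots> = finsum M s D" by (rule fs[symmetric]) (simp_all only: partR s_enc)
      finally have xs: "x = finsum M s D" .
      have "s i \<in> cyclic_space M (fst i) (snd i)" if i: "i \<in> D" for i
      proof -
        obtain \<beta> where \<beta>: "\<beta> \<in> B" "i = enc \<beta>" using i by (auto simp: D_def)
        obtain q where "q \<in> carrier (mpoly_ring (snd \<beta>))" "part \<beta> = q * X (fst \<beta>)"
          unfolding part_def X_def by (rule restr_cone_eq_mult)
        then show ?thesis using s_enc[OF \<beta>(1)] cyc[OF \<beta>(1)] by (simp add: \<beta>(2)) (simp add: enc_def)
      qed
      moreover have "s \<in> extensional D" by (simp add: s_def)
      ultimately have "s \<in> (\<Pi>\<^sub>E (u, Z) \<in> D. cyclic_space M u Z)"
        by (simp add: PiE_iff case_prod_beta)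
      then show "s \<in> (\<Pi>\<^sub>E (u, Z) \<in> D. cyclic_space M u Z) \<and> x = (\<Oplus>\<^bsub>M\<^esub>i \<in> D. s i)"
        using xs by (rule conjI)
    next
      fix t assume t: "t \<in> (\<Pi>\<^sub>E (u, Z) \<in> D. cyclic_space M u Z) \<and> x = (\<Oplus>\<^bsub>M\<^esub>i \<in> D. t i)"
      have "\<forall>\<beta>\<in>B. \<exists>q. q \<in> carrier (mpoly_ring (snd \<beta>)) \<and> t (enc \<beta>) = coset V J (q * X (fst \<beta>))"
      proof
        fix \<beta> assume \<beta>: "\<beta> \<in> B"
        then have "t (enc \<beta>) \<in> cyclic_space M (coset V J (X (fst \<beta>))) (snd \<beta>)"
          using t by (fastforce simp: D_def enc_def)
        then show "\<exists>q. q \<in> carrier (mpoly_ring (snd \<beta>)) \<and> t (enc \<beta>) = coset V J (q * X (fst \<beta>))"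
          unfolding cyc[OF \<beta>] by blast
      qed
      then obtain q where q: "\<And>\<beta>. \<beta> \<in> B \<Longrightarrow> q \<beta> \<in> carrier (mpoly_ring (snd \<beta>))"
        "\<And>\<beta>. \<beta> \<in> B \<Longrightarrow> t (enc \<beta>) = coset V J (q \<beta> * X (fst \<beta>))"
        by metis
      have qR: "q \<beta> * X (fst \<beta>) \<in> carrier R" if "\<beta> \<in> B" for \<beta>
        using ZR[OF q(1)[OF that] that] XR[OF that] by (rule mp.mult_mem)
      have q_keys: "Poly_Mapping.keys (q \<beta> * X (fst \<beta>)) \<subseteq> cone (fst \<beta>) (snd \<beta>)" if "\<beta> \<in> B" for \<beta>
        using mult_single_keys_cone[OF q(1)[OF that]] by (auto simp: X_def)
      have "coset V J p = coset V J (\<Sum>\<beta>\<in>B. q \<beta> * X (fst \<beta>))"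
        using fs[of "\<lambda>\<beta>. q \<beta> * X (fst \<beta>)" t] qR q(2) t p(2) by simp
      then have diff: "p - (\<Sum>\<beta>\<in>B. q \<beta> * X (fst \<beta>)) \<in> J"
        using coset_eq_iff[OF p(1)] qR by (simp add: mp.sum_mem)
      have "q \<beta> * X (fst \<beta>) = part \<beta>" if \<beta>: "\<beta> \<in> B" for \<beta>
      proof (rule poly_mapping_eqI)
        fix b
        show "lk (q \<beta> * X (fst \<beta>)) b = lk (part \<beta>) b"
        proof (cases "b \<in> cone (fst \<beta>) (snd \<beta>)")
          case True
          then have b: "b \<in> N" "\<beta> = (base b, free b)" using B_cone[OF \<beta>] by auto
          then have "b \<notin> Poly_Mapping.keys (p - (\<Sum>\<beta>\<in>B. q \<beta> * X (fst \<beta>)))"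
            using J_keys[OF diff] by (auto simp: N_def)
          then have "lk p b = lk (\<Sum>\<beta>\<in>B. q \<beta> * X (fst \<beta>)) b"
            by (simp add: in_keys_iff lookup_minus)
          also have "\<dots> = lk (q \<beta> * X (fst \<beta>)) b"
            using sum_coeff[OF b(1) q_keys] b(2) by simp
          finally show ?thesis using True by (simp add: part_def lookup_restr)
        next
          case False
          then have "b \<notin> Poly_Mapping.keys (q \<beta> * X (fst \<beta>))" "b \<notin> Poly_Mapping.keys (part \<beta>)"
            using q_keys[OF \<beta>] part_keys[of \<beta>] by blast+
          then show ?thesis by (simp add: in_keys_iff)
        qed
      qed
      then have "t (enc \<beta>) = s (enc \<beta>)" if "\<beta> \<in> B" for \<beta>
        using q(2) s_enc that by simp
      then show "t = s"
        using t by (intro extensionalityI[of _ D]) (auto simp: D_def s_def PiE_def)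
    qed
  qed
  have "stanley_decomposition V M (quot_grading V J) D"
    unfolding stanley_decomposition_def
  proof (intro conjI ballI decomp)
    show "finite D" using finB by (simp add: D_def)
    show "case i of (u, Z) \<Rightarrow> stanley_space V M (quot_grading V J) u Z" if "i \<in> D" for i
      using that stanley by (auto simp: D_def enc_def)
  qed
  moreover have "enat d \<le> (INF (u, Z) \<in> D. enat (card Z))"
    using B_keys(3) by (auto simp: D_def enc_def intro!: INF_greatest)
  ultimately show ?thesis
    unfolding sdepth_def by (intro SUP_upper2[of D]) auto
qed

section \<open>Depth and Koszul cohomology\<close>

text \<open>Koszul cochains are indexed by lists over the whole type; the value 0 makes the indices
  outside \<open>V\<close> inert.\<close>

definition xvar :: "'v set \<Rightarrow> 'v \<Rightarrow> ('v, 'k::field) mpoly" where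
  "xvar V v = (if v \<in> V then mvar v else 0)"

lemma xvar_mem: "xvar V v \<in> carrier (mpoly_ring V)"
  by (simp add: xvar_def mvar_mem mp.zero_mem)

lemma max_ideal_memE:
  fixes f :: "('v, 'k::field) mpoly"
  assumes fin: "finite V" and f: "f \<in> max_ideal V"
  obtains g where "\<And>v. g v \<in> carrier (mpoly_ring V)" "f = (\<Sum>v\<in>V. g v * xvar V v)"
proof -
  interpret cring "mpoly_ring V :: ('v, 'k) mpoly ring" by (rule cring_mpoly_ring)
  define A :: "('v, 'k) mpoly set" where
    "A = {\<Sum>v\<in>V. g v * xvar V v | g. \<forall>v. g v \<in> carrier (mpoly_ring V)}"
  have AI: "(\<Sum>v\<in>V. g v * xvar V v) \<in> A" if "\<And>v. g v \<in> carrier (mpoly_ring V)" for g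
    using that by (auto simp: A_def)
  have "mp.ideal_set V A"
    unfolding mp.ideal_set_def
  proof (intro conjI ballI subsetI)
    fix p assume "p \<in> A"
    then show "p \<in> carrier (mpoly_ring V)"
      by (auto simp: A_def intro!: mp.sum_mem mp.mult_mem xvar_mem)
  next
    show "0 \<in> A" using AI[of "\<lambda>_. 0"] by (simp add: mp.zero_mem)
  next
    fix p q assume "p \<in> A" "q \<in> A"
    then obtain g h where "p = (\<Sum>v\<in>V. g v * xvar V v)" "q = (\<Sum>v\<in>V. h v * xvar V v)"
      "\<And>v. g v \<in> carrier (mpoly_ring V)" "\<And>v. h v \<in> carrier (mpoly_ring V)"
      by (auto simp: A_def)
    then show "p - q \<in> A"
      using AI[of "\<lambda>v. g v - h v"] by (simp add: mp.diff_mem left_diff_distrib sum_subtractf)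
  next
    fix s p :: "('v, 'k) mpoly" assume "s \<in> carrier (mpoly_ring V)" "p \<in> A"
    moreover then obtain g where "p = (\<Sum>v\<in>V. g v * xvar V v)" "\<And>v. g v \<in> carrier (mpoly_ring V)"
      by (auto simp: A_def)
    ultimately show "s * p \<in> A"
      using AI[of "\<lambda>v. s * g v"] by (simp add: mp.mult_mem sum_distrib_left mult.assoc)
  qed
  then have "ideal A (mpoly_ring V)" by (simp add: ideal_iff_ideal_set)
  moreover have "mvar ` V \<subseteq> A"
  proof
    fix p :: "('v, 'k) mpoly" assume "p \<in> mvar ` V"
    then obtain w where w: "w \<in> V" "p = mvar w" by auto
    have "(\<Sum>v\<in>V. (if v = w then 1 else 0) * xvar V v) = p"
      using fin w by (simp add: xvar_def if_distrib[of "\<lambda>x. x * _"] cong: if_cong)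
    moreover have "(\<Sum>v\<in>V. (if v = w then 1 else 0) * xvar V v) \<in> A"
      by (rule AI) (simp add: mp.one_mem mp.zero_mem)
    ultimately show "p \<in> A" by metis
  qed
  ultimately have "max_ideal V \<subseteq> A"
    unfolding max_ideal_def by (rule genideal_minimal)
  then show thesis using f that by (auto simp: A_def)
qed

context mpoly_quotient
begin

text \<open>The preimage in \<open>S\<close> of the submodule generated by \<open>fs\<close>, built
  one element at a time to fit \<open>koszul_nonvanishing_step\<close>.\<close>

definition adjoin_list :: "('v, 'k) mpoly list \<Rightarrow> ('v, 'k) mpoly set" where
  "adjoin_list fs = foldl (mp.adjoin V) J fs"

lemma ideal_set_adjoin_list: "set fs \<subseteq> carrier R \<Longrightarrow> mp.ideal_set V (adjoin_list fs)"
  by (induction fs rule: rev_induct) (auto simp: adjoin_list_def J intro: mp.ideal_set_adjoin)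

lemma adjoin_list_iff:
  "p \<in> adjoin_list fs \<longleftrightarrow>
    (\<exists>g. (\<forall>j. g j \<in> carrier R) \<and> p - (\<Sum>j<length fs. fs ! j * g j) \<in> J)"
proof (induction fs arbitrary: p rule: rev_induct)
  case Nil
  show ?case by (auto simp: adjoin_list_def intro!: exI[of _ "\<lambda>_. 0"] mp.zero_mem)
next
  case (snoc f fs)
  show ?case
  proof
    assume "p \<in> adjoin_list (fs @ [f])"
    then obtain a s where a: "p = a + f * s" "a \<in> adjoin_list fs" "s \<in> carrier R"
      by (auto simp: adjoin_list_def mp.adjoin_def)
    then obtain g where g: "\<forall>j. g j \<in> carrier R" "a - (\<Sum>j<length fs. fs ! j * g j) \<in> J"
      using snoc by blast
    have "(\<Sum>j<length (fs @ [f]). (fs @ [f]) ! j * (g(length fs := s)) j)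
        = (\<Sum>j<length fs. fs ! j * g j) + f * s"
      by (simp add: nth_append)
    then show "\<exists>g. (\<forall>j. g j \<in> carrier R) \<and> p - (\<Sum>j<length (fs @ [f]). (fs @ [f]) ! j * g j) \<in> J"
      using g a by (intro exI[of _ "g(length fs := s)"]) (simp add: algebra_simps)
  next
    assume "\<exists>g. (\<forall>j. g j \<in> carrier R) \<and> p - (\<Sum>j<length (fs @ [f]). (fs @ [f]) ! j * g j) \<in> J"
    then obtain g where g: "\<forall>j. g j \<in> carrier R"
      "p - f * g (length fs) - (\<Sum>j<length fs. fs ! j * g j) \<in> J"
      by (auto simp: nth_append algebra_simps)
    then have "p - f * g (length fs) \<in> adjoin_list fs" using snoc by blast
    then show "p \<in> adjoin_list (fs @ [f])"
      using g(1) unfolding adjoin_list_def foldl_append foldl_Cons foldl_Nil mp.adjoin_def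
      by (intro CollectI exI[of _ "p - f * g (length fs)"] exI[of _ "g (length fs)"]) simp
  qed
qed

lemma coset_mem_seq_submodule_iff:
  assumes p: "p \<in> carrier R" and fs: "set fs \<subseteq> carrier R"
  shows "coset V J p \<in> seq_submodule M fs \<longleftrightarrow> p \<in> adjoin_list fs"
proof -
  have fsR: "fs ! j \<in> carrier R" if "j < length fs" for j
    using fs that by (auto simp: set_conv_nth)
  have sum: "(\<Oplus>\<^bsub>M\<^esub>j \<in> {..<length fs}. (fs ! j) \<odot>\<^bsub>M\<^esub> m j) = coset V J (\<Sum>j<length fs. fs ! j * g j)"
    if "\<And>j. j < length fs \<Longrightarrow> m j = coset V J (g j)" "\<And>j. g j \<in> carrier R" for m g
    using that fsR by (intro finsum_M) (auto simp: smult_M mp.mult_mem)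
  have sumR: "(\<Sum>j<length fs. fs ! j * g j) \<in> carrier R" if "\<forall>j. g j \<in> carrier R" for g
    using that fsR by (intro mp.sum_mem mp.mult_mem) auto
  show ?thesis
  proof
    assume "coset V J p \<in> seq_submodule M fs"
    then obtain m where m: "m \<in> {..<length fs} \<rightarrow> carrier M"
      "coset V J p = (\<Oplus>\<^bsub>M\<^esub>j \<in> {..<length fs}. (fs ! j) \<odot>\<^bsub>M\<^esub> m j)"
      by (auto simp: seq_submodule_def)
    have "\<forall>j. \<exists>q. q \<in> carrier R \<and> (j < length fs \<longrightarrow> m j = coset V J q)"
    proof
      fix j
      show "\<exists>q. q \<in> carrier R \<and> (j < length fs \<longrightarrow> m j = coset V J q)"
      proof (cases "j < length fs")
        case True
        then have "m j \<in> coset V J ` carrier R" using m(1) by (auto simp: carrier_M)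
        then show ?thesis by blast
      qed (use mp.zero_mem in blast)
    qed
    from this[unfolded choice_iff] obtain g
      where g: "\<forall>j. g j \<in> carrier R \<and> (j < length fs \<longrightarrow> m j = coset V J (g j))" by (elim exE)
    then have "coset V J p = coset V J (\<Sum>j<length fs. fs ! j * g j)"
      using sum[of m g] m(2) by simp
    then show "p \<in> adjoin_list fs"
      unfolding adjoin_list_iff using coset_eq_iff[OF p sumR] g by (intro exI[of _ g]) simp
  next
    assume "p \<in> adjoin_list fs"
    then obtain g where g: "\<forall>j. g j \<in> carrier R" "p - (\<Sum>j<length fs. fs ! j * g j) \<in> J"
      by (auto simp: adjoin_list_iff)
    then have "coset V J p = coset V J (\<Sum>j<length fs. fs ! j * g j)"
      using coset_eq_iff[OF p sumR] by simp
    also have "\<dots> = (\<Oplus>\<^bsub>M\<^esub>j \<in> {..<length fs}. (fs ! j) \<odot>\<^bsub>M\<^esub> coset V J (g j))"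
      using g(1) by (intro sum[symmetric]) auto
    finally show "coset V J p \<in> seq_submodule M fs"
      unfolding seq_submodule_def using g(1)
      by (intro CollectI exI[of _ "\<lambda>j. coset V J (g j)"]) (auto simp: carrier_M)
  qed
qed

text \<open>Each element of a regular sequence lowers the degree of a nonzero class by one. After
  \<open>b\<close> elements the class is a nonzero element killed by all variables, so no element of
  the maximal ideal is regular any more.\<close>

theorem depth_le_of_koszul:
  assumes fin: "finite V" and proper: "1 \<notin> J"
    and nv: "mp.koszul_nonvanishing V (xvar V) b J"
  shows "depth R (max_ideal V) M \<le> enat b"
proof -
  have "length fs \<le> b" if fs: "set fs \<subseteq> max_ideal V" "regular_sequence R M fs" for fs
  proof (rule ccontr)
    assume "\<not> length fs \<le> b"
    then have len: "b < length fs" by simp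
    have fsR: "set fs \<subseteq> carrier R" using fs(2) by (simp add: regular_sequence_def)
    have tR: "set (take i fs) \<subseteq> carrier R" for i using fsR set_take_subset[of i fs] by blast
    have fi: "fs ! i \<in> carrier R" "fs ! i \<in> max_ideal V" if "i < length fs" for i
      using fsR fs(1) that by auto
    have reg: "p \<in> adjoin_list (take i fs)"
      if i: "i < length fs" and p: "p \<in> carrier R" "fs ! i * p \<in> adjoin_list (take i fs)" for i p
    proof -
      have "fs ! i \<odot>\<^bsub>M\<^esub> coset V J p \<in> seq_submodule M (take i fs)"
        using p fi[OF i] tR by (simp add: smult_M coset_mem_seq_submodule_iff mp.mult_mem)
      then have "coset V J p \<in> seq_submodule M (take i fs)"
        using fs(2) i p(1) by (auto simp: regular_sequence_def carrier_M)
      then show ?thesis using coset_mem_seq_submodule_iff[OF p(1) tR] by simp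
    qed
    have step: "mp.koszul_nonvanishing V (xvar V) (b - i) (adjoin_list (take i fs))" if "i \<le> b" for i
      using that
    proof (induction i)
      case 0
      then show ?case using nv by (simp add: adjoin_list_def)
    next
      case (Suc i)
      then have i: "i < length fs" "b - i = Suc (b - Suc i)" using len by auto
      obtain g where g: "\<And>v. g v \<in> carrier R" "fs ! i = (\<Sum>v\<in>V. g v * xvar V v)"
        using max_ideal_memE[OF fin fi(2)[OF i(1)]] by blast
      have "mp.koszul_nonvanishing V (xvar V) (b - Suc i) (mp.adjoin V (adjoin_list (take i fs)) (fs ! i))"
      proof (rule mp.koszul_nonvanishing_step)
        show "mp.ideal_set V (adjoin_list (take i fs))" by (rule ideal_set_adjoin_list[OF tR])
        show "range (xvar V) \<subseteq> carrier R" using xvar_mem by auto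
        show "fs ! i = (\<Sum>v\<in>V. g v * xvar V v)" by (rule g(2))
        show "mp.koszul_nonvanishing V (xvar V) (Suc (b - Suc i)) (adjoin_list (take i fs))"
          using Suc i(2) by simp
      qed (use g(1) reg[OF i(1)] in auto)
      then show ?case by (simp add: adjoin_list_def take_Suc_conv_app_nth[OF i(1)])
    qed
    \<comment> \<open>Here \<open>take b fs\<close> has been used up; the contradiction comes from
      the next element \<open>fs ! b\<close>, which exists because
      \<open>b < length fs\<close>.\<close>
    obtain p where p: "p \<in> carrier R" "p \<notin> adjoin_list (take b fs)"
      "\<And>v. xvar V v * p \<in> adjoin_list (take b fs)"
      using mp.koszul_nonvanishing_0[OF ideal_set_adjoin_list[OF tR], of "xvar V" b] step[of b] by auto
    obtain g where g: "\<And>v. g v \<in> carrier R" "fs ! b = (\<Sum>v\<in>V. g v * xvar V v)"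
      using max_ideal_memE[OF fin fi(2)[OF len]] by blast
    have "fs ! b * p = (\<Sum>v\<in>V. g v * (xvar V v * p))"
      by (simp add: g(2) sum_distrib_right mult.assoc)
    also have "\<dots> \<in> adjoin_list (take b fs)"
      by (intro mp.ideal_set_sum[OF ideal_set_adjoin_list[OF tR]]
          mp.ideal_setD(4)[OF ideal_set_adjoin_list[OF tR]] g(1) p(3))
    finally show False using reg[OF len p(1)] p(2) by blast
  qed
  moreover have "carrier M \<noteq> {\<zero>\<^bsub>M\<^esub>}"
  proof
    assume "carrier M = {\<zero>\<^bsub>M\<^esub>}"
    moreover have "coset V J 1 \<in> carrier M" unfolding carrier_M by (intro imageI mp.one_mem)
    ultimately have "coset V J 1 = J" by (simp add: zero_M)
    then show False using coset_eq_zero_iff[OF mp.one_mem] proper by simp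
  qed
  ultimately show ?thesis
    unfolding depth_def by (auto intro!: SUP_least)
qed

end

section \<open>A nonvanishing Koszul class\<close>

text \<open>A linear functional on cochains that detects the class below: it alternates over all choices
  of one of two test variables in each block, or evaluates at a single variable.\<close>

primrec koszul_test ::
    "('c \<Rightarrow> 'v) \<Rightarrow> ('c \<Rightarrow> 'v option) \<Rightarrow> 'c list \<Rightarrow> ('v \<Rightarrow>\<^sub>0 nat) \<Rightarrow> ('v list \<Rightarrow> ('v, 'k::field) mpoly) \<Rightarrow> 'k"
  where
  "koszul_test x y [] m w = lk (w []) m"
| "koszul_test x y (C # Cs) m w = (case y C of
      None \<Rightarrow> koszul_test x y Cs m (\<lambda>l. w (x C # l))
    | Some y' \<Rightarrow> koszul_test x y Cs (m + pm_ev (x C)) (\<lambda>l. w (x C # l))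
               - koszul_test x y Cs (m + pm_ev y') (\<lambda>l. w (y' # l)))"

text \<open>The exponents at which \<open>koszul_test\<close> reads coefficients.\<close>

primrec test_exponents ::
    "('c \<Rightarrow> 'v) \<Rightarrow> ('c \<Rightarrow> 'v option) \<Rightarrow> 'c list \<Rightarrow> ('v \<Rightarrow>\<^sub>0 nat) \<Rightarrow> ('v \<Rightarrow>\<^sub>0 nat) set" where
  "test_exponents x y [] m = {m}"
| "test_exponents x y (C # Cs) m = (case y C of
      None \<Rightarrow> test_exponents x y Cs m
    | Some y' \<Rightarrow> test_exponents x y Cs (m + pm_ev (x C)) \<union> test_exponents x y Cs (m + pm_ev y'))"

lemma lookup_mvar_mult: "lk (mvar v * p) (m + pm_ev v) = lk p m"
  using lookup_mult_single[of p "pm_ev v" 1 m] by (simp add: mvar_eq mult.commute)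

lemma lookup_mvar_mult_eq_0: "lk m v = 0 \<Longrightarrow> lk (mvar v * p) m = 0"
proof (rule ccontr)
  assume m: "lk m v = 0" and "lk (mvar v * p) m \<noteq> 0"
  then have "m \<in> Poly_Mapping.keys (p * Poly_Mapping.single (pm_ev v) 1)"
    by (simp add: in_keys_iff mvar_eq mult.commute)
  then obtain b where "m = b + pm_ev v" unfolding keys_mult_single by blast
  then show False using m by (simp add: lookup_add lookup_ev)
qed

lemma koszul_test_diff:
  "koszul_test x y Cs m (\<lambda>l. w l - w' l) = koszul_test x y Cs m w - koszul_test x y Cs m w'"
  by (induction Cs arbitrary: m w w') (auto simp: lookup_minus split: option.split)

lemma koszul_test_eq_0:
  "(\<And>a l. a \<in> test_exponents x y Cs m \<Longrightarrow> lk (w l) a = 0) \<Longrightarrow> koszul_test x y Cs m w = 0"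
  by (induction Cs arbitrary: m w) (auto split: option.split)

lemma koszul_test_zero [simp]: "koszul_test x y Cs m (\<lambda>l. 0) = 0"
  by (rule koszul_test_eq_0) simp

lemma koszul_test_shift:
  fixes w :: "'v list \<Rightarrow> ('v, 'k::field) mpoly"
  shows "koszul_test x y Cs (m + pm_ev v) (\<lambda>l. mvar v * w l) = koszul_test x y Cs m w"
proof (induction Cs arbitrary: m w)
  case (Cons C Cs)
  have "koszul_test x y Cs (m + pm_ev v + pm_ev z) (\<lambda>l. mvar v * w l)
      = koszul_test x y Cs (m + pm_ev z) w" for z and w :: "'v list \<Rightarrow> ('v, 'k) mpoly"
    using Cons[of "m + pm_ev z" w] by (simp add: ac_simps)
  then show ?case using Cons by (simp split: option.split)
qed (simp add: lookup_mvar_mult)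

lemma koszul_test_avoid:
  fixes w :: "'v list \<Rightarrow> ('v, 'k::field) mpoly"
  assumes "lk m v = 0" and "\<And>C. C \<in> set Cs \<Longrightarrow> v \<noteq> x C \<and> y C \<noteq> Some v"
  shows "koszul_test x y Cs m (\<lambda>l. mvar v * w l) = 0"
  using assms
proof (induction Cs arbitrary: m w)
  case (Cons C Cs)
  have "v \<noteq> x C" "y C \<noteq> Some v" using Cons.prems(2)[of C] by auto
  moreover have "koszul_test x y Cs m (\<lambda>l. mvar v * w l) = 0" if "lk m v = 0"
    for m and w :: "'v list \<Rightarrow> ('v, 'k) mpoly"
    using that Cons.prems by (intro Cons.IH) auto
  ultimately show ?case
    using Cons.prems(1) by (auto simp: lookup_add lookup_ev split: option.split)
qed (simp add: lookup_mvar_mult_eq_0)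

definition test_vars :: "('c \<Rightarrow> 'v) \<Rightarrow> ('c \<Rightarrow> 'v option) \<Rightarrow> 'c \<Rightarrow> 'v set" where
  "test_vars x y C = insert (x C) (set_option (y C))"

text \<open>Splitting the differential at the head variable of the first block leaves a coboundary,
  zero by induction, and a multiple of that variable. With two test variables both multiples reduce
  to the same test at \<open>m\<close> and cancel. With one, the multiple has no term at the tested
  exponents, which do not contain that variable.\<close>

lemma koszul_test_coboundary:
  fixes w :: "'v list \<Rightarrow> ('v, 'k::field) mpoly"
  assumes "distinct Cs"
    and "\<And>C. C \<in> set Cs \<Longrightarrow> test_vars x y C \<subseteq> V"
    and "\<And>C D. C \<in> set Cs \<Longrightarrow> D \<in> set Cs \<Longrightarrow> C \<noteq> D \<Longrightarrow> test_vars x y C \<inter> test_vars x y D = {}"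
    and "\<And>C. C \<in> set Cs \<Longrightarrow> y C = None \<Longrightarrow> lk m (x C) = 0"
  shows "koszul_test x y Cs m (kdiff (xvar V) w) = 0"
  using assms
proof (induction Cs arbitrary: m w)
  case (Cons C Cs m w)
  have disj: "test_vars x y C \<inter> test_vars x y D = {}" if "D \<in> set Cs" for D
    using Cons.prems(1,3) that by (metis distinct.simps(2) list.set_intros)
  have shift: "koszul_test x y Cs (m + pm_ev v) (\<lambda>l. kdiff (xvar V) w (v # l))
      = koszul_test x y Cs m w" if v: "v \<in> test_vars x y C" for v
  proof -
    have "xvar V v = (mvar v :: ('v, 'k) mpoly)" using v Cons.prems(2)[of C] by (auto simp: xvar_def)
    moreover have "koszul_test x y Cs (m + pm_ev v) (kdiff (xvar V) (\<lambda>l. w (v # l))) = 0"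
    proof (rule Cons.IH)
      fix D assume D: "D \<in> set Cs" "y D = None"
      then have "x D \<noteq> v" using disj[OF D(1)] v by (auto simp: test_vars_def)
      then show "lk (m + pm_ev v) (x D) = 0"
        using Cons.prems(4)[of D] D by (simp add: lookup_add lookup_ev)
    qed (use Cons.prems in auto)
    ultimately show ?thesis by (simp add: koszul_test_diff koszul_test_shift)
  qed
  show ?case
  proof (cases "y C")
    case (Some y')
    then show ?thesis using shift[of "x C"] shift[of y'] by (simp add: test_vars_def)
  next
    case None
    have "koszul_test x y Cs m (kdiff (xvar V) (\<lambda>l. w (x C # l))) = 0"
      by (rule Cons.IH) (use Cons.prems in auto)
    moreover have "koszul_test x y Cs m (\<lambda>l. mvar (x C) * w l) = 0"
    proof (rule koszul_test_avoid)
      show "lk m (x C) = 0" using Cons.prems(4)[of C] None by simp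
      show "x C \<noteq> x D \<and> y D \<noteq> Some (x C)" if "D \<in> set Cs" for D
        using disj[OF that] by (auto simp: test_vars_def)
    qed
    moreover have "xvar V (x C) = (mvar (x C) :: ('v, 'k) mpoly)"
      using Cons.prems(2)[of C] by (simp add: test_vars_def xvar_def)
    ultimately show ?thesis by (simp add: None koszul_test_diff)
  qed
qed auto

text \<open>The product of the degree-one forms \<open>c C\<close> over the blocks, times the
  monomial with exponent \<open>u\<close>: \<open>kdiff (c C)\<close> is multiplication by such a
  form.\<close>

definition koszul_class ::
    "('c \<Rightarrow> 'v \<Rightarrow> ('v, 'k::field) mpoly) \<Rightarrow> 'c list \<Rightarrow> ('v \<Rightarrow>\<^sub>0 nat) \<Rightarrow> 'v list \<Rightarrow> ('v, 'k) mpoly" where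
  "koszul_class c Cs u =
     foldr (\<lambda>C. kdiff (c C)) Cs (\<lambda>l. if l = [] then Poly_Mapping.single u 1 else 0)"

lemma koszul_class_Nil: "koszul_class c [] u l = (if l = [] then Poly_Mapping.single u 1 else 0)"
  and koszul_class_Cons: "koszul_class c (C # Cs) u = kdiff (c C) (koszul_class c Cs u)"
  by (simp_all add: koszul_class_def)

lemma koszul_class_eq_0:
  "(\<And>C. C \<in> set Cs \<Longrightarrow> c C v = 0) \<Longrightarrow> koszul_class c Cs u (v # l) = 0"
  by (induction Cs arbitrary: l) (auto simp: koszul_class_Nil koszul_class_Cons)

lemma koszul_class_length: "length l \<noteq> length Cs \<Longrightarrow> koszul_class c Cs u l = 0"
proof (induction Cs arbitrary: l)
  case (Cons C Cs)
  show ?case unfolding koszul_class_Cons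
    by (rule kdiff_length[of "length Cs"]) (use Cons in auto)
qed (simp add: koszul_class_Nil)

text \<open>On test variables of \<open>C\<close> the forms of the other blocks vanish, so the head
  factor comes out as \<open>c C v\<close>. Testing at \<open>x C\<close> contributes
  \<open>mvar (x C)\<close>, which undoes the shift of the exponent, or 1 when there is no shift;
  \<open>y'\<close> contributes 0.\<close>

lemma koszul_test_class:
  assumes "distinct Cs"
    and "\<And>C D v. C \<in> set Cs \<Longrightarrow> D \<in> set Cs \<Longrightarrow> C \<noteq> D \<Longrightarrow> v \<in> test_vars x y C \<Longrightarrow> c D v = 0"
    and "\<And>C. C \<in> set Cs \<Longrightarrow> y C = None \<Longrightarrow> c C (x C) = 1"
    and "\<And>C y'. C \<in> set Cs \<Longrightarrow> y C = Some y' \<Longrightarrow> c C (x C) = mvar (x C) \<and> c C y' = 0"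
  shows "koszul_test x y Cs u (koszul_class c Cs u) = 1"
  using assms
proof (induction Cs)
  case (Cons C Cs)
  have IH: "koszul_test x y Cs u (koszul_class c Cs u) = 1"
    by (rule Cons.IH) (use Cons.prems in auto)
  have eval: "koszul_class c (C # Cs) u (v # l) = c C v * koszul_class c Cs u l"
    if v: "v \<in> test_vars x y C" for v l
  proof -
    have "(\<lambda>l. koszul_class c Cs u (v # l)) = (\<lambda>l. 0)"
      by (rule ext, rule koszul_class_eq_0) (use Cons.prems(1) Cons.prems(2)[of C] v in auto)
    then show ?thesis by (simp add: koszul_class_Cons)
  qed
  show ?case
  proof (cases "y C")
    case None
    then show ?thesis using IH Cons.prems(3)[of C] by (simp add: eval test_vars_def)
  next
    case (Some y')
    then show ?thesis using IH Cons.prems(4)[of C y']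
      by (simp add: eval test_vars_def koszul_test_shift)
  qed
qed (simp add: koszul_class_Nil)

text \<open>By anticommutation the form \<open>p\<close> moves past the factors \<open>As\<close>,
  up to sign, so the cocycle condition can be checked next to the relevant factor.\<close>

lemma kdiff_koszul_class_append:
  assumes J: "mp.ideal_set V J" and c: "\<And>C v. C \<in> set As \<Longrightarrow> c C v \<in> carrier (mpoly_ring V)"
    and "\<And>l. kdiff p (koszul_class c Bs u) l \<in> J"
  shows "kdiff p (koszul_class c (As @ Bs) u) l \<in> J"
  using c
proof (induction As arbitrary: l)
  case (Cons C As)
  have "kdiff (c C) (kdiff p (koszul_class c (As @ Bs) u)) l \<in> J"
    by (rule kdiff_mem)
      (use Cons in \<open>auto intro!: mp.ideal_setD(2)[OF J] mp.ideal_setD(3)[OF J] mp.ideal_setD(4)[OF J]\<close>)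
  then show ?case
    using mp.ideal_set_uminus[OF J]
    by (simp add: koszul_class_Cons kdiff_anticommute[of p "c C"])
qed (use assms in simp)

lemma koszul_class_multiple:
  fixes c :: "'c \<Rightarrow> 'v \<Rightarrow> ('v, 'k::field) mpoly"
  assumes u: "Poly_Mapping.keys u \<subseteq> V" and c: "\<And>C v. C \<in> set Cs \<Longrightarrow> c C v \<in> carrier (mpoly_ring V)"
  shows "koszul_class c Cs u l \<in> {Poly_Mapping.single u 1 * s | s. s \<in> carrier (mpoly_ring V)}"
  using c
proof (induction Cs arbitrary: l)
  case Nil
  show ?case
    by (auto simp: koszul_class_Nil intro: exI[of _ 0] exI[of _ 1] mp.zero_mem mp.one_mem)
next
  case (Cons C Cs)
  let ?A = "{Poly_Mapping.single u 1 * s | s. s \<in> carrier (mpoly_ring V)} :: ('v, 'k) mpoly set"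
  show ?case unfolding koszul_class_Cons
  proof (rule kdiff_mem)
    show "0 \<in> ?A" by (auto intro: exI[of _ 0] mp.zero_mem)
    show "a - b \<in> ?A" if "a \<in> ?A" "b \<in> ?A" for a b
      using that by (auto simp flip: right_diff_distrib intro: mp.diff_mem)
    show "c C v * koszul_class c Cs u m \<in> ?A" for v m
    proof -
      obtain s where "koszul_class c Cs u m = Poly_Mapping.single u 1 * s" "s \<in> carrier (mpoly_ring V)"
        using Cons.IH[of m] Cons.prems by auto
      then show ?thesis
        using Cons.prems[of C v] by (auto intro!: exI[of _ "c C v * s"] mp.mult_mem simp: ac_simps)
    qed
  qed
qed

text \<open>Each block contributes at most one variable to a tested exponent, hence never variables
  from both of its sides. These are the exponents that \<open>u\<close> keeps outside the
  ideal.\<close>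

lemma test_exponents_pure:
  assumes "distinct Cs" and "a \<in> test_exponents x y Cs m"
    and "\<And>C. C \<in> set Cs \<Longrightarrow> x C \<in> X C" and "\<And>C y'. C \<in> set Cs \<Longrightarrow> y C = Some y' \<Longrightarrow> y' \<in> Y C"
    and "\<And>C. C \<in> set Cs \<Longrightarrow> C = X C \<union> Y C \<and> X C \<inter> Y C = {}"
    and "\<And>C D. C \<in> set Cs \<Longrightarrow> D \<in> set Cs \<Longrightarrow> C \<noteq> D \<Longrightarrow> C \<inter> D = {}"
  shows "\<exists>\<epsilon>. a = m + \<epsilon> \<and> Poly_Mapping.keys \<epsilon> \<subseteq> \<Union> (set Cs) \<and>
    (\<forall>C\<in>set Cs. Poly_Mapping.keys \<epsilon> \<inter> X C = {} \<or> Poly_Mapping.keys \<epsilon> \<inter> Y C = {})"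
  using assms
proof (induction Cs arbitrary: m)
  case Nil
  then show ?case by (auto intro: exI[of _ 0])
next
  case (Cons C Cs)
  have CXY: "C = X C \<union> Y C" "X C \<inter> Y C = {}" using Cons.prems(5)[of C] by auto
  have disj: "C \<inter> D = {}" if "D \<in> set Cs" for D using Cons.prems(1,6) that by auto
  have XD: "X D \<subseteq> D" "Y D \<subseteq> D" if "D \<in> set Cs" for D using Cons.prems(5)[of D] that by auto
  have IH: "\<exists>\<epsilon>. a = m' + \<epsilon> \<and> Poly_Mapping.keys \<epsilon> \<subseteq> \<Union> (set Cs) \<and>
    (\<forall>C\<in>set Cs. Poly_Mapping.keys \<epsilon> \<inter> X C = {} \<or> Poly_Mapping.keys \<epsilon> \<inter> Y C = {})"
    if "a \<in> test_exponents x y Cs m'" for m'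
    by (rule Cons.IH[OF _ that]) (use Cons.prems in auto)
  consider "a \<in> test_exponents x y Cs m"
    | v where "v \<in> C" "a \<in> test_exponents x y Cs (m + pm_ev v)"
    using Cons.prems(2) Cons.prems(3)[of C] Cons.prems(4)[of C] CXY(1)
    by (auto split: option.splits)
  then show ?case
  proof cases
    case 1
    from IH[OF this] obtain \<epsilon> where \<epsilon>: "a = m + \<epsilon>" "Poly_Mapping.keys \<epsilon> \<subseteq> \<Union> (set Cs)"
      "\<forall>C\<in>set Cs. Poly_Mapping.keys \<epsilon> \<inter> X C = {} \<or> Poly_Mapping.keys \<epsilon> \<inter> Y C = {}" by blast
    moreover have "Poly_Mapping.keys \<epsilon> \<inter> X C = {}" using \<epsilon>(2) disj CXY(1) by blast
    ultimately show ?thesis by (intro exI[of _ \<epsilon>]) auto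
  next
    case 2
    from IH[OF 2(2)] obtain \<epsilon> where \<epsilon>: "a = m + pm_ev v + \<epsilon>" "Poly_Mapping.keys \<epsilon> \<subseteq> \<Union> (set Cs)"
      "\<forall>C\<in>set Cs. Poly_Mapping.keys \<epsilon> \<inter> X C = {} \<or> Poly_Mapping.keys \<epsilon> \<inter> Y C = {}" by blast
    have keys: "Poly_Mapping.keys (pm_ev v + \<epsilon>) = insert v (Poly_Mapping.keys \<epsilon>)"
      by (simp add: keys_add_nat)
    have "Poly_Mapping.keys \<epsilon> \<inter> C = {}" using \<epsilon>(2) disj by blast
    then have "Poly_Mapping.keys (pm_ev v + \<epsilon>) \<inter> X C = {} \<or> Poly_Mapping.keys (pm_ev v + \<epsilon>) \<inter> Y C = {}"
      unfolding keys using CXY by blast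
    moreover have "Poly_Mapping.keys (pm_ev v + \<epsilon>) \<inter> X D = {} \<or> Poly_Mapping.keys (pm_ev v + \<epsilon>) \<inter> Y D = {}"
      if "D \<in> set Cs" for D
      using XD[OF that] disj[OF that] 2(1) \<epsilon>(3) that unfolding keys by blast
    moreover have "Poly_Mapping.keys (pm_ev v + \<epsilon>) \<subseteq> \<Union> (set (C # Cs))"
      using \<epsilon>(2) 2(1) by (auto simp: keys)
    ultimately show ?thesis
      using \<epsilon>(1) by (intro exI[of _ "pm_ev v + \<epsilon>"]) (simp add: add.assoc)
  qed
qed

text \<open>The degree-one form of a block is the sum of \<open>x_v e_v\<close> over the side
  \<open>X C\<close>, or \<open>e_v\<close> for an isolated vertex. The hypotheses
  \<open>edge\<close> and \<open>rest\<close> make the product of these forms with \<open>u\<close>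
  a cocycle; \<open>pure\<close> makes the test functional vanish on cochains with values in the
  ideal.\<close>

theorem koszul_nonvanishing_blocks:
  fixes V :: "'v set" and P :: "('v \<Rightarrow>\<^sub>0 nat) \<Rightarrow> bool" and X Y :: "'v set \<Rightarrow> 'v set"
  assumes fin: "finite V" and P: "\<And>a b. P a \<Longrightarrow> P (a + b)" and Cs: "distinct Cs"
    and sub: "\<And>C. C \<in> set Cs \<Longrightarrow> C \<subseteq> V"
    and XY: "\<And>C. C \<in> set Cs \<Longrightarrow> C = X C \<union> Y C \<and> X C \<inter> Y C = {}"
    and X: "\<And>C. C \<in> set Cs \<Longrightarrow> X C \<noteq> {}"
    and iso: "\<And>C. C \<in> set Cs \<Longrightarrow> Y C = {} \<Longrightarrow> \<exists>v. C = {v} \<and> lk u v = 0"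
    and disj: "\<And>C D. C \<in> set Cs \<Longrightarrow> D \<in> set Cs \<Longrightarrow> C \<noteq> D \<Longrightarrow> C \<inter> D = {}"
    and u: "Poly_Mapping.keys u \<subseteq> V"
    and edge: "\<And>C a b. C \<in> set Cs \<Longrightarrow> a \<in> X C \<Longrightarrow> b \<in> Y C \<Longrightarrow> P (u + pm_ev a + pm_ev b)"
    and rest: "\<And>v. v \<in> V \<Longrightarrow> v \<notin> \<Union> (set Cs) \<Longrightarrow> P (u + pm_ev v)"
    and pure: "\<And>\<epsilon>. Poly_Mapping.keys \<epsilon> \<subseteq> \<Union> (set Cs) \<Longrightarrow>
       (\<And>C. C \<in> set Cs \<Longrightarrow> Poly_Mapping.keys \<epsilon> \<inter> X C = {} \<or> Poly_Mapping.keys \<epsilon> \<inter> Y C = {}) \<Longrightarrow>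
       \<not> P (u + \<epsilon>)"
  shows "mp.koszul_nonvanishing V (xvar V) (length Cs) (monomial_ideal V P :: ('v, 'k::field) mpoly set)"
proof -
  define J :: "('v, 'k) mpoly set" where "J = monomial_ideal V P"
  let ?S = "carrier (mpoly_ring V) :: ('v, 'k) mpoly set"
  have J: "mp.ideal_set V J" unfolding J_def by (rule ideal_set_monomial_ideal) (rule P)
  define x where "x C = (SOME v. v \<in> X C)" for C
  define y where "y C = (if Y C = {} then None else Some (SOME v. v \<in> Y C))" for C
  \<comment> \<open>For an isolated vertex the class is \<open>e_v\<close> with coefficient 1, the
    nonzero class of degree one of a polynomial ring in one variable.\<close>
  define c :: "'v set \<Rightarrow> 'v \<Rightarrow> ('v, 'k) mpoly" where
    "c C v = (if v \<notin> X C then 0 else if Y C = {} then 1 else xvar V v)" for C v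
  have xX: "x C \<in> X C" if "C \<in> set Cs" for C
    unfolding x_def using X[OF that] by (simp add: some_in_eq)
  have yY: "y' \<in> Y C" if "y C = Some y'" for C y'
    using that by (auto simp: y_def some_in_eq split: if_splits)
  have tvC: "test_vars x y C \<subseteq> C" if "C \<in> set Cs" for C
    using xX[OF that] yY XY[OF that] by (cases "y C") (auto simp: test_vars_def)
  have cS: "c C v \<in> ?S" for C v
    by (simp add: c_def xvar_mem mp.zero_mem mp.one_mem)
  have c0: "c D v = 0" if "C \<in> set Cs" "D \<in> set Cs" "C \<noteq> D" "v \<in> C" for C D v
    using disj[OF that(1-3)] that(4) XY[OF that(2)] by (auto simp: c_def)
  have uS: "Poly_Mapping.single (u + a) 1 * s \<in> J"
    if "Poly_Mapping.keys a \<subseteq> V" "P (u + a)" "s \<in> ?S" for a s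
  proof -
    have "Poly_Mapping.single (u + a) 1 \<in> J"
      using that(1,2) u by (auto simp: J_def monomial_ideal_def keys_add_nat intro!: single_mem_mpoly_ring)
    from mp.ideal_setD(4)[OF J that(3) this] show ?thesis by (subst mult.commute)
  qed
  define z where "z = koszul_class c Cs u"
  define part :: "'v set \<Rightarrow> 'v \<Rightarrow> ('v, 'k) mpoly" where "part C v = (if v \<in> C then xvar V v else 0)" for C v
  define e :: "'v \<Rightarrow> ('v, 'k) mpoly" where "e v = (if v \<in> \<Union> (set Cs) then 0 else xvar V v)" for v
  \<comment> \<open>The differential is the sum of its parts on the blocks and a remainder outside
    them, so the cocycle condition can be checked for each part separately.\<close>
  have xvar_split: "xvar V = (\<lambda>v. (\<Sum>C\<in>set Cs. part C v) + e v)"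
  proof
    fix v
    show "xvar V v = (\<Sum>C\<in>set Cs. part C v) + e v"
    proof (cases "v \<in> \<Union> (set Cs)")
      case True
      then obtain C where C: "C \<in> set Cs" "v \<in> C" by auto
      have "(\<Sum>D\<in>set Cs. part D v) = (\<Sum>D\<in>set Cs. if D = C then xvar V v else 0)"
      proof (intro sum.cong refl)
        show "part D v = (if D = C then xvar V v else 0)" if "D \<in> set Cs" for D
          using C disj[OF that C(1)] by (auto simp: part_def)
      qed
      then show ?thesis using C True by (simp add: e_def)
    next
      case False
      then show ?thesis by (auto simp: e_def part_def intro!: sum.neutral)
    qed
  qed
  have part_cocycle: "kdiff (part C) z l \<in> J" if C: "C \<in> set Cs" for C l
  proof -
    obtain As Bs where AB: "Cs = As @ C # Bs" using split_list[OF C] by blast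
    let ?w = "koszul_class c Bs u"
    have "kdiff (part C) (kdiff (c C) ?w) l \<in> J" for l
    proof (cases "Y C = {}")
      case True
      then obtain v where v: "C = {v}" using iso[OF C] by blast
      \<comment> \<open>For an isolated vertex the block part is a multiple of the form
        \<open>c C\<close>, whose square is zero.\<close>
      then have "part C = (\<lambda>w. xvar V v * c C w)"
        using True XY[OF C] by (auto simp: part_def c_def)
      then have "kdiff (part C) (kdiff (c C) ?w) l = 0" by (simp only: kdiff_left_mult kdiff_kdiff mult_zero_right)
      then show ?thesis using mp.ideal_setD(2)[OF J] by simp
    next
      case False
      define c' :: "'v \<Rightarrow> ('v, 'k) mpoly" where "c' v = (if v \<in> Y C then xvar V v else 0)" for v
      have "part C = (\<lambda>v. c C v + c' v)"
      proof
        fix v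
        have "v \<in> C \<longleftrightarrow> v \<in> X C \<or> v \<in> Y C" "\<not> (v \<in> X C \<and> v \<in> Y C)" using XY[OF C] by blast+
        then show "part C v = c C v + c' v" using False by (auto simp: part_def c_def c'_def)
      qed
      \<comment> \<open>The half of the differential on \<open>X C\<close> is \<open>c C\<close> and
        squares to zero. The half on \<open>Y C\<close> meets it only in products of variables from
        opposite sides, which \<open>u\<close> carries into \<open>J\<close>.\<close>
      then have "kdiff (part C) (kdiff (c C) ?w) l = kdiff c' (kdiff (c C) ?w) l"
        by (simp only: kdiff_left_add kdiff_kdiff add_0)
      also have "\<dots> \<in> J"
      proof (rule kdiff_mem)
        show "c' a * kdiff (c C) ?w m \<in> J" for a m
        proof -
          have "kdiff (c C) ?w m \<in> {r. c' a * r \<in> J}"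
          proof (rule kdiff_mem)
            show "c C b * ?w m \<in> {r. c' a * r \<in> J}" for b m
            proof (cases "a \<in> Y C \<and> b \<in> X C")
              case True
              obtain s where s: "?w m = Poly_Mapping.single u 1 * s" "s \<in> ?S"
                using koszul_class_multiple[OF u, where Cs = Bs and c = c and l = m] cS by auto
              have ab: "a \<in> V" "b \<in> V" using True XY[OF C] sub[OF C] by auto
              have "c' a * (c C b * ?w m) = Poly_Mapping.single (u + (pm_ev b + pm_ev a)) 1 * s"
                using True \<open>Y C \<noteq> {}\<close> ab
                by (simp add: c'_def c_def s(1) xvar_def mvar_eq mult_single ac_simps flip: mult.assoc)
              also have "\<dots> \<in> J"
                using True edge[OF C, of b a] ab s(2)
                by (intro uS) (auto simp: keys_add_nat ac_simps)
              finally show ?thesis by simp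
            next
              case False
              then have "c' a * (c C b * ?w m) = 0" by (auto simp: c'_def c_def)
              then show ?thesis using mp.ideal_setD(2)[OF J] by simp
            qed
          qed (use mp.ideal_setD(2,3)[OF J] in \<open>auto simp: right_diff_distrib\<close>)
          then show ?thesis by simp
        qed
      qed (use mp.ideal_setD(2,3)[OF J] in auto)
      finally show ?thesis .
    qed
    then show ?thesis
      unfolding z_def AB
      by (intro kdiff_koszul_class_append[OF J cS]) (simp add: koszul_class_Cons)
  qed
  have "kdiff e (koszul_class c [] u) l \<in> J" for l
  proof (rule kdiff_mem)
    show "e v * koszul_class c [] u m \<in> J" for v m
    proof (cases "v \<in> V \<and> v \<notin> \<Union> (set Cs) \<and> m = []")
      case True
      then have "e v * koszul_class c [] u m = Poly_Mapping.single (u + pm_ev v) 1 * 1"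
        by (auto simp: e_def xvar_def mvar_eq koszul_class_Nil mult_single ac_simps)
      also have "\<dots> \<in> J" using True rest[of v] by (intro uS mp.one_mem) auto
      finally show ?thesis .
    next
      case False
      then have "e v * koszul_class c [] u m = 0"
        by (auto simp: e_def xvar_def koszul_class_Nil)
      then show ?thesis using mp.ideal_setD(2)[OF J] by simp
    qed
  qed (use mp.ideal_setD(2,3)[OF J] in auto)
  then have e_cocycle: "kdiff e z l \<in> J" for l
    using kdiff_koszul_class_append[OF J cS, where As = Cs and p = e and Bs = "[]" and u = u and l = l] by (simp add: z_def)
  have cocycle: "kdiff (xvar V) z l \<in> J" for l
  proof -
    have "kdiff (xvar V) z l = (\<Sum>C\<in>set Cs. kdiff (part C) z l) + kdiff e z l"
      by (subst xvar_split) (simp only: kdiff_left_add kdiff_left_sum)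
    then show ?thesis
      using mp.ideal_set_add[OF J mp.ideal_set_sum[OF J part_cocycle] e_cocycle] by simp
  qed
  have test_z: "koszul_test x y Cs u z = 1"
    unfolding z_def
  proof (rule koszul_test_class[OF Cs])
    show "c D v = 0" if "C \<in> set Cs" "D \<in> set Cs" "C \<noteq> D" "v \<in> test_vars x y C" for C D v
      using c0[OF that(1-3)] tvC[OF that(1)] that(4) by blast
    show "c C (x C) = 1" if "C \<in> set Cs" "y C = None" for C
      using xX[OF that(1)] that(2) by (simp add: c_def y_def split: if_splits)
    show "c C (x C) = mvar (x C) \<and> c C y' = 0" if "C \<in> set Cs" "y C = Some y'" for C y'
      using xX[OF that(1)] yY[OF that(2)] XY[OF that(1)] sub[OF that(1)] by (auto simp: c_def xvar_def)
  qed
  have "mp.koszul_nonvanishing V (xvar V) (length Cs) J"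
  proof (rule mp.koszul_nonvanishingI[of z])
    show "range z \<subseteq> ?S"
    proof clarify
      fix l
      obtain s where "z l = Poly_Mapping.single u 1 * s" "s \<in> ?S"
        using koszul_class_multiple[OF u, where Cs = Cs and c = c and l = l] cS by (auto simp: z_def)
      then show "z l \<in> ?S" using u by (simp add: mp.mult_mem single_mem_mpoly_ring)
    qed
    show "z l = 0" if "length l \<noteq> length Cs" for l
      unfolding z_def using that by (rule koszul_class_length)
    fix w :: "'v list \<Rightarrow> ('v, 'k) mpoly" assume w: "\<And>l. z l - kdiff (xvar V) w l \<in> J"
    \<comment> \<open>No tested exponent satisfies \<open>P\<close>, so the functional vanishes on
      \<open>J\<close>-valued cochains. By linearity the value 1 on \<open>z\<close> would have to
      equal the value 0 on the coboundary.\<close>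
    have "koszul_test x y Cs u (\<lambda>l. z l - kdiff (xvar V) w l) = 0"
    proof (rule koszul_test_eq_0)
      fix a l assume a: "a \<in> test_exponents x y Cs u"
      obtain \<epsilon> where "a = u + \<epsilon>" "Poly_Mapping.keys \<epsilon> \<subseteq> \<Union> (set Cs)"
        "\<forall>C\<in>set Cs. Poly_Mapping.keys \<epsilon> \<inter> X C = {} \<or> Poly_Mapping.keys \<epsilon> \<inter> Y C = {}"
        using test_exponents_pure[OF Cs a xX yY XY disj] by blast
      then have "\<not> P a" using pure[of \<epsilon>] by auto
      then show "lk (z l - kdiff (xvar V) w l) a = 0"
        using w[of l] by (auto simp: J_def monomial_ideal_def in_keys_iff)
    qed
    moreover have "koszul_test x y Cs u (kdiff (xvar V) w) = 0"
    proof (rule koszul_test_coboundary[OF Cs])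
      show "test_vars x y C \<subseteq> V" if "C \<in> set Cs" for C using tvC[OF that] sub[OF that] by blast
      show "test_vars x y C \<inter> test_vars x y D = {}" if "C \<in> set Cs" "D \<in> set Cs" "C \<noteq> D" for C D
        using tvC[OF that(1)] tvC[OF that(2)] disj[OF that] by blast
      show "lk u (x C) = 0" if "C \<in> set Cs" "y C = None" for C
        using iso[OF that(1)] that(2) xX[OF that(1)] XY[OF that(1)]
        by (auto simp: y_def split: if_splits)
    qed
    ultimately show False using test_z by (simp add: koszul_test_diff)
  qed (rule cocycle)
  then show ?thesis by (simp only: J_def)
qed

section \<open>Connected components\<close>

text \<open>\<open>reach E r p v\<close>: there is a walk from \<open>r\<close> to \<open>v\<close>, of odd length iff \<open>p\<close>.\<close>

inductive reach :: "'v set set \<Rightarrow> 'v \<Rightarrow> bool \<Rightarrow> 'v \<Rightarrow> bool" for E r where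
  reach_refl: "reach E r False r"
| reach_step: "reach E r p v \<Longrightarrow> {v, w} \<in> E \<Longrightarrow> reach E r (\<not> p) w"

lemma reach_trans: "reach E v q w \<Longrightarrow> reach E r p v \<Longrightarrow> reach E r (p \<noteq> q) w"
proof (induction rule: reach.induct)
  case (reach_step q v' w)
  then show ?case using reach.reach_step[of E r "p \<noteq> q" v' w] by (cases p; cases q) auto
qed simp

lemma reach_sym: "reach E r p v \<Longrightarrow> reach E v p r"
proof (induction rule: reach.induct)
  case (reach_step p v w)
  have "reach E w True v"
    using reach.reach_step[OF reach_refl[of E w], of v] reach_step.hyps by (simp add: insert_commute)
  from reach_trans[OF reach_step.IH this] show ?case by simp
qed (rule reach_refl)

definition component :: "'v set set \<Rightarrow> 'v \<Rightarrow> 'v set" where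
  "component E r = {v. \<exists>p. reach E r p v}"

lemma mem_component: "r \<in> component E r"
  by (auto simp: component_def intro: reach_refl)

lemma component_eq:
  assumes "v \<in> component E r" shows "component E v = component E r"
  using assms reach_trans reach_sym by (fastforce simp: component_def)

lemma component_edge:
  assumes "{x, y} \<in> E" "x \<in> component E r" shows "y \<in> component E r"
  using assms reach_step by (fastforce simp: component_def)

lemma reach_exit:
  "reach E r p v \<Longrightarrow> r \<in> W \<Longrightarrow> v \<notin> W \<Longrightarrow> \<exists>a b. a \<in> W \<and> b \<notin> W \<and> {a, b} \<in> E \<and> b \<in> component E r"
proof (induction rule: reach.induct)
  case (reach_step p v w)
  have "w \<in> component E r"
    using reach.reach_step[OF reach_step.hyps] by (auto simp: component_def)
  then show ?case using reach_step by (cases "v \<in> W") auto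
qed auto

definition edge_connected :: "'v set set \<Rightarrow> 'v set \<Rightarrow> bool" where
  "edge_connected E C \<longleftrightarrow>
     (\<forall>W\<subseteq>C. W \<noteq> {} \<longrightarrow> W \<noteq> C \<longrightarrow> (\<exists>a\<in>W. \<exists>b\<in>C - W. {a, b} \<in> E))"

lemma edge_connected_component: "edge_connected E (component E r)"
  unfolding edge_connected_def
proof (intro allI impI)
  fix W assume W: "W \<subseteq> component E r" "W \<noteq> {}" "W \<noteq> component E r"
  then obtain w v where w: "w \<in> W" "v \<in> component E r" "v \<notin> W" by blast
  then have eq: "component E w = component E r" using W by (intro component_eq) auto
  then obtain p where "reach E w p v" using w by (auto simp: component_def)
  from reach_exit[OF this w(1,3)] show "\<exists>a\<in>W. \<exists>b\<in>component E r - W. {a, b} \<in> E"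
    by (auto simp: eq)
qed

text \<open>Induction along a connected set, attaching one adjacent vertex at a time; it carries the
  growth of the colon witnesses.\<close>

lemma grow_connected:
  assumes "edge_connected E C" "finite C" "W \<subseteq> C" "W \<noteq> {}" "Q W"
    and "\<And>W a b. W \<subseteq> C \<Longrightarrow> W \<noteq> {} \<Longrightarrow> Q W \<Longrightarrow> a \<in> W \<Longrightarrow> b \<in> C \<Longrightarrow> b \<notin> W \<Longrightarrow> {a, b} \<in> E \<Longrightarrow> Q (insert b W)"
  shows "Q C"
  using assms(3-5)
proof (induction "card (C - W)" arbitrary: W rule: less_induct)
  case less
  show ?case
  proof (cases "W = C")
    case False
    then obtain a b where ab: "a \<in> W" "b \<in> C" "b \<notin> W" "{a, b} \<in> E"
      using assms(1) less.prems unfolding edge_connected_def by blast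
    have "card (C - insert b W) < card (C - W)"
      using ab assms(2) by (intro psubset_card_mono) auto
    then show ?thesis
      by (rule less.hyps) (use ab less.prems assms(6) in auto)
  qed (use less.prems in simp)
qed

text \<open>The first vertex is not repeated at the end, so the length of the list is the number of
  edges, closing edge included.\<close>

definition closed_walk :: "'v set set \<Rightarrow> 'v list \<Rightarrow> bool" where
  "closed_walk E l \<longleftrightarrow> l \<noteq> [] \<and> successively (\<lambda>a b. {a, b} \<in> E) l \<and> {last l, hd l} \<in> E"

lemma reach_walk:
  "reach E r p v \<Longrightarrow> \<exists>l. l \<noteq> [] \<and> hd l = r \<and> last l = v \<and> successively (\<lambda>a b. {a, b} \<in> E) l \<and>
     set l \<subseteq> component E r \<and> (even (length l) \<longleftrightarrow> p)"
proof (induction rule: reach.induct)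
  case reach_refl
  show ?case by (rule exI[of _ "[r]"]) (simp add: mem_component)
next
  case (reach_step p v w)
  then obtain l where l: "l \<noteq> []" "hd l = r" "last l = v" "successively (\<lambda>a b. {a, b} \<in> E) l"
    "set l \<subseteq> component E r" "even (length l) \<longleftrightarrow> p" by blast
  have "w \<in> component E r"
    using reach.reach_step[OF reach_step.hyps] by (auto simp: component_def)
  then show ?case
    using l reach_step.hyps by (intro exI[of _ "l @ [w]"]) (auto simp: successively_append_iff)
qed

text \<open>The parities of walks from \<open>r\<close> define the two sides. They overlap only if
  two walks to one vertex, joined together, form an odd walk from \<open>r\<close> to
  itself.\<close>

lemma bipartition_or_odd_closed_walk:
  fixes E :: "'v set set" and r :: 'v
  defines "C \<equiv> component E r"
  assumes E: "\<forall>e\<in>E. card e = 2"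
  shows "(\<exists>X Y. bipartition (inner_edges E C) C X Y \<and> X \<noteq> {}) \<or>
    (\<exists>l. odd (length l) \<and> closed_walk E l \<and> set l \<subseteq> C)"
proof (cases "reach E r True r")
  case True
  from reach_walk[OF this] obtain l where l: "l \<noteq> []" "hd l = r" "last l = r"
    "successively (\<lambda>a b. {a, b} \<in> E) l" "set l \<subseteq> C" "even (length l)" unfolding C_def by blast
  then obtain m where m: "l = m @ [r]" "odd (length m)" by (cases l rule: rev_cases) auto
  then have "m \<noteq> []" by auto
  then have "closed_walk E m" "set m \<subseteq> C"
    using l m(1) by (auto simp: closed_walk_def successively_append_iff)
  then show ?thesis using m(2) by blast
next
  case False
  define X where "X = {v. reach E r False v}"
  define Y where "Y = {v. reach E r True v}"
  have CXY: "C = X \<union> Y" by (auto simp: C_def component_def X_def Y_def) (metis (full_types))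
  have XY: "X \<inter> Y = {}"
    using False reach_trans[of E _ True r r False] reach_sym by (fastforce simp: X_def Y_def)
  have "\<exists>x\<in>X. \<exists>y\<in>Y. e = {x, y}" if e: "e \<in> inner_edges E C" for e
  proof -
    obtain a b where ab: "e = {a, b}" "{a, b} \<in> E" "a \<in> C"
      using e E by (auto simp: inner_edges_def card_2_iff)
    show ?thesis
    proof (cases "a \<in> X")
      case True
      then have "b \<in> Y" using reach_step[of E r False a b] ab by (simp add: X_def Y_def)
      then show ?thesis using True ab by blast
    next
      case False
      then have a: "a \<in> Y" using ab CXY by auto
      then have "b \<in> X" using reach_step[of E r True a b] ab by (simp add: X_def Y_def)
      then show ?thesis using a ab by (metis insert_commute)
    qed
  qed
  then have "bipartition (inner_edges E C) C X Y" using CXY XY by (simp add: bipartition_def)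
  moreover have "r \<in> X" by (simp add: X_def reach_refl)
  ultimately show ?thesis by blast
qed

section \<open>Colon witnesses\<close>

lemma wt_eq_0: "Poly_Mapping.keys a \<inter> C = {} \<Longrightarrow> wt a C = 0"
  by (auto simp: wt_def in_keys_iff intro!: sum.neutral)

text \<open>With \<open>u\<close> the product of suitable edges, \<open>u x y\<close> lies in the next power whenever \<open>x\<close>, \<open>y\<close> are on
  different sides: adding a vertex \<open>b\<close> adjacent to \<open>a\<close> multiplies \<open>u\<close> by an edge \<open>az\<close>, because
  \<open>x b (a z) u = (a b) (x z u)\<close>.\<close>

lemma bipartite_colon_witness:
  assumes conn: "edge_connected E C" and fin: "finite C" and card: "card C \<ge> 2"
    and bip: "bipartition (inner_edges E C) C X Y" and t: "t \<ge> card C - 2"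
  shows "\<exists>u. Poly_Mapping.keys u \<subseteq> C \<and> wt u X = t \<and> wt u Y = t \<and> epow E t u \<and>
     (\<forall>x\<in>X. \<forall>y\<in>Y. epow E (Suc t) (u + pm_ev x + pm_ev y))"
proof -
  have XY: "C = X \<union> Y" "X \<inter> Y = {}" and finXY: "finite X" "finite Y"
    using bip fin by (auto simp: bipartition_def)
  have cross: "x \<in> X \<and> y \<in> Y \<or> x \<in> Y \<and> y \<in> X" if "{x, y} \<in> E" "x \<in> C" "y \<in> C" for x y
  proof -
    have "{x, y} \<in> inner_edges E C" using that by (simp add: inner_edges_def)
    then obtain p q where "p \<in> X" "q \<in> Y" "{x, y} = {p, q}"
      using bip unfolding bipartition_def by blast
    then show ?thesis by (auto simp: doubleton_eq_iff)
  qed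
  have edge_wt: "wt (pm_ev x + pm_ev y) X = 1 \<and> wt (pm_ev x + pm_ev y) Y = 1"
    if "{x, y} \<in> E" "x \<in> C" "y \<in> C" for x y
    using cross[OF that] XY(2) finXY by (auto simp: wt_add wt_ev)
  \<comment> \<open>The weights are recorded for the later upper bound: a side is a vertex cover,
    and one of weight \<open>t\<close> permits at most \<open>t\<close> edges.\<close>
  define good where "good W t u \<longleftrightarrow> Poly_Mapping.keys u \<subseteq> C \<and> wt u X = t \<and> wt u Y = t \<and> epow E t u \<and>
     (\<forall>x\<in>X \<inter> W. \<forall>y\<in>Y \<inter> W. epow E (Suc t) (u + pm_ev x + pm_ev y))" for W t u
  have add_edge: "good W (Suc t) (u + pm_ev x + pm_ev y)"
    if u: "good W t u" and e: "{x, y} \<in> E" "x \<in> C" "y \<in> C" for W t u x y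
  proof -
    have "epow E (Suc (Suc t)) (u + pm_ev x + pm_ev y + pm_ev p + pm_ev q)"
      if "p \<in> X \<inter> W" "q \<in> Y \<inter> W" for p q
      using epow_Suc[of E "Suc t" "u + pm_ev p + pm_ev q" x y] u that e
      by (simp add: good_def ac_simps)
    then show ?thesis
      using u e edge_wt[OF e] epow_Suc[of E t u x y] by (auto simp: good_def wt_add keys_add_nat)
  qed
  \<comment> \<open>A single edge starts with \<open>t = 0\<close> and each further vertex costs one
    edge, whence \<open>card W - 2\<close>. The neighbour inside \<open>W\<close> supplies the
    vertex \<open>z\<close> of the growth step.\<close>
  define Q where "Q W \<longleftrightarrow> card W \<ge> 2 \<and> (\<forall>w\<in>W. \<exists>z\<in>W. {w, z} \<in> E) \<and> (\<exists>u. good W (card W - 2) u)" for W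
  obtain a where a: "a \<in> C" using card by fastforce
  moreover have "{a} \<noteq> C" using card by auto
  ultimately obtain b where b: "b \<in> C" "b \<noteq> a" "{a, b} \<in> E"
    using conn unfolding edge_connected_def by (metis DiffE empty_iff empty_subsetI insert_subset singletonD singletonI)
  have "Q C"
  proof (rule grow_connected[OF conn fin])
    show "{a, b} \<subseteq> C" "{a, b} \<noteq> {}" using a b by auto
    have "{p, q} = {a, b}" if "p \<in> X \<inter> {a, b}" "q \<in> Y \<inter> {a, b}" for p q
      using that XY(2) by auto
    then have "good {a, b} 0 0"
      using epow_edge[of _ _ E] b(3) by (auto simp: good_def wt_def epow_0)
    then show "Q {a, b}" using b by (auto simp: Q_def insert_commute)
  next
    fix W a b assume W: "W \<subseteq> C" "W \<noteq> {}" "Q W" and a: "a \<in> W" and b: "b \<in> C" "b \<notin> W" "{a, b} \<in> E"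
    have finW: "finite W" using W(1) fin finite_subset by blast
    obtain u where u: "good W (card W - 2) u" using W(3) by (auto simp: Q_def)
    obtain z where z: "z \<in> W" "{a, z} \<in> E" using W(3) a by (auto simp: Q_def)
    define t where "t = card W - 2"
    have card: "card (insert b W) - 2 = Suc t" "2 \<le> card (insert b W)"
      using W(3) finW b(2) by (auto simp: Q_def t_def)
    have aC: "a \<in> C" "z \<in> C" using a z W(1) by auto
    let ?u = "u + pm_ev a + pm_ev z"
    have g: "good W (Suc t) ?u" by (rule add_edge) (use u z aC in \<open>simp_all add: t_def\<close>)
    have new: "epow E (Suc (Suc t)) (?u + pm_ev p + pm_ev b)"
      if "p \<in> W" "p \<in> X \<and> z \<in> Y \<or> p \<in> Y \<and> z \<in> X" for p
    proof -
      have "epow E (Suc t) (u + pm_ev p + pm_ev z)"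
      proof -
        have G: "epow E (Suc t) (u + pm_ev x + pm_ev y)" if "x \<in> X \<inter> W" "y \<in> Y \<inter> W" for x y
          using u that by (simp add: good_def t_def)
        show ?thesis
          using that(2)
        proof
          assume "p \<in> Y \<and> z \<in> X"
          then have "epow E (Suc t) (u + pm_ev z + pm_ev p)" using that(1) z(1) by (intro G) auto
          then show ?thesis by (metis add.assoc add.commute)
        qed (use that(1) z(1) in \<open>auto intro: G\<close>)
      qed
      from epow_Suc[OF this b(3)] show ?thesis by (simp add: ac_simps)
    qed
    have "epow E (Suc (Suc t)) (?u + pm_ev p + pm_ev q)"
      if pq: "p \<in> X \<inter> insert b W" "q \<in> Y \<inter> insert b W" for p q
    proof -
      consider "p \<in> W" "q \<in> W" | "p = b" "q \<in> W" | "p \<in> W" "q = b" using pq XY(2) by auto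
      then show ?thesis
      proof cases
        case 1
        then show ?thesis using g pq by (simp add: good_def)
      next
        case 2
        then have "z \<in> X" using cross[of a b] cross[of a z] aC z b pq XY(2) by auto
        then show ?thesis using new[of q] 2 pq by (simp add: ac_simps)
      next
        case 3
        then have "z \<in> Y" using cross[of a b] cross[of a z] aC z b pq XY(2) by auto
        then show ?thesis using new[of p] 3 pq by simp
      qed
    qed
    then have "good (insert b W) (Suc t) ?u" using g by (simp add: good_def)
    moreover have "\<forall>w\<in>insert b W. \<exists>z\<in>insert b W. {w, z} \<in> E"
      using W(3) a b(3) unfolding Q_def by (metis insert_commute insert_iff)
    ultimately show "Q (insert b W)" unfolding Q_def using card by auto
  qed
  then obtain u where "good C (card C - 2) u" by (auto simp: Q_def)
  then have "\<exists>u. good C (card C - 2) u" by blast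
  \<comment> \<open>Multiplying by a fixed edge of \<open>C\<close> raises \<open>t\<close> by one
    and keeps all conditions.\<close>
  then have "\<exists>u. good C t u"
    using t by (induction rule: dec_induct[OF t, consumes 0]) (use add_edge a b in blast)+
  then show ?thesis using XY(1) by (auto simp: good_def Int_absorb2)
qed

lemma epow_walk:
  "successively (\<lambda>a b. {a, b} \<in> E) l \<Longrightarrow> length l = 2 * m \<Longrightarrow> epow E m (\<Sum>v\<leftarrow>l. pm_ev v)"
proof (induction m arbitrary: l)
  case (Suc m)
  then obtain a b l' where l: "l = a # b # l'" by (cases l rule: remdups_adj.cases) auto
  have "epow E m (\<Sum>v\<leftarrow>l'. pm_ev v)"
    by (rule Suc.IH) (use Suc.prems l in \<open>auto simp: successively_Cons\<close>)
  from epow_Suc[OF this, of a b] show ?case using Suc.prems l by (simp add: ac_simps)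
qed (simp add: epow_0)

text \<open>At a repeated vertex a closed walk splits into two shorter closed walks, one of them
  odd; so a shortest odd one has no repetition.\<close>

lemma distinct_odd_closed_walk:
  assumes "odd (length l)" "closed_walk E l" "set l \<subseteq> C"
  obtains l' where "odd (length l')" "closed_walk E l'" "set l' \<subseteq> C" "distinct l'"
proof -
  define Q where "Q l \<longleftrightarrow> odd (length l) \<and> closed_walk E l \<and> set l \<subseteq> C" for l
  obtain l where l: "Q l" "\<And>m. Q m \<Longrightarrow> length l \<le> length m"
    using exists_least_iff[of "\<lambda>n. \<exists>l. Q l \<and> length l = n"] assms
    by (metis (no_types, lifting) Q_def not_less)
  have "distinct l"
  proof (rule ccontr)
    assume "\<not> distinct l"
    then obtain as v bs cs where d: "l = as @ [v] @ bs @ [v] @ cs" using not_distinct_decomp by blast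
    have s: "successively (\<lambda>a b. {a, b} \<in> E) l" "{last l, hd l} \<in> E" "odd (length l)" "set l \<subseteq> C"
      using l(1) by (auto simp: Q_def closed_walk_def)
    have "closed_walk E (v # bs)"
      using s(1) by (cases bs rule: rev_cases)
        (auto simp: d closed_walk_def successively_append_iff successively_Cons hd_append split: if_splits)
    moreover have "closed_walk E (as @ v # cs)"
      using s(1,2) by (cases as; cases cs)
        (auto simp: d closed_walk_def successively_append_iff successively_Cons hd_append split: if_splits)
    moreover have "odd (length (v # bs)) \<or> odd (length (as @ v # cs))" using s(3) by (auto simp: d)
    ultimately have "Q (v # bs) \<or> Q (as @ v # cs)" using s(4) by (auto simp: Q_def d)
    then show False using l(2) by (fastforce simp: d)
  qed
  then show thesis using that l(1) by (auto simp: Q_def)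
qed

lemma wt_walk: "finite C \<Longrightarrow> set l \<subseteq> C \<Longrightarrow> wt (\<Sum>v\<leftarrow>l. pm_ev v) C = length l"
  by (induction l) (auto simp: wt_add wt_ev wt_def[of 0])

lemma keys_walk: "Poly_Mapping.keys (\<Sum>v\<leftarrow>l. pm_ev v) = set l"
  by (induction l) (auto simp: keys_add_nat)

text \<open>Start with \<open>u\<close> the product of the vertices of an odd cycle of length
  \<open>2 r + 1\<close>, which contains \<open>r\<close> edges. Repeating any vertex
  \<open>v\<close> of the cycle gives a walk on \<open>2 r + 2\<close> vertices from
  \<open>v\<close> to \<open>v\<close>, hence \<open>r + 1\<close> edges. A new vertex
  \<open>b\<close> adjacent to \<open>a\<close> is handled by \<open>b (a z) u = (a b) (z u)\<close>
  for a neighbour \<open>z\<close> of \<open>a\<close>. Each step adds an edge, so the degree stays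
  \<open>2 t + 1\<close>.\<close>

lemma nonbipartite_colon_witness:
  assumes conn: "edge_connected E C" and fin: "finite C" and E: "\<forall>e\<in>E. card e = 2"
    and odd: "odd (length l0)" "closed_walk E l0" "set l0 \<subseteq> C" and t: "t \<ge> card C - 2"
  shows "card C \<ge> 2 \<and> (\<exists>u. Poly_Mapping.keys u \<subseteq> C \<and> wt u C = 2 * t + 1 \<and> epow E t u \<and>
     (\<forall>v\<in>C. epow E (Suc t) (u + pm_ev v)))"
proof -
  obtain l where l: "odd (length l)" "closed_walk E l" "set l \<subseteq> C" "distinct l"
    using distinct_odd_closed_walk[OF odd] by blast
  obtain r where r: "length l = 2 * r + 1" using l(1) by (auto elim: oddE)
  have walk: "successively (\<lambda>a b. {a, b} \<in> E) l" and close: "{last l, hd l} \<in> E"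
    using l(2) by (auto simp: closed_walk_def)
  have "r \<noteq> 0"
  proof
    assume "r = 0"
    then obtain v where "l = [v]" using r by (auto simp: length_Suc_conv)
    then have "{v} \<in> E" using close by simp
    then show False using E by fastforce
  qed
  \<comment> \<open>Rotates the cycle so that it starts at \<open>v\<close>, and closes it with a
    second copy of \<open>v\<close>.\<close>
  have rot: "\<exists>m. successively (\<lambda>a b. {a, b} \<in> E) (v # m @ [v]) \<and> length l = Suc (length m) \<and>
      set l = set (v # m) \<and> (\<Sum>v\<leftarrow>l. pm_ev v) = (\<Sum>v\<leftarrow>v # m. pm_ev v)"
    if v: "v \<in> set l" for v
  proof -
    obtain as bs where d: "l = as @ v # bs" using split_list[OF v] by blast
    have "successively (\<lambda>a b. {a, b} \<in> E) ((v # bs) @ (as @ [v]))"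
      using walk close by (cases as)
        (auto simp: d successively_append_iff successively_Cons hd_append split: if_splits)
    then show ?thesis by (intro exI[of _ "bs @ as"]) (auto simp: d ac_simps)
  qed
  define good where "good W t u \<longleftrightarrow> Poly_Mapping.keys u \<subseteq> C \<and> wt u C = 2 * t + 1 \<and> epow E t u \<and>
     (\<forall>v\<in>W. epow E (Suc t) (u + pm_ev v))" for W t u
  have add_edge: "good W (Suc t) (u + pm_ev x + pm_ev y)"
    if u: "good W t u" and e: "{x, y} \<in> E" "x \<in> C" "y \<in> C" for W t u x y
  proof -
    have "epow E (Suc (Suc t)) (u + pm_ev x + pm_ev y + pm_ev p)" if "p \<in> W" for p
      using epow_Suc[of E "Suc t" "u + pm_ev p" x y] u that e by (simp add: good_def ac_simps)
    then show ?thesis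
      using u e fin epow_Suc[of E t u x y] by (auto simp: good_def wt_add wt_ev keys_add_nat)
  qed
  \<comment> \<open>Only an inequality: a cycle of length \<open>2 r + 1\<close> starts with
    \<open>t = r\<close>, and \<open>r + 2\<close> is at most \<open>2 r + 1\<close> because
    \<open>r\<close> is not zero.\<close>
  define Q where "Q W \<longleftrightarrow> (\<forall>w\<in>W. \<exists>z\<in>W. {w, z} \<in> E) \<and> (\<exists>t u. t + 2 \<le> card W \<and> good W t u)" for W
  have "Q C"
  proof (rule grow_connected[OF conn fin l(3)])
    show "set l \<noteq> {}" using r by auto
    have "epow E r (\<Sum>v\<leftarrow>l. pm_ev v)"
    proof -
      have "epow E r (\<Sum>v\<leftarrow>butlast l. pm_ev v)"
      proof (rule epow_walk)
        show "successively (\<lambda>a b. {a, b} \<in> E) (butlast l)"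
          using walk by (cases l rule: rev_cases) (auto simp: successively_append_iff)
      qed (simp add: r)
      moreover have "(\<Sum>v\<leftarrow>l. pm_ev v) = (\<Sum>v\<leftarrow>butlast l. pm_ev v) + pm_ev (last l)"
        using r by (cases l rule: rev_cases) auto
      ultimately show ?thesis by (simp add: epow_mono)
    qed
    moreover have "epow E (Suc r) ((\<Sum>v\<leftarrow>l. pm_ev v) + pm_ev v)" if v: "v \<in> set l" for v
    proof -
      obtain m where m: "successively (\<lambda>a b. {a, b} \<in> E) (v # m @ [v])"
        "length l = Suc (length m)" "(\<Sum>v\<leftarrow>l. pm_ev v) = (\<Sum>v\<leftarrow>v # m. pm_ev v)"
        using rot[OF v] by blast
      have "epow E (Suc r) (\<Sum>v\<leftarrow>v # m @ [v]. pm_ev v)"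
        using m(2) by (intro epow_walk m(1)) (simp add: r)
      then show ?thesis by (simp add: m(3) ac_simps)
    qed
    ultimately have "good (set l) r (\<Sum>v\<leftarrow>l. pm_ev v)"
      using l(3) fin by (simp add: good_def wt_walk keys_walk r)
    moreover have "r + 2 \<le> card (set l)" using distinct_card[OF l(4)] r \<open>r \<noteq> 0\<close> by simp
    moreover have "\<exists>z\<in>set l. {w, z} \<in> E" if w: "w \<in> set l" for w
    proof -
      obtain m where m: "successively (\<lambda>a b. {a, b} \<in> E) (w # m @ [w])"
        "length l = Suc (length m)" "set l = set (w # m)"
        using rot[OF w] by blast
      then obtain z m' where "m = z # m'" using r \<open>r \<noteq> 0\<close> by (cases m) auto
      then show ?thesis using m(1,3) by auto
    qed
    ultimately show "Q (set l)" unfolding Q_def by blast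
  next
    fix W a b assume W: "W \<subseteq> C" "W \<noteq> {}" "Q W" and a: "a \<in> W" and b: "b \<in> C" "b \<notin> W" "{a, b} \<in> E"
    have finW: "finite W" using W(1) fin finite_subset by blast
    obtain u t where u: "good W t u" "t + 2 \<le> card W" using W(3) by (auto simp: Q_def)
    obtain z where z: "z \<in> W" "{a, z} \<in> E" using W(3) a by (auto simp: Q_def)
    let ?u = "u + pm_ev a + pm_ev z"
    have g: "good W (Suc t) ?u" using add_edge[OF u(1) z(2)] a z W(1) by auto
    have "epow E (Suc t) (u + pm_ev z)" using u(1) z(1) by (auto simp: good_def)
    from epow_Suc[OF this b(3)] have "epow E (Suc (Suc t)) (?u + pm_ev b)" by (simp add: ac_simps)
    then have "good (insert b W) (Suc t) ?u" using g by (simp add: good_def)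
    moreover have "Suc t + 2 \<le> card (insert b W)" using u(2) finW b(2) by simp
    moreover have "\<forall>w\<in>insert b W. \<exists>z\<in>insert b W. {w, z} \<in> E"
      using W(3) a b(3) unfolding Q_def by (metis insert_commute insert_iff)
    ultimately show "Q (insert b W)" unfolding Q_def by blast
  qed
  then obtain s u where su: "s + 2 \<le> card C" "good C s u" by (auto simp: Q_def)
  obtain a z where az: "a \<in> C" "z \<in> C" "{a, z} \<in> E"
  proof -
    have "hd l \<in> C" using r l(3) by (cases l) auto
    moreover from this obtain z where "z \<in> C" "{hd l, z} \<in> E" using \<open>Q C\<close> by (auto simp: Q_def)
    ultimately show thesis by (rule that)
  qed
  have "s \<le> t" using su(1) t by simp
  then have "\<exists>u. good C t u"
  proof (induction rule: dec_induct)
    case (step m)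
    then show ?case using add_edge[OF _ az(3,1,2)] by blast
  qed (use su(2) in blast)
  then show ?thesis using su(1) by (auto simp: good_def)
qed

section \<open>Depth and Stanley depth of powers of edge ideals\<close>

lemma epow_degree: "epow F t a \<Longrightarrow> finite C \<Longrightarrow> (\<And>e. e \<in> F \<Longrightarrow> e \<subseteq> C) \<Longrightarrow> 2 * t \<le> wt a C"
proof (induction rule: epow.induct)
  case (epow_Suc t a x y)
  then have "x \<in> C" "y \<in> C" by auto
  then show ?case using epow_Suc by (simp add: wt_add wt_ev)
qed simp

lemma wt_sum: "wt (sum a S) C = (\<Sum>i\<in>S. wt (a i) C)"
  unfolding wt_def lookup_sum by (rule sum.swap)

locale finite_graph =
  fixes V :: "'v set" and E :: "'v set set"
  assumes graph: "simple_graph V E"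
begin

definition comps :: "'v set set" where
  "comps = component E ` V"

definition bip_comps :: "'v set set" where
  "bip_comps = {C \<in> comps. \<exists>X Y. bipartition (inner_edges E C) C X Y}"

lemma finite_V: "finite V" and edge_sub: "e \<in> E \<Longrightarrow> e \<subseteq> V" and card_edge: "\<forall>e\<in>E. card e = 2"
  using graph by (auto simp: simple_graph_def)

lemma finite_comps: "finite comps"
  by (simp add: comps_def finite_V)

lemma component_subset: "r \<in> V \<Longrightarrow> component E r \<subseteq> V"
proof
  fix v assume r: "r \<in> V" and "v \<in> component E r"
  then obtain p where "reach E r p v" by (auto simp: component_def)
  then show "v \<in> V" using r edge_sub by (induction rule: reach.induct) auto
qed

lemma comps_sub: "C \<in> comps \<Longrightarrow> C \<subseteq> V"
  using component_subset by (auto simp: comps_def)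

lemma finite_comp: "C \<in> comps \<Longrightarrow> finite C"
  using comps_sub finite_V finite_subset by blast

lemma comps_nonempty: "{} \<notin> comps"
  using mem_component by (fastforce simp: comps_def)

lemma comps_eq: "C \<in> comps \<Longrightarrow> D \<in> comps \<Longrightarrow> v \<in> C \<Longrightarrow> v \<in> D \<Longrightarrow> C = D"
  unfolding comps_def by (metis component_eq imageE)

lemma comps_disjoint: "C \<in> comps \<Longrightarrow> D \<in> comps \<Longrightarrow> C \<noteq> D \<Longrightarrow> C \<inter> D = {}"
  using comps_eq by blast

lemma Union_comps: "\<Union> comps = V"
  using comps_sub mem_component by (fastforce simp: comps_def)

lemma edge_in_comp: "e \<in> E \<Longrightarrow> \<exists>C\<in>comps. e \<subseteq> C"
proof -
  assume e: "e \<in> E"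
  then obtain x y where xy: "e = {x, y}" using card_edge by (auto simp: card_2_iff)
  moreover have "x \<in> V" using e edge_sub[OF e] xy by simp
  moreover have "y \<in> component E x"
    using component_edge[OF _ mem_component] e xy by simp
  ultimately show ?thesis using xy mem_component by (fastforce simp: comps_def)
qed

lemma connected_comp: "C \<in> comps \<Longrightarrow> edge_connected E C"
  by (auto simp: comps_def edge_connected_component)

lemma bip_comps_bipartition:
  "C \<in> bip_comps \<Longrightarrow> \<exists>X Y. bipartition (inner_edges E C) C X Y \<and> X \<noteq> {}"
proof -
  assume C: "C \<in> bip_comps"
  then obtain X Y where b: "bipartition (inner_edges E C) C X Y" by (auto simp: bip_comps_def)
  show ?thesis
  proof (cases "X = {}")
    case True
    moreover have "C \<noteq> {}" using C comps_nonempty by (auto simp: bip_comps_def)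
    ultimately show ?thesis using b
      by (intro exI[of _ Y] exI[of _ "{}"]) (auto simp: bipartition_def)
  qed (use b in blast)
qed

lemma not_bip_odd_walk:
  assumes "C \<in> comps" "C \<notin> bip_comps"
  obtains l where "odd (length l)" "closed_walk E l" "set l \<subseteq> C"
proof -
  obtain r where "C = component E r" using assms(1) by (auto simp: comps_def)
  then have "\<exists>l. odd (length l) \<and> closed_walk E l \<and> set l \<subseteq> C"
    using bipartition_or_odd_closed_walk[OF card_edge, of r] assms by (auto simp: bip_comps_def)
  then show thesis using that by blast
qed

lemma sum_card_comps: "(\<Sum>C\<in>comps. card C) = card V"
proof -
  have "card (\<Union> comps) = (\<Sum>C\<in>comps. card C)"
    by (rule card_Union_disjoint) (auto simp: pairwise_def disjnt_def comps_disjoint finite_comp)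
  then show ?thesis by (simp add: Union_comps)
qed

theorem sdepth_ge:
  assumes "k \<ge> 1"
  shows "enat (card bip_comps)
    \<le> sdepth V (quot_module (mpoly_ring V) (monomial_ideal V (epow E k) :: ('v, 'k::field) mpoly set))
        (quot_grading V (monomial_ideal V (epow E k)))"
proof -
  have bip: "\<exists>X Y. bipartition (inner_edges E C) C X Y" if "C \<in> bip_comps" for C
    using that by (auto simp: bip_comps_def)
  have sub: "bip_comps \<subseteq> comps" by (auto simp: bip_comps_def)
  have "\<exists>(base :: ('v \<Rightarrow>\<^sub>0 nat) \<Rightarrow> 'v \<Rightarrow>\<^sub>0 nat) free.
    finite ((\<lambda>a. (base a, free a)) ` {a. Poly_Mapping.keys a \<subseteq> V}) \<and>
    (\<forall>a. Poly_Mapping.keys (base a) \<subseteq> V \<and> free a \<subseteq> V \<and> card bip_comps \<le> card (free a)) \<and>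
    (\<forall>a. Poly_Mapping.keys a \<subseteq> V \<longrightarrow> a \<in> cone (base a) (free a) \<and>
       (\<forall>b\<in>cone (base a) (free a).
          base b = base a \<and> free b = free a \<and> (epow E k b \<longleftrightarrow> epow E k a)))"
    by (rule cone_partition_complement[where \<C> = comps, OF finite_V assms card_edge _ _ _ comps_nonempty sub])
      (erule edge_in_comp | rule comps_eq, assumption+ | erule comps_sub | erule bip)+
  then obtain base :: "('v \<Rightarrow>\<^sub>0 nat) \<Rightarrow> 'v \<Rightarrow>\<^sub>0 nat" and free where part:
    "finite ((\<lambda>a. (base a, free a)) ` {a. Poly_Mapping.keys a \<subseteq> V})"
    "\<forall>a. Poly_Mapping.keys (base a) \<subseteq> V \<and> free a \<subseteq> V \<and> card bip_comps \<le> card (free a)"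
    "\<forall>a. Poly_Mapping.keys a \<subseteq> V \<longrightarrow> a \<in> cone (base a) (free a) \<and>
       (\<forall>b\<in>cone (base a) (free a).
          base b = base a \<and> free b = free a \<and> (epow E k b \<longleftrightarrow> epow E k a))"
    by (elim exE conjE) (rule that)
  show ?thesis
  proof (rule sdepth_ge_of_cones)
    show "finite ((\<lambda>a. (base a, free a)) ` {a. Poly_Mapping.keys a \<subseteq> V \<and> \<not> epow E k a})"
      by (rule finite_subset[OF _ part(1)]) auto
    show "epow E k (a + b)" if "epow E k a" for a b using that by (rule epow_mono)
    fix a assume a: "Poly_Mapping.keys a \<subseteq> V" "\<not> epow E k a"
    show "Poly_Mapping.keys (base a) \<subseteq> V" "free a \<subseteq> V \<and> card bip_comps \<le> card (free a)"
      using part(2) by simp_all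
    note pa = part(3)[rule_format, OF a(1)]
    show "a \<in> cone (base a) (free a)" by (rule conjunct1[OF pa])
    show "\<not> epow E k b \<and> base b = base a \<and> free b = free a" if "b \<in> cone (base a) (free a)" for b
      using bspec[OF conjunct2[OF pa] that] a(2) by blast
  qed
qed

text \<open>The weights are the upper bounds that keep the product of \<open>u\<close> with a
  one-sided monomial out of the next power; the last conjuncts are the generators to be put into
  it.\<close>

definition colon_witness :: "nat \<Rightarrow> ('v set \<Rightarrow> 'v set) \<Rightarrow> ('v set \<Rightarrow> 'v set) \<Rightarrow> 'v set \<Rightarrow> ('v \<Rightarrow>\<^sub>0 nat) \<Rightarrow> bool"
  where
  "colon_witness t X Y C u \<longleftrightarrow> Poly_Mapping.keys u \<subseteq> C \<and> epow E t u \<and>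
     (if C \<in> bip_comps
      then wt u (X C) = t \<and> wt u (Y C) = t \<and>
           (\<forall>x\<in>X C. \<forall>y\<in>Y C. epow E (Suc t) (u + pm_ev x + pm_ev y))
      else wt u C = 2 * t + 1 \<and> (\<forall>v\<in>C. epow E (Suc t) (u + pm_ev v)))"

lemma exists_colon_witness:
  assumes C: "C \<in> comps" "card C \<ge> 2" "t \<ge> card C - 2"
    and XY: "C \<in> bip_comps \<Longrightarrow> bipartition (inner_edges E C) C (X C) (Y C)"
  shows "\<exists>u. colon_witness t X Y C u"
proof (cases "C \<in> bip_comps")
  case True
  then show ?thesis
    using bipartite_colon_witness[OF connected_comp[OF C(1)] finite_comp[OF C(1)] C(2) XY C(3)]
    by (auto simp: colon_witness_def)
next
  case False
  obtain l where "odd (length l)" "closed_walk E l" "set l \<subseteq> C"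
    using not_bip_odd_walk[OF C(1) False] by blast
  from nonbipartite_colon_witness[OF connected_comp[OF C(1)] finite_comp[OF C(1)] card_edge this C(3)]
  show ?thesis using False by (auto simp: colon_witness_def)
qed

lemma card_nonbip: "C \<in> comps \<Longrightarrow> C \<notin> bip_comps \<Longrightarrow> card C \<ge> 2"
  using nonbipartite_colon_witness[OF connected_comp finite_comp card_edge _ _ _ order_refl]
    not_bip_odd_walk by metis

text \<open>Every component with an edge demands \<open>card C - 2\<close>. As there is at least
  one, the demands add up to at most \<open>card V - 2\<close>, hence to at most
  \<open>k - 1\<close>; one component \<open>D\<close> receives all the excess.\<close>

lemma distribute_exponent:
  assumes k: "k \<ge> card V - 1" "k \<ge> 1" and ne: "{C \<in> comps. card C \<ge> 2} \<noteq> {}"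
  obtains t :: "'v set \<Rightarrow> nat" where "(\<Sum>C\<in>{C \<in> comps. card C \<ge> 2}. t C) = k - 1"
    "\<And>C. C \<in> comps \<Longrightarrow> card C \<ge> 2 \<Longrightarrow> t C \<ge> card C - 2"
proof -
  define \<N> where "\<N> = {C \<in> comps. card C \<ge> 2}"
  have fin: "finite \<N>" using finite_comps by (simp add: \<N>_def)
  obtain D where D: "D \<in> \<N>" using ne by (auto simp: \<N>_def)
  define s where "s = (\<Sum>C\<in>\<N> - {D}. card C - 2)"
  have "s + card D \<le> (\<Sum>C\<in>\<N>. card C)"
    using fin D unfolding s_def by (simp add: sum.remove[of \<N> D] sum_mono)
  also have "\<dots> \<le> (\<Sum>C\<in>comps. card C)"
    using finite_comps by (intro sum_mono2) (auto simp: \<N>_def)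
  finally have "s + card D \<le> card V" by (simp add: sum_card_comps)
  then have sD: "s + (card D - 2) \<le> k - 1" using D k by (auto simp: \<N>_def)
  define t where "t C = (if C = D then k - 1 - s else card C - 2)" for C
  have "(\<Sum>C\<in>\<N>. t C) = t D + (\<Sum>C\<in>\<N> - {D}. t C)" using fin D by (rule sum.remove)
  also have "(\<Sum>C\<in>\<N> - {D}. t C) = s" unfolding s_def by (intro sum.cong) (auto simp: t_def)
  finally have "(\<Sum>C\<in>\<N>. t C) = k - 1" using sD by (simp add: t_def)
  then show thesis
  proof (rule that[of t, folded \<N>_def])
    show "t C \<ge> card C - 2" for C using sD by (auto simp: t_def)
  qed
qed

text \<open>The Koszul class is built on a monomial \<open>u\<close> such that \<open>I\<^sup>k : u\<close> is generated by the variables of the nonbipartite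
  components and the products \<open>x y\<close> with \<open>x\<close>, \<open>y\<close> on different sides of a bipartite component.\<close>

theorem depth_le:
  assumes k: "k \<ge> card V - 1" "k \<ge> 1"
  shows "depth (mpoly_ring V) (max_ideal V)
      (quot_module (mpoly_ring V) (monomial_ideal V (epow E k) :: ('v, 'k::field) mpoly set))
    \<le> enat (card bip_comps)"
proof -
  let ?J = "monomial_ideal V (epow E k) :: ('v, 'k) mpoly set"
  have bsub: "bip_comps \<subseteq> comps" by (auto simp: bip_comps_def)
  have "\<forall>C\<in>bip_comps. \<exists>X Y. bipartition (inner_edges E C) C X Y \<and> X \<noteq> {}"
    using bip_comps_bipartition by blast
  then obtain X Y where XY: "\<And>C. C \<in> bip_comps \<Longrightarrow> bipartition (inner_edges E C) C (X C) (Y C)"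
    "\<And>C. C \<in> bip_comps \<Longrightarrow> X C \<noteq> {}"
    by metis
  have XYC: "C = X C \<union> Y C" "X C \<inter> Y C = {}" "finite (X C)" "finite (Y C)" if "C \<in> bip_comps" for C
  proof -
    show "C = X C \<union> Y C" "X C \<inter> Y C = {}" using XY(1)[OF that] by (simp_all add: bipartition_def)
    then show "finite (X C)" "finite (Y C)" using finite_comp[of C] bsub that by (metis finite_Un subsetD)+
  qed
  define \<N> where "\<N> = {C \<in> comps. card C \<ge> 2}"
  have finN: "finite \<N>" using finite_comps by (simp add: \<N>_def)
  \<comment> \<open>If no component has an edge, there is nothing to distribute and \<open>u\<close>
    will be 0; the condition on the sum is then void.\<close>
  obtain t :: "'v set \<Rightarrow> nat" where t: "\<N> \<noteq> {} \<Longrightarrow> (\<Sum>C\<in>\<N>. t C) = k - 1"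
    "\<And>C. C \<in> \<N> \<Longrightarrow> t C \<ge> card C - 2"
  proof (cases "\<N> = {}")
    case False
    from distribute_exponent[OF k False[unfolded \<N>_def]] show thesis
      using that unfolding \<N>_def by (metis (no_types, lifting) mem_Collect_eq)
  qed (use that in auto)
  have "\<forall>C\<in>\<N>. \<exists>u. colon_witness (t C) X Y C u"
    using exists_colon_witness[of _ _ X Y] t(2) XY(1) by (auto simp: \<N>_def)
  then obtain w where w: "\<And>C. C \<in> \<N> \<Longrightarrow> colon_witness (t C) X Y C (w C)" by metis
  define u where "u = (\<Sum>C\<in>\<N>. w C)"
  have NV: "C \<in> comps" "C \<subseteq> V" if "C \<in> \<N>" for C using that comps_sub by (auto simp: \<N>_def)
  have wt_u: "wt u A = (if C \<in> \<N> then wt (w C) A else 0)" if C: "C \<in> comps" "A \<subseteq> C" for A C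
  proof -
    have "wt u A = (\<Sum>D\<in>\<N>. wt (w D) A)" by (simp add: u_def wt_sum)
    also have "\<dots> = (\<Sum>D\<in>\<N>. if D = C then wt (w C) A else 0)"
    proof (intro sum.cong refl)
      fix D assume D: "D \<in> \<N>"
      have "wt (w D) A = 0" if "D \<noteq> C"
        using comps_disjoint[OF NV(1)[OF D] C(1) that] w[OF D] C(2)
        by (intro wt_eq_0) (auto simp: colon_witness_def)
      then show "wt (w D) A = (if D = C then wt (w C) A else 0)" by simp
    qed
    also have "\<dots> = (if C \<in> \<N> then wt (w C) A else 0)" using finN by simp
    finally show ?thesis .
  qed
  \<comment> \<open>The witnesses together hold \<open>k - 1\<close> edges, so gaining one edge in a
    single component reaches the power \<open>k\<close>.\<close>
  have mem: "epow E k (u + a)" if C: "C \<in> \<N>" "epow E (Suc (t C)) (w C + a)" for C a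
  proof -
    have "epow E (\<Sum>D\<in>\<N> - {C}. t D) (\<Sum>D\<in>\<N> - {C}. w D)"
      using finN w by (intro epow_sum) (auto simp: colon_witness_def)
    from epow_add[OF C(2) this] have "epow E (Suc (\<Sum>D\<in>\<N>. t D)) (u + a)"
      using sum.remove[OF finN C(1), of t] sum.remove[OF finN C(1), of w]
      by (simp add: u_def ac_simps)
    moreover have "Suc (\<Sum>D\<in>\<N>. t D) = k" using t(1) C(1) k(2) by fastforce
    ultimately show ?thesis by simp
  qed
  have big: "C \<in> \<N>" if "C \<in> comps" "C \<notin> bip_comps" for C
    using that card_nonbip by (simp add: \<N>_def)
  obtain Cs where Cs: "set Cs = bip_comps" "distinct Cs"
    using finite_distinct_list[of bip_comps] finite_comps bsub finite_subset by metis
  interpret mpoly_quotient V ?J by unfold_locales (rule ideal_set_epow)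
  have "mp.koszul_nonvanishing V (xvar V) (length Cs) ?J"
  proof (rule koszul_nonvanishing_blocks[where X = X and Y = Y and u = u])
    show "finite V" by (rule finite_V)
    show "epow E k (a + b)" if "epow E k a" for a b using that by (rule epow_mono)
    show "distinct Cs" by (rule Cs)
    show "C \<subseteq> V" if "C \<in> set Cs" for C using that Cs bsub comps_sub by auto
    show "C = X C \<union> Y C \<and> X C \<inter> Y C = {}" "X C \<noteq> {}" if "C \<in> set Cs" for C
      using that Cs XYC[of C] XY(2) by simp_all
    show "C \<inter> D = {}" if "C \<in> set Cs" "D \<in> set Cs" "C \<noteq> D" for C D
      using comps_disjoint[of C D] that Cs bsub by blast
    show "Poly_Mapping.keys u \<subseteq> V"
    proof
      fix v assume "v \<in> Poly_Mapping.keys u"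
      then have "(\<Sum>C\<in>\<N>. lk (w C) v) \<noteq> 0" by (simp add: u_def in_keys_iff lookup_sum)
      then obtain C where "C \<in> \<N>" "v \<in> Poly_Mapping.keys (w C)"
        by (meson in_keys_iff sum.neutral)
      then show "v \<in> V" using w[of C] NV(2)[of C] by (auto simp: colon_witness_def)
    qed
  next
    fix C assume C: "C \<in> set Cs" "Y C = {}"
    then have Cc: "C \<in> bip_comps" "C \<in> comps" using Cs bsub by auto
    have no_edge: "{a, b} \<notin> E" if "a \<in> C" "b \<in> C" for a b
    proof
      assume "{a, b} \<in> E"
      then have "{a, b} \<in> inner_edges E C" using that by (simp add: inner_edges_def)
      then show False using XY(1)[OF Cc(1)] C(2) by (auto simp: bipartition_def)
    qed
    obtain v where v: "v \<in> C" using Cc comps_nonempty by fastforce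
    have "C = {v}"
    proof (rule ccontr)
      assume "C \<noteq> {v}"
      then show False
        using connected_comp[OF Cc(2)] v no_edge unfolding edge_connected_def
        by (metis DiffE empty_subsetI insert_not_empty insert_subset singletonD)
    qed
    moreover from this have "C \<notin> \<N>" by (simp add: \<N>_def)
    ultimately show "\<exists>v. C = {v} \<and> lk u v = 0"
      using wt_u[OF Cc(2), of "{v}"] by (auto simp: wt_def)
  next
    fix C a b assume C: "C \<in> set Cs" and ab: "a \<in> X C" "b \<in> Y C"
    then have Cb: "C \<in> bip_comps" using Cs by simp
    have ne: "a \<noteq> b" and sub: "{a, b} \<subseteq> C" using XYC[OF Cb] ab by auto
    have "card {a, b} \<le> card C" using card_mono[OF _ sub] finite_comp[of C] Cb bsub by blast
    moreover have "card {a, b} = 2" using ne by simp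
    ultimately have "C \<in> \<N>" using Cb bsub by (auto simp: \<N>_def)
    moreover from w[OF this] have "epow E (Suc (t C)) (w C + (pm_ev a + pm_ev b))"
      using Cb ab by (simp add: colon_witness_def add.assoc)
    ultimately have "epow E k (u + (pm_ev a + pm_ev b))" by (rule mem)
    then show "epow E k (u + pm_ev a + pm_ev b)" by (simp add: add.assoc)
  next
    fix v assume v: "v \<in> V" "v \<notin> \<Union> (set Cs)"
    then obtain C where C: "C \<in> comps" "v \<in> C" using Union_comps by blast
    then have "C \<notin> bip_comps" using v Cs by auto
    then show "epow E k (u + pm_ev v)"
      using mem[of C "pm_ev v"] w[of C] big C by (auto simp: colon_witness_def)
  next
    fix \<epsilon> :: "'v \<Rightarrow>\<^sub>0 nat" assume \<epsilon>: "Poly_Mapping.keys \<epsilon> \<subseteq> \<Union> (set Cs)"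
      "\<And>C. C \<in> set Cs \<Longrightarrow> Poly_Mapping.keys \<epsilon> \<inter> X C = {} \<or> Poly_Mapping.keys \<epsilon> \<inter> Y C = {}"
    show "\<not> epow E k (u + \<epsilon>)"
    proof
      assume "epow E k (u + \<epsilon>)"
      from epow_split[OF this finite_comps edge_in_comp] obtain f where f: "sum f comps = k"
        "\<And>C. C \<in> comps \<Longrightarrow> epow (inner_edges E C) (f C) (u + \<epsilon>)" by blast
      \<comment> \<open>No component can hold more edges than its share \<open>t C\<close>, so all
        together hold at most \<open>k - 1\<close>.\<close>
      have f_le: "f C \<le> (if C \<in> \<N> then t C else 0)" if C: "C \<in> comps" for C
      proof (cases "C \<in> \<N>")
        case N: True
        show ?thesis
        proof (cases "C \<in> bip_comps")
          case True
          \<comment> \<open>Both sides are covers, and \<open>\<epsilon>\<close> misses one of them,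
            whose weight therefore remains \<open>t C\<close>.\<close>
          have cov: "vertex_cover (inner_edges E C) (X C)" "vertex_cover (inner_edges E C) (Y C)"
            using XY(1)[OF True] by (force simp: vertex_cover_def bipartition_def)+
          have wu: "wt u (X C) = t C" "wt u (Y C) = t C"
            using wt_u[OF C, of "X C"] wt_u[OF C, of "Y C"] w[OF N] XYC(1)[OF True] N True
            by (auto simp: colon_witness_def)
          have "f C \<le> wt (u + \<epsilon>) (X C)" "f C \<le> wt (u + \<epsilon>) (Y C)"
            using epow_wt_le[OF cov(1) _ f(2)[OF C]] epow_wt_le[OF cov(2) _ f(2)[OF C]] XYC[OF True]
            by blast+
          moreover have "wt \<epsilon> (X C) = 0 \<or> wt \<epsilon> (Y C) = 0"
          proof -
            have "C \<in> set Cs" using True Cs(1) by simp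
            from \<epsilon>(2)[OF this] show ?thesis by (elim disjE) (simp_all add: wt_eq_0)
          qed
          ultimately show ?thesis using wu N by (auto simp: wt_add)
        next
          case False
          have "Poly_Mapping.keys \<epsilon> \<inter> C = {}"
            using \<epsilon>(1) comps_disjoint[OF _ C] Cs False bsub by blast
          \<comment> \<open>The factor \<open>\<epsilon>\<close> does not touch a nonbipartite
            component, and degree \<open>2 * t C + 1\<close> has room for only \<open>t C\<close>
            edges.\<close>
          then have "wt (u + \<epsilon>) C = 2 * t C + 1"
            using wt_u[OF C order_refl] w[OF N] N False wt_eq_0[of \<epsilon> C]
            by (simp add: wt_add colon_witness_def)
          moreover have "2 * f C \<le> wt (u + \<epsilon>) C"
            by (rule epow_degree[OF f(2)[OF C] finite_comp[OF C]]) (auto simp: inner_edges_def)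
          ultimately show ?thesis using N by simp
        qed
      next
        case False
        have "inner_edges E C = {}"
        proof (rule ccontr)
          assume "inner_edges E C \<noteq> {}"
          then obtain e where "e \<in> E" "e \<subseteq> C" by (auto simp: inner_edges_def)
          then have "2 \<le> card C" using card_edge card_mono[OF finite_comp[OF C], of e] by auto
          then show False using False C by (simp add: \<N>_def)
        qed
        then have "vertex_cover (inner_edges E C) {}" by (simp add: vertex_cover_def)
        from epow_wt_le[OF this _ f(2)[OF C]] show ?thesis by (simp add: wt_def)
      qed
      have "k \<le> (\<Sum>C\<in>comps. if C \<in> \<N> then t C else 0)"
        using sum_mono[of comps f, OF f_le] f(1) by simp
      also have "\<dots> = (\<Sum>C\<in>\<N>. t C)"
        using finite_comps by (simp add: sum.If_cases \<N>_def Int_def cong: conj_cong)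
      also have "\<dots> \<le> k - 1" using t(1) by (cases "\<N> = {}") auto
      finally show False using k(2) by simp
    qed
  qed
  moreover have "1 \<notin> ?J"
  proof
    assume "1 \<in> ?J"
    then have "\<forall>a\<in>Poly_Mapping.keys (1 :: ('v, 'k) mpoly). epow E k a"
      unfolding monomial_ideal_def by (elim CollectE conjE)
    then have "epow E k 0" by simp
    from epow_degree[OF this finite_V] have "2 * k \<le> wt 0 V" using edge_sub by simp
    then show False using k(2) by (simp add: wt_def)
  qed
  moreover have "length Cs = card bip_comps" using Cs distinct_card by metis
  ultimately show ?thesis using depth_le_of_koszul[OF finite_V] by simp
qed

end

theorem corollary2p5:
  fixes V :: "'v set" and E :: "'v set set"
    and I :: "('v, 'k::field) mpoly set" and n k :: nat
  assumes "simple_graph V E" and "n = card V" and "n \<ge> 1"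
    and "I = edge_ideal V E"
    and "k \<ge> n - 1"
  shows "stanley_inequality V
           (quot_module (mpoly_ring V) (ideal_power (mpoly_ring V) I k))
           (quot_grading V (ideal_power (mpoly_ring V) I k))"
proof -
  interpret finite_graph V E by unfold_locales (rule assms(1))
  have J: "ideal_power (mpoly_ring V) I k = monomial_ideal V (epow E k)"
    unfolding assms(4) by (rule ideal_power_edge_ideal) (rule edge_sub)
  let ?J = "monomial_ideal V (epow E k) :: ('v, 'k) mpoly set"
  let ?s = "sdepth V (quot_module (mpoly_ring V) ?J) (quot_grading V ?J)"
  show ?thesis
  proof (cases "k = 0")
    case True
    \<comment> \<open>For \<open>k = 0\<close> the quotient is zero: no exponent lies outside the
      ideal, so the empty family of cones gives every lower bound.\<close>
    have "enat d \<le> ?s" for d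
      by (rule sdepth_ge_of_cones) (simp_all add: True epow_0)
    then have "?s = \<infinity>" by (metis enat_ord_simps(1) not_enat_eq not_less_eq_eq order_refl)
    then show ?thesis unfolding stanley_inequality_def J by simp
  next
    case False
    then have "k \<ge> 1" by simp
    moreover have "k \<ge> card V - 1" using assms(2,5) by simp
    ultimately show ?thesis
      unfolding stanley_inequality_def J using depth_le sdepth_ge by (blast intro: order_trans)
  qed
qed

end
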